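(* Let $N\ge2$, let $K$ be the $N$-dimensional Sierpinski gasket, let $\gamma_N=\log_2\frac{\sqrt{4N+5}+1}{\sqrt{4N+5}-1}$, and let $w\in W_*$. For distinct $i,j\in S$, $h\in\mathcal H$ and $x\in\psi_w(\overline{p_ip_j})$ consider the condition $$\limsup_{y\in\psi_w(\overline{p_ip_j})\setminus\{x\},\ y\to x}\frac{\left|\frac{\delta\nu_h}{\delta\nu}(y)-\frac{\delta\nu_h}{\delta\nu}(x)\right|}{|y-x|^{\gamma_N}}>0,\qquad(\ast)$$ where $\frac{\delta\nu_h}{\delta\nu}$ is the canonical edge trace on $\psi_w(\overline{p_ip_j})$. (i) For any nonconstant $h\in\mathcal H$, there exist distinct $i,j\in S$ and $x\in\psi_w(\overline{p_ip_j})$ such that $(\ast)$ holds. (ii) For any distinct $i,j\in S$, there exist $h\in\mathcal H$ and $x\in\psi_w(\overline{p_ip_j})$ such that $(\ast)$ holds.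
   Context: Let $N\ge 2$ be an integer and $S=\{1,2,\dots,N+1\}$. Let $V_0=\{p_1,\dots,p_{N+1}\}$ be the vertex set of a (nondegenerate) closed $N$-simplex in $\mathbb R^N$, and let $\psi_i(z)=(z+p_i)/2$ for $i\in S$. The $N$-dimensional Sierpinski gasket $K$ is the unique nonempty compact subset of $\mathbb R^N$ with $K=\bigcup_{i\in S}\psi_i(K)$; it carries the Euclidean metric. Let $W_m=S^m$ (words of length $m$; $W_0=\{\emptyset\}$), $W_*=\bigcup_{m\ge0}W_m$, $\psi_w=\psi_{w_1}\circ\cdots\circ\psi_{w_m}$ for $w=w_1\cdots w_m$ ($\psi_\emptyset=\mathrm{id}$), and $K_w=\psi_w(K)$. Concatenation of words is written $ww'$. For $\omega=\omega_1\omega_2\cdots\in S^{\mathbb N}$, $[\omega]_n=\omega_1\cdots\omega_n\in W_n$ (with $[\omega]_0=\emptyset$). For $p,p'\in K$, $\overline{pp'}$ is the line segment connecting $p$ and $p'$. For $w\in W_*$, distinct $i,j\in S$ and $\omega\in\{i,j\}^{\mathbb N}$, $\Psi_w(\omega)$ denotes the unique point $x$ with $\bigcap_{n\ge0}K_{w[\omega]_n}=\{x\}$; it lies in $\psi_w(\overline{p_ip_j})$, and $\Psi_w:\{i,j\}^{\mathbb N}\to\psi_w(\overline{p_ip_j})$ is surjective. Energy form: for $f:V_0\to\mathbb R$ put $Q_0(f,f)=\frac12\sum_{i,j\in S}(f(p_i)-f(p_j))^2$. For $f\in C(K)$ the sequence $\left(\frac{N+3}{N+1}\right)^m\sum_{w\in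 W_m}Q_0(f\circ\psi_w|_{V_0},f\circ\psi_w|_{V_0})$ is nondecreasing in $m$; its limit is $\mathcal E(f,f)\in[0,\infty]$. Let $\mathcal F=\{f\in C(K)\mid\mathcal E(f,f)<\infty\}$ (real-valued functions) and define $\mathcal E(f,g)$ for $f,g\in\mathcal F$ by polarization, $\mathcal E(f,g)=\frac12\{\mathcal E(f+g,f+g)-\mathcal E(f,f)-\mathcal E(g,g)\}$. Energy measure: for $f\in\mathcal F$, $\nu_f$ is the unique positive Borel measure on $K$ with $\int_K g\,\mathrm d\nu_f=2\mathcal E(f,fg)-\mathcal E(f^2,g)$ for every $g\in\mathcal F$. Harmonic functions: for every $u:V_0\to\mathbb R$ there is a unique $h\in\mathcal F$ with $h|_{V_0}=u$ and $\mathcal E(h,h)=\inf\{\mathcal E(f,f)\mid f\in\mathcal F,\ f|_{V_0}=u\}$; such $h$ is called harmonic, and $\mathcal H$ is the space of harmonic functions. For $k\in S$, $h_k\in\mathcal H$ is the harmonic function with $h_k(p_k)=1$ and $h_k(p_i)=0$ for $i\ne k$. Kusuoka measure: $\nu=\sum_{k\in S}\nu_{h_k}$. Canonical edge trace: for $h\in\mathcal H$, $w\in W_*$, distinct $i,j\in S$ and $\omega\in\{i,j\}^{\mathbb N}$, the limit $\delta_{h,w}(\omega)=\lim_{n\to\infty}\nu_h(K_{w[\omega]_n})/\nu(K_{w[\omega]_n})$ exists and depends only on the point $\Psi_w(\omega)$; the canonical edge trace is the function on $\psi_w(\overline{p_ip_j})$ defined by $\frac{\delta\nu_h}{\delta\nu}(x)=\delta_{h,w}(\omega)$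 for $x=\Psi_w(\omega)$. *)

theory Defs
  imports "HOL-Analysis.Analysis"
begin

text \<open>
  Throughout, \<open>p 1, \<dots>, p (N + 1)\<close> are the vertices of the simplex (values of \<open>p\<close> at other indices
  are irrelevant). Functions on the gasket \<open>K\<close> are represented by total functions of which only the
  values on \<open>K\<close> matter.
\<close>

definition letters :: "nat \<Rightarrow> nat set" where
  "letters N = {1..N + 1}"

definition words :: "nat \<Rightarrow> nat list set" where
  "words N = lists (letters N)"

definition words_len :: "nat \<Rightarrow> nat \<Rightarrow> nat list set" where
  "words_len N m = {w \<in> words N. length w = m}"

definition cmap :: "(nat \<Rightarrow> real ^ 'n) \<Rightarrow> nat \<Rightarrow> real ^ 'n \<Rightarrow> real ^ 'n" where
  "cmap p i z = (z + p i) /\<^sub>R 2"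

definition psi :: "(nat \<Rightarrow> real ^ 'n) \<Rightarrow> nat list \<Rightarrow> real ^ 'n \<Rightarrow> real ^ 'n" where
  "psi p w = foldr (\<lambda>i g. cmap p i \<circ> g) w id"

definition gasket :: "nat \<Rightarrow> (nat \<Rightarrow> real ^ 'n) \<Rightarrow> (real ^ 'n) set" where
  "gasket N p = (THE K. compact K \<and> K \<noteq> {} \<and> K = (\<Union>i\<in>letters N. cmap p i ` K))"

definition cell :: "nat \<Rightarrow> (nat \<Rightarrow> real ^ 'n) \<Rightarrow> nat list \<Rightarrow> (real ^ 'n) set" where
  "cell N p w = psi p w ` gasket N p"

definition edge :: "(nat \<Rightarrow> real ^ 'n) \<Rightarrow> nat list \<Rightarrow> nat \<Rightarrow> nat \<Rightarrow> (real ^ 'n) set" where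
  "edge p w i j = psi p w ` closed_segment (p i) (p j)"

definition Q0 :: "nat \<Rightarrow> (nat \<Rightarrow> real ^ 'n) \<Rightarrow> (real ^ 'n \<Rightarrow> real) \<Rightarrow> real" where
  "Q0 N p f = 1 / 2 * (\<Sum>i\<in>letters N. \<Sum>j\<in>letters N. (f (p i) - f (p j))\<^sup>2)"

definition level_energy :: "nat \<Rightarrow> (nat \<Rightarrow> real ^ 'n) \<Rightarrow> nat \<Rightarrow> (real ^ 'n \<Rightarrow> real) \<Rightarrow> real" where
  "level_energy N p m f =
     ((real N + 3) / (real N + 1)) ^ m * (\<Sum>w\<in>words_len N m. Q0 N p (f \<circ> psi p w))"

definition energy :: "nat \<Rightarrow> (nat \<Rightarrow> real ^ 'n) \<Rightarrow> (real ^ 'n \<Rightarrow> real) \<Rightarrow> ennreal" where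
  "energy N p f = lim (\<lambda>m. ennreal (level_energy N p m f))"

definition energy_domain :: "nat \<Rightarrow> (nat \<Rightarrow> real ^ 'n) \<Rightarrow> (real ^ 'n \<Rightarrow> real) set" where
  "energy_domain N p = {f. continuous_on (gasket N p) f \<and> energy N p f < \<infinity>}"

definition energy_form ::
    "nat \<Rightarrow> (nat \<Rightarrow> real ^ 'n) \<Rightarrow> (real ^ 'n \<Rightarrow> real) \<Rightarrow> (real ^ 'n \<Rightarrow> real) \<Rightarrow> real" where
  "energy_form N p f g =
     1 / 2 * (enn2real (energy N p (\<lambda>x. f x + g x)) - enn2real (energy N p f) - enn2real (energy N p g))"

text \<open>
  The predicate \<^const>\<open>has_bochner_integral\<close> includes integrability, so testing with \<open>g = 1\<close> forces
  the measure to be finite.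
\<close>

definition energy_measure ::
    "nat \<Rightarrow> (nat \<Rightarrow> real ^ 'n) \<Rightarrow> (real ^ 'n \<Rightarrow> real) \<Rightarrow> (real ^ 'n) measure" where
  "energy_measure N p f =
     (THE M. sets M = sets (restrict_space borel (gasket N p)) \<and>
        (\<forall>g\<in>energy_domain N p. has_bochner_integral M g
           (2 * energy_form N p f (\<lambda>x. f x * g x) - energy_form N p (\<lambda>x. (f x)\<^sup>2) g)))"

definition harmonic :: "nat \<Rightarrow> (nat \<Rightarrow> real ^ 'n) \<Rightarrow> (real ^ 'n \<Rightarrow> real) set" where
  "harmonic N p = {h \<in> energy_domain N p.
     energy N p h = Inf (energy N p ` {f \<in> energy_domain N p. \<forall>i\<in>letters N. f (p i) = h (p i)})}"

text \<open>
  The choice operator is used because the defining conditions determine \<open>h\<^sub>k\<close> only on the gasket;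
  its energy measure does not depend on the values elsewhere.
\<close>

definition harmonic_basis :: "nat \<Rightarrow> (nat \<Rightarrow> real ^ 'n) \<Rightarrow> nat \<Rightarrow> real ^ 'n \<Rightarrow> real" where
  "harmonic_basis N p k =
     (SOME h. h \<in> harmonic N p \<and> (\<forall>i\<in>letters N. h (p i) = (if i = k then 1 else 0)))"

definition kusuoka_measure :: "nat \<Rightarrow> (nat \<Rightarrow> real ^ 'n) \<Rightarrow> (real ^ 'n) measure" where
  "kusuoka_measure N p =
     measure_of (gasket N p) (sets (restrict_space borel (gasket N p)))
       (\<lambda>A. \<Sum>k\<in>letters N. emeasure (energy_measure N p (harmonic_basis N p k)) A)"

text \<open>
  Infinite words are functions \<open>\<omega> :: nat \<Rightarrow> nat\<close> with letters \<open>\<omega> 0, \<omega> 1, \<dots>\<close>, so the prefix of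
  length \<open>n\<close> is \<open>map \<omega> [0..<n]\<close>.
\<close>

definition coding_point ::
    "nat \<Rightarrow> (nat \<Rightarrow> real ^ 'n) \<Rightarrow> nat list \<Rightarrow> (nat \<Rightarrow> nat) \<Rightarrow> real ^ 'n" where
  "coding_point N p w \<omega> = (THE x. (\<Inter>n. cell N p (w @ map \<omega> [0..<n])) = {x})"

definition trace_coded ::
    "nat \<Rightarrow> (nat \<Rightarrow> real ^ 'n) \<Rightarrow> (real ^ 'n \<Rightarrow> real) \<Rightarrow> nat list \<Rightarrow> (nat \<Rightarrow> nat) \<Rightarrow> real" where
  "trace_coded N p h w \<omega> =
     lim (\<lambda>n. measure (energy_measure N p h) (cell N p (w @ map \<omega> [0..<n])) /
              measure (kusuoka_measure N p) (cell N p (w @ map \<omega> [0..<n])))"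

definition edge_trace ::
    "nat \<Rightarrow> (nat \<Rightarrow> real ^ 'n) \<Rightarrow> (real ^ 'n \<Rightarrow> real) \<Rightarrow> nat list \<Rightarrow> nat \<Rightarrow> nat \<Rightarrow> real ^ 'n \<Rightarrow> real" where
  "edge_trace N p h w i j x =
     (THE d. \<exists>\<omega>. range \<omega> \<subseteq> {i, j} \<and> coding_point N p w \<omega> = x \<and> d = trace_coded N p h w \<omega>)"

definition gamma_exp :: "nat \<Rightarrow> real" where
  "gamma_exp N = log 2 ((sqrt (4 * real N + 5) + 1) / (sqrt (4 * real N + 5) - 1))"

text \<open>
  The limit superior is taken in the extended reals since it may be infinite; the filter
  \<open>at x within A\<close> is that of \<open>A - {x}\<close> near \<open>x\<close>.
\<close>

definition edge_limsup ::
    "nat \<Rightarrow> (nat \<Rightarrow> real ^ 'n) \<Rightarrow> (real ^ 'n \<Rightarrow> real) \<Rightarrow> nat list \<Rightarrow> nat \<Rightarrow> nat \<Rightarrow> real ^ 'n \<Rightarrow> ereal" where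
  "edge_limsup N p h w i j x =
     Limsup (at x within edge p w i j)
       (\<lambda>y. ereal (\<bar>edge_trace N p h w i j y - edge_trace N p h w i j x\<bar> / norm (y - x) powr gamma_exp N))"

end

theory Submission
  imports Defs
begin

text \<open>
  Along one edge the canonical trace of an energy measure is governed by a linear system of
  dimension two, and the exponent \<open>\<gamma>\<^sub>N\<close> is read off from its eigenvalues.

  A harmonic function is determined by its boundary values \<open>u\<close>. On the cell of a word \<open>w\<close> it is
  again harmonic, with boundary values \<open>restrs N w u\<close> obtained from \<open>u\<close> by one linear map per
  letter, and its energy measure gives that cell the mass \<open>2 ((N + 3) / (N + 1)) ^ |w|\<close> times the
  graph energy of \<open>restrs N w u\<close> (\<open>measure_energy_measure_cell\<close>). To see this, a measure with these
  cell masses is built as an image of Lebesgue measure on an interval. Its self-similarity shows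
  that it satisfies the identity defining the energy measure, and functions of finite energy are
  uniformly dense in the continuous functions, so no other measure does (\<open>energy_measure_eq\<close>).
  Hence the trace at the point with address \<open>\<omega>\<close> is a limit of quotients of quadratic forms in
  products of restriction maps.

  On the edge between vertices \<open>i\<close> and \<open>j\<close> only these two letters occur. Modulo constants, the
  restriction maps act on the pair formed by \<open>u j - u i\<close> and the sum over the other vertices of the
  deviation from \<open>(u i + u j) / 2\<close>; the remaining part of \<open>u\<close> shrinks by the factor \<open>1 / (N + 3)\<close>.
  Restricting to the cell of \<open>i\<close> and then exchanging the roles of \<open>i\<close> and \<open>j\<close> is a single map with
  eigenvalues \<open>\<mu> / (N + 3)\<close>, where \<open>\<mu>\<^sup>2 + \<mu> = N + 1\<close>, that is \<open>\<mu> = (- 1 \<plusminus> sqrt (4 N + 5)) / 2\<close>. Its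
  eigenfunctionals \<open>l\<^sub>1\<close> (for the root \<open>\<mu>\<^sub>1\<close> of larger modulus) and \<open>l\<^sub>2\<close> are \<open>edge_functional\<close>.

  At the point \<open>x\<close> with address \<open>v i j i j \<dots>\<close> the trace is therefore the quotient of \<open>l\<^sub>1\<^sup>2\<close>, evaluated
  at the restriction of \<open>h\<close>, by the sum of the corresponding values for the basis functions. The
  points \<open>y\<^sub>n\<close> with address \<open>v (i j)\<^sup>n j i j i \<dots>\<close> have distance \<open>C / 4 ^ n\<close> from \<open>x\<close>. Expressing the
  functional of the reversed edge in the eigenbasis shows that the trace at \<open>y\<^sub>n\<close> is obtained by
  replacing \<open>l\<^sub>1\<close> by \<open>l\<^sub>1 + \<epsilon>\<^sub>n l\<^sub>2\<close> in the same quotient, where \<open>\<epsilon>\<^sub>n\<close> is a constant multiple of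
  \<open>(\<mu>\<^sub>2 / \<mu>\<^sub>1) ^ (2 n) = 4 powr (- \<gamma>\<^sub>N n)\<close>. So the difference quotients along \<open>y\<^sub>n\<close> converge to a
  positive multiple of the modulus of the derivative of a rational function at \<open>0\<close>
  (\<open>edge_limsup_pos\<close>).

  This derivative is nonzero unless \<open>l\<^sub>1\<close> lies on one of two lines in the plane of functionals. The
  prefixes \<open>v = []\<close>, \<open>[i]\<close> and \<open>[j]\<close> give three pairwise independent functionals, so one of them
  avoids both lines as soon as \<open>h\<close> takes different values at the two ends of the edge
  (\<open>edge_limsup_pos_of_ends_distinct\<close>). For a nonconstant \<open>h\<close> such an edge exists in every cell
  because restriction is injective modulo constants; for a given edge such an \<open>h\<close> exists because
  restriction is surjective.
\<close>

section \<open>Harmonic extension of boundary values\<close>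

definition boundary_energy :: "nat \<Rightarrow> (nat \<Rightarrow> real) \<Rightarrow> real" where
  "boundary_energy N u = 1 / 2 * (\<Sum>i\<in>letters N. \<Sum>j\<in>letters N. (u i - u j)\<^sup>2)"

text \<open>
  The energy on the first level is smallest when the value at the midpoint of the edge from \<open>i\<close> to
  \<open>k\<close> is the mean of the boundary values with weight \<open>2\<close> at \<open>i\<close> and \<open>k\<close> and weight \<open>1\<close> at all other
  vertices. These are the values of the harmonic function at the vertices of the cell of \<open>i\<close>.
\<close>

definition restr :: "nat \<Rightarrow> nat \<Rightarrow> (nat \<Rightarrow> real) \<Rightarrow> nat \<Rightarrow> real" where
  "restr N i u k = (if k = i then u i else (u i + u k + sum u (letters N)) / (real N + 3))"

lemma finite_letters [simp]: "finite (letters N)"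
  by (simp add: letters_def)

lemma card_letters [simp]: "card (letters N) = N + 1"
  by (simp add: letters_def)

lemma letters_nonempty [simp]: "letters N \<noteq> {}"
  by (simp add: letters_def)

lemma one_in_letters [simp]: "Suc 0 \<in> letters N"
  by (simp add: letters_def)

lemma Q0_eq_boundary_energy: "Q0 N p f = boundary_energy N (\<lambda>i. f (p i))"
  by (simp add: Q0_def boundary_energy_def)

lemma boundary_energy_nonneg: "boundary_energy N u \<ge> 0"
  unfolding boundary_energy_def by (intro mult_nonneg_nonneg sum_nonneg) auto

lemma boundary_energy_cong:
  "(\<And>i. i \<in> letters N \<Longrightarrow> u i = v i) \<Longrightarrow> boundary_energy N u = boundary_energy N v"
  unfolding boundary_energy_def by (intro arg_cong2[where f="(*)"] sum.cong) auto

lemma double_sum_diff_mult: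
  fixes u v :: "'a \<Rightarrow> real"
  assumes "finite A"
  shows "(\<Sum>i\<in>A. \<Sum>j\<in>A. (u i - u j) * (v i - v j)) =
    2 * (real (card A) * (\<Sum>i\<in>A. u i * v i) - sum u A * sum v A)"
proof -
  have "(\<Sum>i\<in>A. \<Sum>j\<in>A. (u i - u j) * (v i - v j)) =
     (\<Sum>i\<in>A. \<Sum>j\<in>A. u i * v i) + (\<Sum>i\<in>A. \<Sum>j\<in>A. u j * v j)
     - (\<Sum>i\<in>A. \<Sum>j\<in>A. u i * v j) - (\<Sum>i\<in>A. \<Sum>j\<in>A. u j * v i)"
    unfolding sum.distrib[symmetric] sum_subtractf[symmetric]
    by (intro sum.cong refl) (simp add: algebra_simps)
  moreover have "(\<Sum>i\<in>A. \<Sum>j\<in>A. u i * v j) = sum u A * sum v A"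
    by (simp add: sum_product)
  moreover have "(\<Sum>i\<in>A. \<Sum>j\<in>A. u j * v i) = sum u A * sum v A"
    by (subst sum.swap) (simp add: sum_product)
  moreover have "(\<Sum>i\<in>A. \<Sum>j\<in>A. u i * v i) = real (card A) * (\<Sum>i\<in>A. u i * v i)"
    by (simp add: sum_distrib_left)
  moreover have "(\<Sum>i\<in>A. \<Sum>j\<in>A. u j * v j) = real (card A) * (\<Sum>i\<in>A. u i * v i)"
    by simp
  ultimately show ?thesis by simp
qed

lemma boundary_energy_expand:
  "boundary_energy N u = (real N + 1) * (\<Sum>i\<in>letters N. (u i)\<^sup>2) - (sum u (letters N))\<^sup>2"
  using double_sum_diff_mult[of "letters N" u u]
  by (simp add: boundary_energy_def power2_eq_square algebra_simps)

lemma boundary_energy_eq_0D: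
  assumes "boundary_energy N u = 0" "i \<in> letters N" "j \<in> letters N"
  shows "u i = u j"
proof -
  have "(\<Sum>i\<in>letters N. \<Sum>j\<in>letters N. (u i - u j)\<^sup>2) = 0"
    using assms(1) by (simp add: boundary_energy_def)
  hence "\<forall>i\<in>letters N. (\<Sum>j\<in>letters N. (u i - u j)\<^sup>2) = 0"
    by (subst (asm) sum_nonneg_eq_0_iff) (auto intro!: sum_nonneg)
  hence "(\<Sum>j\<in>letters N. (u i - u j)\<^sup>2) = 0"
    using assms by auto
  hence "\<forall>j\<in>letters N. (u i - u j)\<^sup>2 = 0"
    by (subst (asm) sum_nonneg_eq_0_iff) auto
  hence "(u i - u j)\<^sup>2 = 0" using assms(3) by blast
  thus ?thesis by simp
qed

lemma boundary_energy_le: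
  assumes "\<And>i j. i \<in> letters N \<Longrightarrow> j \<in> letters N \<Longrightarrow> \<bar>u i - u j\<bar> \<le> c"
  shows "boundary_energy N u \<le> (real N + 1)\<^sup>2 * c\<^sup>2"
proof -
  have c0: "0 \<le> c" using assms[of "Suc 0" "Suc 0"] by simp
  have "(\<Sum>i\<in>letters N. \<Sum>j\<in>letters N. (u i - u j)\<^sup>2) \<le> (\<Sum>i\<in>letters N. \<Sum>j\<in>letters N. c\<^sup>2)"
  proof (intro sum_mono)
    fix i j assume "i \<in> letters N" "j \<in> letters N"
    from assms[OF this] have "\<bar>u i - u j\<bar> \<le> c" .
    thus "(u i - u j)\<^sup>2 \<le> c\<^sup>2" using c0 by (metis abs_ge_zero power2_abs power_mono)
  qed
  also have "\<dots> = (real N + 1)\<^sup>2 * c\<^sup>2" by (simp add: power2_eq_square algebra_simps)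
  finally have "(\<Sum>i\<in>letters N. \<Sum>j\<in>letters N. (u i - u j)\<^sup>2) \<le> (real N + 1)\<^sup>2 * c\<^sup>2" .
  moreover have "0 \<le> (real N + 1)\<^sup>2 * c\<^sup>2" by simp
  ultimately show ?thesis unfolding boundary_energy_def by linarith
qed

lemma restr_self [simp]: "restr N i u i = u i"
  by (simp add: restr_def)

lemma restr_sym: "restr N i u j = restr N j u i"
  by (simp add: restr_def algebra_simps)

lemma restr_alt:
  "restr N i u j = (u i + u j + sum u (letters N)) / (real N + 3)
     + (if j = i then ((real N + 1) * u i - sum u (letters N)) / (real N + 3) else 0)"
  by (simp add: restr_def divide_simps) (simp add: algebra_simps)

lemma sum_restr:
  assumes "i \<in> letters N"
  shows "sum (restr N i u) (letters N) =
    (real N + 1) * (2 * u i + sum u (letters N)) / (real N + 3)"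
proof -
  have "sum (restr N i u) (letters N) = ((real N + 1) * u i + sum u (letters N)
     + (real N + 1) * sum u (letters N)) / (real N + 3)
     + ((real N + 1) * u i - sum u (letters N)) / (real N + 3)"
    using assms
    by (simp add: restr_alt sum.distrib sum_divide_distrib[symmetric] sum.delta' algebra_simps)
  thus ?thesis by (simp add: divide_simps) (simp add: algebra_simps)
qed

lemma sum_restr_mult:
  assumes "i \<in> letters N"
  shows "(\<Sum>j\<in>letters N. restr N i u j * v j) =
    (\<Sum>j\<in>letters N. (u i + u j + sum u (letters N)) / (real N + 3) * v j)
     + ((real N + 1) * u i - sum u (letters N)) / (real N + 3) * v i"
proof -
  have "(\<Sum>j\<in>letters N. restr N i u j * v j) =
    (\<Sum>j\<in>letters N. (u i + u j + sum u (letters N)) / (real N + 3) * v j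
      + (if j = i then ((real N + 1) * u i - sum u (letters N)) / (real N + 3) * v i else 0))"
    by (intro sum.cong refl) (simp add: restr_alt algebra_simps)
  thus ?thesis using assms by (simp add: sum.distrib)
qed

text \<open>
  Off the diagonal the summand is a multiple of \<open>(u j - u i) * f i j\<close>, which is antisymmetric: the
  harmonic value at the midpoint of \<open>i\<close> and \<open>j\<close> balances the two cells meeting there.
\<close>

lemma sum_restr_symmetric:
  assumes sym: "\<And>i j. i \<in> letters N \<Longrightarrow> j \<in> letters N \<Longrightarrow> f i j = f j i"
  shows "(\<Sum>i\<in>letters N. (real N + 1) * (\<Sum>j\<in>letters N. restr N i u j * f i j)
            - sum (restr N i u) (letters N) * sum (f i) (letters N)) =
         (real N + 1) / (real N + 3) * (\<Sum>i\<in>letters N. ((real N + 1) * u i - sum u (letters N)) * f i i)"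
proof -
  let ?S = "letters N" and ?c = "(real N + 1) / (real N + 3)"
  have "(real N + 1) * (\<Sum>j\<in>?S. restr N i u j * f i j) - sum (restr N i u) ?S * sum (f i) ?S
    = (\<Sum>j\<in>?S. ?c * (u j * f i j - u i * f i j)) + ?c * (((real N + 1) * u i - sum u ?S) * f i i)"
    if i: "i \<in> ?S" for i
  proof -
    have "(real N + 1) * (\<Sum>j\<in>?S. restr N i u j * f i j) - sum (restr N i u) ?S * sum (f i) ?S
       = (\<Sum>j\<in>?S. (real N + 1) * ((u i + u j + sum u ?S) / (real N + 3) * f i j)
           - (real N + 1) * (2 * u i + sum u ?S) / (real N + 3) * f i j)
         + ?c * (((real N + 1) * u i - sum u ?S) * f i i)"
      using i by (simp add: sum_restr_mult sum_restr sum_distrib_left sum_subtractf distrib_left)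
    also have "(\<Sum>j\<in>?S. (real N + 1) * ((u i + u j + sum u ?S) / (real N + 3) * f i j)
           - (real N + 1) * (2 * u i + sum u ?S) / (real N + 3) * f i j)
       = (\<Sum>j\<in>?S. ?c * (u j * f i j - u i * f i j))"
      by (intro sum.cong refl) (simp add: divide_simps, simp add: algebra_simps)
    finally show ?thesis .
  qed
  hence "(\<Sum>i\<in>?S. (real N + 1) * (\<Sum>j\<in>?S. restr N i u j * f i j) - sum (restr N i u) ?S * sum (f i) ?S)
     = (\<Sum>i\<in>?S. (\<Sum>j\<in>?S. ?c * (u j * f i j - u i * f i j)) + ?c * (((real N + 1) * u i - sum u ?S) * f i i))"
    by simp
  also have "\<dots> = ?c * ((\<Sum>i\<in>?S. \<Sum>j\<in>?S. u j * f i j) - (\<Sum>i\<in>?S. \<Sum>j\<in>?S. u i * f i j))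
      + ?c * (\<Sum>i\<in>?S. ((real N + 1) * u i - sum u ?S) * f i i)"
    by (simp only: sum_distrib_left[symmetric] sum_subtractf sum.distrib)
  also have "(\<Sum>i\<in>?S. \<Sum>j\<in>?S. u j * f i j) = (\<Sum>i\<in>?S. \<Sum>j\<in>?S. u i * f i j)"
    by (subst sum.swap) (auto intro!: sum.cong simp: sym)
  finally show ?thesis by simp
qed

lemma sum_boundary_energy_restr:
  "(\<Sum>i\<in>letters N. boundary_energy N (restr N i u)) =
     (real N + 1) / (real N + 3) * boundary_energy N u"
proof -
  have "(\<Sum>i\<in>letters N. boundary_energy N (restr N i u)) = (\<Sum>i\<in>letters N. (real N + 1) *
      (\<Sum>j\<in>letters N. restr N i u j * restr N i u j) - sum (restr N i u) (letters N) * sum (restr N i u) (letters N))"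
    by (simp only: boundary_energy_expand power2_eq_square)
  also have "\<dots> = (real N + 1) / (real N + 3) *
      (\<Sum>i\<in>letters N. ((real N + 1) * u i - sum u (letters N)) * restr N i u i)"
    by (rule sum_restr_symmetric) (rule restr_sym)
  also have "(\<Sum>i\<in>letters N. ((real N + 1) * u i - sum u (letters N)) * restr N i u i) = boundary_energy N u"
    unfolding boundary_energy_expand restr_self left_diff_distrib sum_subtractf
    by (simp add: power2_eq_square sum_distrib_left mult_ac)
  finally show ?thesis .
qed

text \<open>
  The family \<open>g\<close> consists of arbitrary values at the vertices of the first-level cells. Its deviation
  from the harmonic values is orthogonal to them, so harmonic values minimise the energy.
\<close>

lemma sum_boundary_energy_split:
  assumes sym: "\<And>i j. i \<in> letters N \<Longrightarrow> j \<in> letters N \<Longrightarrow> g i j = g j i"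
    and diag: "\<And>i. i \<in> letters N \<Longrightarrow> g i i = u i"
  shows "(\<Sum>i\<in>letters N. boundary_energy N (g i)) = (real N + 1) / (real N + 3) * boundary_energy N u
     + (\<Sum>i\<in>letters N. boundary_energy N (\<lambda>j. g i j - restr N i u j))"
proof -
  let ?S = "letters N"
  define f where "f i j = g i j - restr N i u j" for i j
  have f: "g i = (\<lambda>j. restr N i u j + f i j)" for i by (simp add: f_def)
  have "boundary_energy N (g i) = boundary_energy N (restr N i u) + boundary_energy N (f i)
     + 2 * ((real N + 1) * (\<Sum>j\<in>?S. restr N i u j * f i j) - sum (restr N i u) ?S * sum (f i) ?S)" for i
    unfolding boundary_energy_expand f power2_sum sum.distrib
    by (simp add: algebra_simps sum_distrib_left)
  moreover have "(\<Sum>i\<in>?S. ((real N + 1) * (\<Sum>j\<in>?S. restr N i u j * f i j) - sum (restr N i u) ?S * sum (f i) ?S)) = 0"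
    using sum_restr_symmetric[of N f u] sym diag by (simp add: f_def restr_sym)
  ultimately have "(\<Sum>i\<in>?S. boundary_energy N (g i)) =
    (\<Sum>i\<in>?S. boundary_energy N (restr N i u)) + (\<Sum>i\<in>?S. boundary_energy N (f i))"
    by (simp only: sum.distrib sum_distrib_left[symmetric])
  thus ?thesis unfolding f_def sum_boundary_energy_restr .
qed

lemma restr_bounds:
  assumes "i \<in> letters N" "k \<in> letters N"
    and "\<And>j. j \<in> letters N \<Longrightarrow> A \<le> u j" "\<And>j. j \<in> letters N \<Longrightarrow> u j \<le> B"
  shows "A \<le> restr N i u k" "restr N i u k \<le> B"
proof -
  have "(real N + 1) * A \<le> sum u (letters N)" "sum u (letters N) \<le> (real N + 1) * B"
    using sum_bounded_below[of "letters N" A u] sum_bounded_above[of "letters N" u B] assms(3,4)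
    by (simp_all add: add.commute)
  moreover have "A \<le> u i" "u i \<le> B" "A \<le> u k" "u k \<le> B" using assms by auto
  ultimately show "A \<le> restr N i u k" "restr N i u k \<le> B"
    by (auto simp: restr_def field_simps)
qed

text \<open>
  Every midpoint value other than the one at vertex \<open>i\<close> is an average with weight at least
  \<open>2 / (N + 3)\<close> at vertex \<open>i\<close>; hence the oscillation contracts by \<open>(N + 1) / (N + 3)\<close>.
\<close>

lemma restr_osc:
  assumes "i \<in> letters N" "k \<in> letters N" "l \<in> letters N"
    and osc: "\<And>j k. j \<in> letters N \<Longrightarrow> k \<in> letters N \<Longrightarrow> \<bar>u j - u k\<bar> \<le> c"
  shows "\<bar>restr N i u k - restr N i u l\<bar> \<le> (real N + 1) / (real N + 3) * c"
proof -
  have c0: "0 \<le> c" using osc[of "Suc 0" "Suc 0"] by simp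
  have *: "\<bar>restr N i u k - u i\<bar> \<le> (real N + 1) / (real N + 3) * c" if k: "k \<in> letters N" "k \<noteq> i" for k
  proof -
    have "restr N i u k - u i = ((u k - u i) + (\<Sum>j\<in>letters N. u j - u i)) / (real N + 3)"
      using k by (simp add: restr_def sum_subtractf divide_simps) (simp add: algebra_simps)
    also have "(\<Sum>j\<in>letters N. u j - u i) = (\<Sum>j\<in>letters N - {i}. u j - u i)"
      using assms by (simp add: sum.remove[of _ i])
    finally have e: "restr N i u k - u i = ((u k - u i) + (\<Sum>j\<in>letters N - {i}. u j - u i)) / (real N + 3)" .
    have "\<bar>\<Sum>j\<in>letters N - {i}. u j - u i\<bar> \<le> (\<Sum>j\<in>letters N - {i}. c)"
      using assms by (intro order_trans[OF sum_abs] sum_mono osc) auto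
    also have "\<dots> = real N * c" using assms by (simp add: card_Diff_singleton)
    finally have "\<bar>(u k - u i) + (\<Sum>j\<in>letters N - {i}. u j - u i)\<bar> \<le> (real N + 1) * c"
      using osc[OF k(1) assms(1)] by (simp add: algebra_simps abs_le_iff)
    thus ?thesis unfolding e by (simp add: divide_simps)
  qed
  consider "k = i" | "l = i" | "k \<noteq> i" "l \<noteq> i" by blast
  thus ?thesis
  proof cases
    case 1 thus ?thesis using *[of l] assms c0 by (cases "l = i") (auto simp: abs_minus_commute)
  next
    case 2 thus ?thesis using *[of k] assms c0 by (cases "k = i") auto
  next
    case 3
    hence "restr N i u k - restr N i u l = (u k - u l) / (real N + 3)"
      by (simp add: restr_def diff_divide_distrib[symmetric])
    hence "\<bar>restr N i u k - restr N i u l\<bar> = \<bar>u k - u l\<bar> / (real N + 3)" by simp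
    also have "\<dots> \<le> ((real N + 1) * c) / (real N + 3)"
      using osc[OF assms(2,3)] c0 by (intro divide_right_mono) (simp_all add: algebra_simps add_increasing2)
    finally show ?thesis by simp
  qed
qed

lemma restr_surj:
  assumes "i \<in> letters N"
  shows "\<exists>u. \<forall>k. restr N i u k = v k"
proof -
  define D where "D = (\<Sum>k\<in>letters N. v k - v i)"
  \<comment> \<open>The sum of the differences to vertex \<open>i\<close> is an eigenfunctional for the eigenvalue \<open>(N + 1) / (N + 3)\<close>.\<close>
  define u where "u k = (if k = i then v i else v i + (real N + 3) * (v k - v i) - (real N + 3) * D / (real N + 1))" for k
  have "sum u (letters N) = v i + (\<Sum>k\<in>letters N - {i}. v i + (real N + 3) * (v k - v i) - (real N + 3) * D / (real N + 1))"
    using assms by (simp add: sum.remove[of _ i] u_def)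
  also have "(\<Sum>k\<in>letters N - {i}. v i + (real N + 3) * (v k - v i) - (real N + 3) * D / (real N + 1))
     = real N * v i + (real N + 3) * (\<Sum>k\<in>letters N - {i}. v k - v i) - real N * ((real N + 3) * D / (real N + 1))"
    using assms by (simp add: sum.distrib sum_subtractf sum_distrib_left card_Diff_singleton algebra_simps)
  also have "(\<Sum>k\<in>letters N - {i}. v k - v i) = D"
    using assms by (simp add: D_def sum.remove[of _ i])
  finally have U: "sum u (letters N) = (real N + 1) * v i + (real N + 3) * D / (real N + 1)"
    by (simp add: divide_simps) (simp add: algebra_simps)
  have "restr N i u k = v k" for k
    unfolding restr_def U
    by (auto simp: u_def divide_simps) (simp add: algebra_simps)
  thus ?thesis by blast
qed

lemma restr_const_imp_const:
  assumes "i \<in> letters N" "\<And>k. k \<in> letters N \<Longrightarrow> restr N i u k = c"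
  shows "k \<in> letters N \<Longrightarrow> u k = c"
proof -
  have ui: "u i = c" using assms(2)[of i] assms(1) by simp
  have e: "u k = (real N + 3) * c - c - sum u (letters N)" if "k \<in> letters N" "k \<noteq> i" for k
    using assms(2)[of k] that ui by (simp add: restr_def divide_simps) (simp add: algebra_simps)
  have "sum u (letters N) = c + (\<Sum>k\<in>letters N - {i}. (real N + 3) * c - c - sum u (letters N))"
    (is "_ = ?r")
  proof -
    have "sum u (letters N) = u i + sum u (letters N - {i})"
      using assms(1) by (intro sum.remove) auto
    also have "\<dots> = ?r"
      unfolding ui by (intro arg_cong2[where f="(+)"] refl sum.cong e) auto
    finally show ?thesis .
  qed
  also have "\<dots> = c + real N * ((real N + 3) * c - c - sum u (letters N))"
    using assms by (simp add: card_Diff_singleton)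
  finally have "(real N + 1) * (sum u (letters N) - (real N + 1) * c) = 0"
    by (simp add: algebra_simps)
  hence "sum u (letters N) = (real N + 1) * c" by (simp add: add_nonneg_eq_0_iff)
  thus "u k = c" if "k \<in> letters N" using e[of k] that ui by (cases "k = i") (auto simp: algebra_simps)
qed

lemma restr_cong:
  "(\<And>k. k \<in> letters N \<Longrightarrow> u k = v k) \<Longrightarrow> i \<in> letters N \<Longrightarrow> k \<in> letters N \<Longrightarrow> restr N i u k = restr N i v k"
  by (auto simp: restr_def intro!: sum.cong)

abbreviation restrs :: "nat \<Rightarrow> nat list \<Rightarrow> (nat \<Rightarrow> real) \<Rightarrow> nat \<Rightarrow> real" where
  "restrs N w u \<equiv> fold (restr N) w u"

lemma restrs_surj: "set w \<subseteq> letters N \<Longrightarrow> \<exists>u. \<forall>k. restrs N w u k = v k"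
proof (induction w arbitrary: v)
  case (Cons i w)
  have "set w \<subseteq> letters N" using Cons.prems by auto
  from Cons.IH[OF this, of v] obtain u where u: "\<forall>k. restrs N w u k = v k" by blast
  from Cons obtain u' where "\<forall>k. restr N i u' k = u k" using restr_surj[of i N u] by auto
  hence "restr N i u' = u" by auto
  thus ?case using u by (intro exI[of _ u']) auto
qed auto

lemma restrs_const_imp_const:
  assumes "set w \<subseteq> letters N" "\<And>k. k \<in> letters N \<Longrightarrow> restrs N w u k = c"
  shows "k \<in> letters N \<Longrightarrow> u k = c"
  using assms
proof (induction w arbitrary: u k)
  case (Cons i w)
  have "restr N i u k = c" if "k \<in> letters N" for k
    by (rule Cons.IH[OF that]) (use Cons.prems in auto)
  thus ?case using Cons.prems restr_const_imp_const[of i N u c] by simp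
qed auto

lemma restrs_osc:
  assumes "set w \<subseteq> letters N" "k \<in> letters N" "l \<in> letters N"
    and "\<And>j k. j \<in> letters N \<Longrightarrow> k \<in> letters N \<Longrightarrow> \<bar>u j - u k\<bar> \<le> c"
  shows "\<bar>restrs N w u k - restrs N w u l\<bar> \<le> ((real N + 1) / (real N + 3)) ^ length w * c"
  using assms
proof (induction w arbitrary: u c)
  case (Cons i w)
  have "\<bar>restrs N w (restr N i u) k - restrs N w (restr N i u) l\<bar>
     \<le> ((real N + 1) / (real N + 3)) ^ length w * ((real N + 1) / (real N + 3) * c)"
    using Cons.prems by (intro Cons.IH restr_osc) auto
  thus ?case by (simp add: mult_ac)
qed auto

lemma restrs_cong:
  assumes "set w \<subseteq> letters N" "\<And>k. k \<in> letters N \<Longrightarrow> u k = v k" "k \<in> letters N"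
  shows "restrs N w u k = restrs N w v k"
  using assms
proof (induction w arbitrary: u v)
  case (Cons a w)
  have "restr N a u j = restr N a v j" if "j \<in> letters N" for j
    by (rule restr_cong) (use Cons.prems that in auto)
  thus ?case using Cons.IH[of "restr N a u" "restr N a v"] Cons.prems by simp
qed simp

definition unit_boundary :: "nat \<Rightarrow> nat \<Rightarrow> real" where
  "unit_boundary k i = (if i = k then 1 else 0)"

lemma restr_expand:
  assumes "i \<in> letters N" "l \<in> letters N"
  shows "restr N i u l = (\<Sum>m\<in>letters N. u m * restr N i (unit_boundary m) l)"
proof -
  have U: "sum (unit_boundary m) (letters N) = 1" if "m \<in> letters N" for m
    using that by (simp add: unit_boundary_def)
  have d: "(\<Sum>m\<in>letters N. u m * unit_boundary m k) = u k" if "k \<in> letters N" for k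
    using that by (simp add: unit_boundary_def if_distrib cong: if_cong)
  show ?thesis
  proof (cases "l = i")
    case True thus ?thesis using assms d[of i] by simp
  next
    case False
    have "(\<Sum>m\<in>letters N. u m * restr N i (unit_boundary m) l) =
       (\<Sum>m\<in>letters N. (u m * unit_boundary m i + u m * unit_boundary m l + u m) / (real N + 3))"
      using False by (intro sum.cong refl) (simp add: restr_def U algebra_simps)
    also have "\<dots> = (u i + u l + sum u (letters N)) / (real N + 3)"
      using assms by (simp add: sum_divide_distrib[symmetric] sum.distrib d)
    finally show ?thesis using False by (simp add: restr_def)
  qed
qed

lemma restrs_expand:
  assumes "set w \<subseteq> letters N" "k \<in> letters N"
  shows "restrs N w u k = (\<Sum>m\<in>letters N. u m * restrs N w (unit_boundary m) k)"
  using assms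
proof (induction w arbitrary: u)
  case Nil
  thus ?case by (simp add: unit_boundary_def if_distrib cong: if_cong)
next
  case (Cons i w)
  let ?S = "letters N"
  have i: "i \<in> ?S" and w: "set w \<subseteq> ?S" using Cons.prems by auto
  have IH: "restrs N w v k = (\<Sum>m\<in>?S. v m * restrs N w (unit_boundary m) k)" for v
    by (rule Cons.IH[OF w Cons.prems(2)])
  have "restrs N (i # w) u k = (\<Sum>l\<in>?S. restr N i u l * restrs N w (unit_boundary l) k)"
    using IH[of "restr N i u"] by simp
  also have "\<dots> = (\<Sum>l\<in>?S. (\<Sum>m\<in>?S. u m * restr N i (unit_boundary m) l) * restrs N w (unit_boundary l) k)"
    by (intro sum.cong refl) (simp add: restr_expand[OF i])
  also have "\<dots> = (\<Sum>m\<in>?S. u m * (\<Sum>l\<in>?S. restr N i (unit_boundary m) l * restrs N w (unit_boundary l) k))"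
    unfolding sum_distrib_right sum_distrib_left by (subst sum.swap) (simp add: mult_ac)
  also have "\<dots> = (\<Sum>m\<in>?S. u m * restrs N (i # w) (unit_boundary m) k)"
    using IH[of "restr N i (unit_boundary _)"] by simp
  finally show ?case .
qed

section \<open>Geometry of the gasket\<close>

lemma psi_Nil [simp]: "psi p [] = id"
  by (simp add: psi_def)

lemma psi_Cons [simp]: "psi p (i # w) = cmap p i \<circ> psi p w"
  by (simp add: psi_def)

lemma psi_append: "psi p (v @ w) = psi p v \<circ> psi p w"
  by (induction v) (auto simp: fun_eq_iff)

lemma cmap_diff: "cmap p i x - cmap p i y = (1 / 2) *\<^sub>R (x - y)"
  by (simp add: cmap_def algebra_simps)

lemma psi_diff: "psi p w x - psi p w y = (1 / 2) ^ length w *\<^sub>R (x - y)"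
  by (induction w) (simp_all add: cmap_diff)

lemma cmap_eq_iff [simp]: "cmap p i x = cmap p i y \<longleftrightarrow> x = y"
  by (simp add: cmap_def)

lemma psi_eq_iff [simp]: "psi p w x = psi p w y \<longleftrightarrow> x = y"
  by (induction w) auto

lemma continuous_on_cmap [continuous_intros]: "continuous_on A (cmap p i)"
  unfolding cmap_def by (intro continuous_intros)

lemma continuous_on_psi: "continuous_on A (psi p w)"
  by (induction w) (simp_all add: continuous_on_compose continuous_on_cmap del: o_apply comp_apply)

lemma cmap_fixed [simp]: "cmap p i (p i) = p i"
  by (simp add: cmap_def scaleR_2[symmetric])

lemma cmap_vertex_sym: "cmap p i (p j) = cmap p j (p i)"
  by (simp add: cmap_def add.commute)

lemma cmap_inverse: "2 *\<^sub>R cmap p i x - p i = x"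
  by (simp add: cmap_def)

lemma map_Suc_unfold: "map \<omega> [0..<Suc n] = \<omega> 0 # map (\<lambda>k. \<omega> (Suc k)) [0..<n]"
  by (simp add: upt_conv_Cons map_Suc_upt[symmetric] del: upt_Suc)

lemma half_power_LIMSEQ: "(\<lambda>n. (1 / 2) ^ n * c) \<longlonglongrightarrow> (0 :: real)"
  using tendsto_mult[OF LIMSEQ_power_zero[of "1 / 2 :: real"] tendsto_const[of c]] by simp

text \<open>
  Iterating the maps \<open>z \<mapsto> (z + p i) / 2\<close> along an infinite word unfolds to this series.
\<close>

definition address_point :: "(nat \<Rightarrow> real ^ 'n) \<Rightarrow> (nat \<Rightarrow> nat) \<Rightarrow> real ^ 'n" where
  "address_point p \<omega> = (\<Sum>n. (1 / 2) ^ Suc n *\<^sub>R p (\<omega> n))"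

locale sierpinski =
  fixes N :: nat and p :: "nat \<Rightarrow> real ^ 'n"
  assumes N_ge: "N \<ge> 2"
    and inj_p: "inj_on p (letters N)"
    and indep: "\<not> affine_dependent (p ` letters N)"
begin

abbreviation "S \<equiv> letters N"
abbreviation "K \<equiv> gasket N p"

lemma ex_barycentric:
  assumes k: "k \<in> S"
  shows "\<exists>l. continuous_on UNIV l \<and> (\<forall>c. sum c S = 1 \<longrightarrow> l (\<Sum>j\<in>S. c j *\<^sub>R p j) = (c k :: real))
           \<and> (\<forall>i x. l (cmap p i x) = (l x + l (p i)) / 2)"
proof -
  \<comment> \<open>By affine independence there is a linear functional with value \<open>- 1\<close> on every edge leaving \<open>p k\<close>.\<close>
  let ?B = "(\<lambda>x. - p k + x) ` (p ` S - {p k})"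
  have "independent ?B"
    using indep k affine_dependent_iff_dependent2[of "p k" "p ` S"] by auto
  from linear_independent_extend[OF this, of "\<lambda>_. - 1 :: real"]
  obtain g where g: "linear g" "\<forall>x\<in>?B. g x = (- 1 :: real)" by auto
  define l where "l x = 1 + g (x - p k)" for x
  have gj: "g (p j - p k) = (if j = k then 0 else - 1)" if "j \<in> S" for j
  proof (cases "j = k")
    case False
    hence "p j \<noteq> p k" using that k inj_p by (auto dest: inj_onD)
    hence "- p k + p j \<in> ?B" using that by auto
    with g(2) have "g (- p k + p j) = - 1" by blast
    thus ?thesis using False by simp
  qed (simp add: linear_0[OF g(1)])
  have "l (\<Sum>j\<in>S. c j *\<^sub>R p j) = c k" if c: "sum c S = 1" for c
  proof -
    have "(\<Sum>j\<in>S. c j *\<^sub>R p j) - p k = (\<Sum>j\<in>S. c j *\<^sub>R (p j - p k))"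
      using c by (simp add: scaleR_right_diff_distrib sum_subtractf scaleR_left.sum[symmetric])
    hence "g ((\<Sum>j\<in>S. c j *\<^sub>R p j) - p k) = (\<Sum>j\<in>S. c j * g (p j - p k))"
      by (simp add: linear_sum[OF g(1)] linear_scale[OF g(1)])
    also have "\<dots> = (\<Sum>j\<in>S. (if j = k then c j else 0) - c j)"
      by (intro sum.cong refl) (simp add: gj)
    also have "\<dots> = c k - 1" using k c by (simp add: sum_subtractf)
    finally show ?thesis by (simp add: l_def)
  qed
  moreover have "l (cmap p i x) = (l x + l (p i)) / 2" for i x
  proof -
    have e: "cmap p i x - p k = (1/2) *\<^sub>R ((x - p k) + (p i - p k))"
      by (simp add: cmap_def algebra_simps scaleR_2[symmetric])
    have "g (cmap p i x - p k) = (g (x - p k) + g (p i - p k)) / 2"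
      unfolding e linear_scale[OF g(1)] linear_add[OF g(1)] by simp
    thus ?thesis by (simp add: l_def)
  qed
  moreover have "continuous_on UNIV l"
  proof -
    have "continuous_on UNIV g" by (rule linear_continuous_on) (use g(1) linear_conv_bounded_linear in blast)
    hence "continuous_on UNIV (\<lambda>x. g (x - p k))"
      by (rule continuous_on_compose2) (auto intro!: continuous_intros)
    thus ?thesis unfolding l_def by (intro continuous_intros)
  qed
  ultimately show ?thesis by blast
qed

definition barycentric :: "nat \<Rightarrow> real ^ 'n \<Rightarrow> real" where
  "barycentric k = (SOME l. continuous_on UNIV l \<and> (\<forall>c. sum c S = 1 \<longrightarrow> l (\<Sum>j\<in>S. c j *\<^sub>R p j) = c k)
           \<and> (\<forall>i x. l (cmap p i x) = (l x + l (p i)) / 2))"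

lemma
  assumes "k \<in> S"
  shows continuous_on_barycentric: "continuous_on A (barycentric k)"
    and barycentric_sum: "sum c S = 1 \<Longrightarrow> barycentric k (\<Sum>j\<in>S. c j *\<^sub>R p j) = c k"
    and barycentric_cmap: "barycentric k (cmap p i x) = (barycentric k x + barycentric k (p i)) / 2"
  using someI_ex[OF ex_barycentric[OF assms]] unfolding barycentric_def[symmetric]
  by (auto intro: continuous_on_subset)

lemma barycentric_vertex: 
  assumes "k \<in> S" "j \<in> S"
  shows "barycentric k (p j) = (if j = k then 1 else 0)"
proof -
  have "p j = (\<Sum>l\<in>S. (if l = j then 1 else 0) *\<^sub>R p l)"
    using assms by (simp add: if_distrib[of "\<lambda>x. x *\<^sub>R _"] cong: if_cong)
  hence "barycentric k (p j) = barycentric k (\<Sum>l\<in>S. (if l = j then 1 else 0) *\<^sub>R p l)" by simp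
  also have "\<dots> = (if k = j then 1 else 0)"
    using assms by (subst barycentric_sum) auto
  finally show ?thesis by auto
qed

lemma convex_hull_coords:
  assumes "x \<in> convex hull (p ` S)"
  obtains c where "\<And>j. j \<in> S \<Longrightarrow> 0 \<le> c j" "sum c S = 1" "x = (\<Sum>j\<in>S. c j *\<^sub>R p j)"
proof -
  obtain d where d: "\<forall>y\<in>p ` S. 0 \<le> d y" "sum d (p ` S) = 1" "(\<Sum>y\<in>p ` S. d y *\<^sub>R y) = x"
    using assms by (auto simp: convex_hull_finite)
  show ?thesis
    by (rule that[of "d \<circ> p"]) (use d inj_p in \<open>auto simp: sum.reindex\<close>)
qed

text \<open>
  Each unfolding of the invariance halves the distance of points of \<open>A\<close> from \<open>B\<close>. Applied in both
  directions this yields uniqueness of the gasket.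
\<close>

lemma invariant_subset:
  assumes A: "compact A" "A \<subseteq> (\<Union>i\<in>S. cmap p i ` A)"
    and B: "compact B" "B \<noteq> {}" "(\<Union>i\<in>S. cmap p i ` B) \<subseteq> B"
  shows "A \<subseteq> B"
proof
  fix x assume x: "x \<in> A"
  from A B have "bounded (A \<union> B)" by (simp add: compact_imp_bounded)
  then obtain D where D: "\<And>x. x \<in> A \<union> B \<Longrightarrow> norm x \<le> D"
    by (auto simp: bounded_iff)
  have *: "\<exists>y\<in>B. dist y x \<le> (1 / 2) ^ n * (2 * D)" if "x \<in> A" for n x
    using that
  proof (induction n arbitrary: x)
    case 0
    obtain y where "y \<in> B" using B by auto
    moreover have "dist y x \<le> 2 * D"
      using D[of x] D[of y] 0 \<open>y \<in> B\<close> norm_triangle_ineq4[of y x] by (auto simp: dist_norm)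
    ultimately show ?case by auto
  next
    case (Suc n)
    from A(2) Suc.prems obtain i x' where i: "i \<in> S" "x = cmap p i x'" "x' \<in> A" by auto
    from Suc.IH[OF i(3)] obtain y' where y': "y' \<in> B" "dist y' x' \<le> (1 / 2) ^ n * (2 * D)" by auto
    have "dist (cmap p i y') x = dist y' x' / 2"
      by (simp add: i dist_norm cmap_diff)
    with y' have "dist (cmap p i y') x \<le> (1 / 2) ^ Suc n * (2 * D)" by simp
    moreover have "cmap p i y' \<in> B" using B i y' by auto
    ultimately show ?case by blast
  qed
  have "\<exists>y\<in>B. dist y x < e" if "e > 0" for e
  proof -
    have "eventually (\<lambda>n. (1 / 2) ^ n * (2 * D) < e) sequentially"
      using that half_power_LIMSEQ by (intro order_tendstoD) auto
    then obtain n where "(1 / 2) ^ n * (2 * D) < e" by (auto simp: eventually_sequentially)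
    with *[OF x, of n] show ?thesis by force
  qed
  thus "x \<in> B" using B(1) closed_approachable[of B x] compact_imp_closed by auto
qed

text \<open>
  The gasket is the intersection of the decreasing images of the simplex. A point of the intersection
  lies in some first-level image at every stage and, as there are finitely many letters, in the one of
  a fixed letter at infinitely many stages, hence at all.
\<close>

lemma ex_gasket:
  "\<exists>A. compact A \<and> A \<noteq> {} \<and> A = (\<Union>i\<in>S. cmap p i ` A) \<and> A \<subseteq> convex hull (p ` S)"
proof -
  define D where "D n = ((\<lambda>A. \<Union>i\<in>S. cmap p i ` A) ^^ n) (convex hull (p ` S))" for n
  have D0: "D 0 = convex hull (p ` S)" and DS: "D (Suc n) = (\<Union>i\<in>S. cmap p i ` D n)" for n
    by (simp_all add: D_def)
  have D1: "D (Suc 0) \<subseteq> D 0"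
  proof -
    have "cmap p i x \<in> convex hull (p ` S)" if "i \<in> S" "x \<in> convex hull (p ` S)" for i x
    proof -
      have "(1 / 2) *\<^sub>R x + (1 / 2) *\<^sub>R p i \<in> convex hull (p ` S)"
        using that by (intro convexD[OF convex_convex_hull]) (auto intro: hull_inc)
      thus ?thesis by (simp add: cmap_def algebra_simps)
    qed
    thus ?thesis by (auto simp: DS D0)
  qed
  have "D (Suc n) \<subseteq> D n" for n
  proof (induction n)
    case 0 show ?case by (rule D1)
  next
    case (Suc n) thus ?case unfolding DS[of "Suc n"] DS[of n] by blast
  qed
  hence dec: "D n \<subseteq> D m" if "m \<le> n" for m n
    using lift_Suc_antimono_le[of D] that by blast
  have comp: "compact (D n)" for n
  proof (induction n)
    case 0 show ?case unfolding D0 by (intro compact_convex_hull finite_imp_compact) simp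
  next
    case (Suc n) thus ?case
      unfolding DS by (intro compact_UN finite_letters compact_continuous_image continuous_on_cmap)
  qed
  define A where "A = (\<Inter>n. D n)"
  have "p (Suc 0) \<in> D n" for n
  proof (induction n)
    case (Suc n)
    hence "cmap p (Suc 0) (p (Suc 0)) \<in> D (Suc n)"
      unfolding DS using one_in_letters by blast
    thus ?case by simp
  qed (auto simp: D0 intro!: hull_inc)
  hence "A \<noteq> {}" by (auto simp: A_def)
  moreover have "A \<subseteq> D 0" by (auto simp: A_def)
  moreover have "compact A"
    unfolding A_def using comp
    by (intro compact_Inter) auto
  moreover have "A = (\<Union>i\<in>S. cmap p i ` A)"
  proof (intro equalityI subsetI)
    fix x assume "x \<in> (\<Union>i\<in>S. cmap p i ` A)"
    then obtain i y where "i \<in> S" "y \<in> A" "x = cmap p i y" by auto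
    hence "x \<in> D (Suc n)" for n unfolding DS by (auto simp: A_def)
    hence "x \<in> D n" for n using dec[of n "Suc n"] by auto
    thus "x \<in> A" by (auto simp: A_def)
  next
    fix x assume x: "x \<in> A"
    hence "\<forall>n. \<exists>i\<in>S. x \<in> cmap p i ` D n"
      unfolding A_def using DS by blast
    then obtain i where i: "\<And>n. i n \<in> S" "\<And>n. x \<in> cmap p (i n) ` D n" by metis
    have "finite (range i)" using i by (intro finite_subset[OF _ finite_letters[of N]]) auto
    then obtain a where a: "infinite {n. i n = a}"
      using pigeonhole_infinite[of "UNIV :: nat set" i] by auto
    define y where "y = 2 *\<^sub>R x - p a"
    have ya: "x = cmap p a y" by (simp add: y_def cmap_def)
    have "y \<in> D n" for n
    proof -
      obtain m where m: "m > n" "i m = a"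
        using a by (auto simp: infinite_nat_iff_unbounded)
      with i(2)[of m] ya have "y \<in> D m" by auto
      thus ?thesis using dec[of n m] m by auto
    qed
    moreover obtain n where "i n = a" using a by (auto simp: infinite_nat_iff_unbounded)
    ultimately show "x \<in> (\<Union>i\<in>S. cmap p i ` A)"
      using i(1)[of n] ya by (auto simp: A_def)
  qed
  ultimately show ?thesis unfolding D0 by blast
qed

lemma gasket_props:
  shows compact_gasket: "compact K" and gasket_nonempty: "K \<noteq> {}"
    and gasket_invariant: "K = (\<Union>i\<in>S. cmap p i ` K)" and gasket_subset_hull: "K \<subseteq> convex hull (p ` S)"
proof -
  obtain A where A: "compact A" "A \<noteq> {}" "A = (\<Union>i\<in>S. cmap p i ` A)" "A \<subseteq> convex hull (p ` S)"
    using ex_gasket by blast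
  have "K = A" unfolding gasket_def
  proof (rule the_equality)
    fix B assume B: "compact B \<and> B \<noteq> {} \<and> B = (\<Union>i\<in>S. cmap p i ` B)"
    hence B: "compact B" "B \<noteq> {}" "B = (\<Union>i\<in>S. cmap p i ` B)" by blast+
    show "B = A"
      using invariant_subset[OF B(1) equalityD1[OF B(3)] A(1,2) equalityD2[OF A(3)]]
        invariant_subset[OF A(1) equalityD1[OF A(3)] B(1,2) equalityD2[OF B(3)]] by blast
  qed (use A in blast)
  thus "compact K" "K \<noteq> {}" "K = (\<Union>i\<in>S. cmap p i ` K)" "K \<subseteq> convex hull (p ` S)"
    using A by simp_all
qed

lemma closed_gasket: "closed K"
  using compact_gasket compact_imp_closed by blast

lemma cmap_in_gasket: "i \<in> S \<Longrightarrow> x \<in> K \<Longrightarrow> cmap p i x \<in> K"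
  using gasket_invariant by blast

lemma gasket_cases:
  assumes "x \<in> K" obtains i y where "i \<in> S" "y \<in> K" "x = cmap p i y"
  using assms gasket_invariant by blast

lemma psi_in_gasket: "set w \<subseteq> S \<Longrightarrow> x \<in> K \<Longrightarrow> psi p w x \<in> K"
  by (induction w) (auto intro: cmap_in_gasket)

lemma barycentric_gasket:
  assumes "x \<in> K"
  shows "k \<in> S \<Longrightarrow> 0 \<le> barycentric k x" "(\<Sum>k\<in>S. barycentric k x) = 1"
    "x = (\<Sum>k\<in>S. barycentric k x *\<^sub>R p k)"
proof -
  have "x \<in> convex hull (p ` S)" using assms gasket_subset_hull by auto
  then obtain c where c: "\<And>j. j \<in> S \<Longrightarrow> 0 \<le> c j" "sum c S = 1" "x = (\<Sum>j\<in>S. c j *\<^sub>R p j)"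
    by (rule convex_hull_coords) blast
  have b: "barycentric k x = c k" if "k \<in> S" for k
    unfolding c(3) using barycentric_sum[OF that c(2)] .
  show "k \<in> S \<Longrightarrow> 0 \<le> barycentric k x" using b c(1) by simp
  show "(\<Sum>k\<in>S. barycentric k x) = 1" using b c(2) by simp
  have "(\<Sum>k\<in>S. barycentric k x *\<^sub>R p k) = (\<Sum>j\<in>S. c j *\<^sub>R p j)"
    by (intro sum.cong refl) (simp add: b)
  thus "x = (\<Sum>k\<in>S. barycentric k x *\<^sub>R p k)" using c(3) by simp
qed

lemma barycentric_eq_1D:
  assumes "x \<in> K" "k \<in> S" "barycentric k x \<ge> 1"
  shows "x = p k"
proof -
  note b = barycentric_gasket[OF assms(1)]
  have "(\<Sum>j\<in>S. barycentric j x) = barycentric k x + (\<Sum>j\<in>S - {k}. barycentric j x)"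
    using assms by (intro sum.remove) auto
  moreover have nn: "(\<Sum>j\<in>S - {k}. barycentric j x) \<ge> 0" using b by (intro sum_nonneg) auto
  ultimately have "barycentric k x = 1" and s: "(\<Sum>j\<in>S - {k}. barycentric j x) = 0"
    using b(2) assms by auto
  moreover have "barycentric j x = 0" if "j \<in> S" "j \<noteq> k" for j
    using s that b by (subst (asm) sum_nonneg_eq_0_iff) auto
  ultimately have "(\<Sum>j\<in>S. barycentric j x *\<^sub>R p j) = (\<Sum>j\<in>S. if j = k then p k else 0)"
    by (intro sum.cong) auto
  thus ?thesis using b(3) assms by simp
qed

lemma barycentric_le_1:
  assumes "x \<in> K" "k \<in> S" shows "barycentric k x \<le> 1"
  using barycentric_gasket[OF assms(1)] assms member_le_sum[of k S "\<lambda>k. barycentric k x"] by auto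

text \<open>
  The \<open>j\<close>-th barycentric coordinate is at most \<open>1 / 2\<close> on the cell of \<open>i\<close> and at least \<open>1 / 2\<close> on the
  cell of \<open>j\<close>; so distinct first-level cells meet only in the midpoint of an edge.
\<close>

lemma cmap_eq_cmapD:
  assumes "i \<in> S" "j \<in> S" "i \<noteq> j" "x \<in> K" "y \<in> K" "cmap p i x = cmap p j y"
  shows "x = p j" "y = p i"
proof -
  have *: "x = p j" if "i \<in> S" "j \<in> S" "i \<noteq> j" "x \<in> K" "y \<in> K" "cmap p i x = cmap p j y" for i j x y
  proof -
    have "barycentric j x / 2 = (barycentric j y + 1) / 2"
      using that barycentric_cmap[of j i x] barycentric_cmap[of j j y]
      by (simp add: barycentric_vertex)
    moreover have "barycentric j y \<ge> 0" using that barycentric_gasket by auto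
    ultimately show ?thesis using that by (intro barycentric_eq_1D) auto
  qed
  show "x = p j" using *[of i j x y] assms by auto
  show "y = p i" using *[of j i y x] assms by auto
qed

lemma vertex_eq_cmapD:
  assumes "i \<in> S" "j \<in> S" "x \<in> K" "p j = cmap p i x"
  shows "i = j" "x = p j"
proof -
  have "1 = (barycentric j x + (if i = j then 1 else 0)) / 2"
    using assms barycentric_cmap[of j i x] by (simp add: barycentric_vertex flip: assms(4))
  moreover have "barycentric j x \<le> 1" using assms barycentric_le_1 by auto
  ultimately show "i = j" by (auto split: if_splits)
  with assms(4) have "cmap p j x = cmap p j (p j)" unfolding cmap_fixed by simp
  thus "x = p j" unfolding cmap_eq_iff .
qed

lemma vertex_bound: obtains B where "\<And>i. i \<in> S \<Longrightarrow> norm (p i) \<le> B" "B \<ge> 0"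
proof -
  have "bounded (p ` S)" by (intro finite_imp_bounded) auto
  then obtain B where B: "\<forall>x\<in>p ` S. norm x \<le> B" by (auto simp: bounded_iff)
  have "B \<ge> 0" using B one_in_letters[of N] norm_ge_zero[of "p (Suc 0)"] by (meson imageI order_trans)
  thus ?thesis using B that by auto
qed

lemma address_summable:
  assumes "range \<omega> \<subseteq> S"
  shows "summable (\<lambda>n. (1 / 2) ^ Suc n *\<^sub>R p (\<omega> n))"
proof -
  obtain B where B: "\<And>i. i \<in> S \<Longrightarrow> norm (p i) \<le> B" "B \<ge> 0" using vertex_bound by metis
  show ?thesis
  proof (rule summable_comparison_test[where g="\<lambda>n. (1 / 2) ^ Suc n * B"])
    show "summable (\<lambda>n. (1 / 2) ^ Suc n * B)"
      by (intro summable_mult2) (simp add: summable_geometric)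
    have "norm ((1 / 2) ^ Suc n *\<^sub>R p (\<omega> n)) \<le> (1 / 2) ^ Suc n * B" for n
      using B(1)[of "\<omega> n"] assms by (auto simp: field_simps intro!: mult_left_mono)
    thus "\<exists>N. \<forall>n\<ge>N. norm ((1 / 2) ^ Suc n *\<^sub>R p (\<omega> n)) \<le> (1 / 2) ^ Suc n * B" by auto
  qed
qed

lemma address_point_shift:
  assumes "range \<omega> \<subseteq> S"
  shows "address_point p \<omega> = cmap p (\<omega> 0) (address_point p (\<lambda>n. \<omega> (Suc n)))"
proof -
  have s: "summable (\<lambda>n. (1 / 2) ^ Suc n *\<^sub>R p (\<omega> (Suc n)))"
    using assms by (intro address_summable) auto
  have "address_point p \<omega> = (\<Sum>n. (1 / 2) ^ Suc (Suc n) *\<^sub>R p (\<omega> (Suc n))) + (1 / 2) *\<^sub>R p (\<omega> 0)"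
    unfolding address_point_def by (subst suminf_split_head[OF address_summable[OF assms]]) simp
  also have "(\<Sum>n. (1 / 2) ^ Suc (Suc n) *\<^sub>R p (\<omega> (Suc n)))
      = (\<Sum>n. (1 / 2) *\<^sub>R (1 / 2) ^ Suc n *\<^sub>R p (\<omega> (Suc n)))" by simp
  also have "\<dots> = (1 / 2) *\<^sub>R address_point p (\<lambda>n. \<omega> (Suc n))"
    unfolding address_point_def by (rule suminf_scaleR_right[OF s, symmetric])
  finally show ?thesis by (simp add: cmap_def algebra_simps)
qed

lemma address_point_prefix:
  assumes "range \<omega> \<subseteq> S"
  shows "address_point p \<omega> = psi p (map \<omega> [0..<n]) (address_point p (\<lambda>k. \<omega> (k + n)))"
  using assms
proof (induction n arbitrary: \<omega>)
  case (Suc n)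
  have "range (\<lambda>k. \<omega> (Suc k)) \<subseteq> S" using Suc.prems by auto
  from Suc.IH[OF this] show ?case
    unfolding map_Suc_unfold address_point_shift[OF Suc.prems] by simp
qed simp

text \<open>
  The point with address \<open>\<omega>\<close> is the limit of the images of any \<open>z\<close> under the prefixes of \<open>\<omega>\<close>.
\<close>

lemma closed_invariant_address:
  assumes \<omega>: "range \<omega> \<subseteq> S" and "closed C" and z: "z \<in> C"
    and inv: "\<And>a x. a \<in> range \<omega> \<Longrightarrow> x \<in> C \<Longrightarrow> cmap p a x \<in> C"
  shows "address_point p \<omega> \<in> C"
proof -
  obtain B where B: "\<And>i. i \<in> S \<Longrightarrow> norm (p i) \<le> B" "B \<ge> 0" using vertex_bound by metis
  have bd: "norm (address_point p \<omega>') \<le> B" if "range \<omega>' \<subseteq> S" for \<omega>'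
  proof -
    have "norm (address_point p \<omega>') \<le> (\<Sum>n. (1 / 2) ^ Suc n * B)"
      unfolding address_point_def
    proof (rule norm_suminf_le)
      show "norm ((1 / 2) ^ Suc n *\<^sub>R p (\<omega>' n)) \<le> (1 / 2) ^ Suc n * B" for n
        using B(1)[of "\<omega>' n"] that by (auto simp: field_simps intro!: mult_left_mono)
      show "summable (\<lambda>n. (1 / 2) ^ Suc n * B)"
        by (intro summable_mult2) (simp add: summable_geometric)
    qed
    also have "\<dots> = B" using power_half_series by (intro sums_unique[symmetric]) (use sums_mult2 in fastforce)
    finally show ?thesis .
  qed
  have in_C: "psi p v x \<in> C" if "set v \<subseteq> range \<omega>" "x \<in> C" for v x
    using that by (induction v) (auto intro!: inv)
  have "(\<lambda>n. psi p (map \<omega> [0..<n]) z) \<longlonglongrightarrow> address_point p \<omega>"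
  proof (rule LIMSEQ_I)
    fix e :: real assume "e > 0"
    have "eventually (\<lambda>n. (1 / 2) ^ n * (norm z + B) < e) sequentially"
      using \<open>e > 0\<close> half_power_LIMSEQ by (intro order_tendstoD) auto
    then obtain m where m: "\<And>n. n \<ge> m \<Longrightarrow> (1 / 2) ^ n * (norm z + B) < e" by (auto simp: eventually_sequentially)
    have "norm (psi p (map \<omega> [0..<n]) z - address_point p \<omega>) < e" if "n \<ge> m" for n
    proof -
      have "norm (psi p (map \<omega> [0..<n]) z - address_point p \<omega>)
          = (1 / 2) ^ n * norm (z - address_point p (\<lambda>k. \<omega> (k + n)))"
        unfolding address_point_prefix[OF \<omega>, of n] psi_diff by simp
      also have "\<dots> \<le> (1 / 2) ^ n * (norm z + B)"
        using \<omega> by (intro mult_left_mono order_trans[OF norm_triangle_ineq4] add_left_mono bd) auto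
      finally show ?thesis using m[OF that] by simp
    qed
    thus "\<exists>m. \<forall>n\<ge>m. norm (psi p (map \<omega> [0..<n]) z - address_point p \<omega>) < e" by blast
  qed
  moreover have "psi p (map \<omega> [0..<n]) z \<in> C" for n
    by (rule in_C) (use z in auto)
  ultimately show ?thesis
    using closed_sequentially[OF \<open>closed C\<close>, of "\<lambda>n. psi p (map \<omega> [0..<n]) z"] by simp
qed

lemma gasket_diameter: obtains D where "\<And>x y. x \<in> K \<Longrightarrow> y \<in> K \<Longrightarrow> norm (x - y) \<le> D"
  using compact_imp_bounded[OF compact_gasket] by (auto simp: bounded_two_points dist_norm)

lemma address_in_gasket:
  assumes "range \<omega> \<subseteq> S" shows "address_point p \<omega> \<in> K"
proof -
  obtain z where z: "z \<in> K" using gasket_nonempty by blast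
  show ?thesis
    by (rule closed_invariant_address[OF assms closed_gasket z]) (use assms cmap_in_gasket in blast)
qed

lemma address_in_segment:
  assumes "range \<omega> \<subseteq> {i, j}" "i \<in> S" "j \<in> S"
  shows "address_point p \<omega> \<in> closed_segment (p i) (p j)"
proof (rule closed_invariant_address)
  fix a x assume "a \<in> range \<omega>" and x: "x \<in> closed_segment (p i) (p j)"
  have pa: "p a \<in> closed_segment (p i) (p j)" using assms(1) \<open>a \<in> range \<omega>\<close> by auto
  have "cmap p a x = (1 / 2) *\<^sub>R x + (1 / 2) *\<^sub>R p a" by (simp add: cmap_def algebra_simps)
  thus "cmap p a x \<in> closed_segment (p i) (p j)"
    using convexD[OF convex_closed_segment x pa, of "1 / 2" "1 / 2"] by simp
qed (use assms in auto)

lemma vertex_in_gasket: "i \<in> S \<Longrightarrow> p i \<in> K"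
proof -
  assume i: "i \<in> S"
  have "address_point p (\<lambda>_. i) \<in> {p i}"
    using i by (intro closed_invariant_address) auto
  thus "p i \<in> K" using address_in_gasket[of "\<lambda>_. i"] i by auto
qed

lemma address_eq_vertexD:
  assumes "range \<omega> \<subseteq> S" "b \<in> S" "address_point p \<omega> = p b"
  shows "\<omega> n = b"
  using assms
proof (induction n arbitrary: \<omega>)
  case 0
  have "p b = cmap p (\<omega> 0) (address_point p (\<lambda>n. \<omega> (Suc n)))"
    using address_point_shift[OF 0(1)] 0 by simp
  thus ?case using 0 by (intro vertex_eq_cmapD(1)[of _ b]) (auto intro!: address_in_gasket)
next
  case (Suc n)
  have "p b = cmap p (\<omega> 0) (address_point p (\<lambda>n. \<omega> (Suc n)))"
    using address_point_shift[OF Suc(2)] Suc by simp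
  hence "address_point p (\<lambda>n. \<omega> (Suc n)) = p b"
    using Suc by (intro vertex_eq_cmapD(2)[of "\<omega> 0" b]) (auto intro!: address_in_gasket)
  thus ?case using Suc by (intro Suc.IH) auto
qed

text \<open>
  A point with two addresses is, at the level where the addresses first differ, the common point
  of two cells; so both addresses end in a constant sequence.
\<close>

lemma address_eqD:
  assumes \<omega>: "range \<omega> \<subseteq> S" and \<omega>': "range \<omega>' \<subseteq> S"
    and eq: "address_point p \<omega> = address_point p \<omega>'" and ne: "\<omega> \<noteq> \<omega>'"
  shows "\<exists>n b. \<forall>m\<ge>n. \<omega> m = b"
proof -
  obtain k where "\<omega> k \<noteq> \<omega>' k" using ne by auto
  define n where "n = (LEAST k. \<omega> k \<noteq> \<omega>' k)"
  have n: "\<omega> n \<noteq> \<omega>' n" unfolding n_def by (rule LeastI) (rule \<open>\<omega> k \<noteq> \<omega>' k\<close>)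
  have "\<omega> m = \<omega>' m" if "m < n" for m using not_less_Least[of m] that unfolding n_def by blast
  hence pre: "map \<omega> [0..<n] = map \<omega>' [0..<n]" by (intro map_cong) auto
  have "address_point p (\<lambda>k. \<omega> (k + n)) = address_point p (\<lambda>k. \<omega>' (k + n))"
    using eq unfolding address_point_prefix[OF \<omega>, of n] address_point_prefix[OF \<omega>', of n] pre by simp
  moreover have "address_point p (\<lambda>k. \<omega> (k + n)) = cmap p (\<omega> n) (address_point p (\<lambda>k. \<omega> (Suc k + n)))"
    using \<omega> by (subst address_point_shift) auto
  moreover have "address_point p (\<lambda>k. \<omega>' (k + n)) = cmap p (\<omega>' n) (address_point p (\<lambda>k. \<omega>' (Suc k + n)))"
    using \<omega>' by (subst address_point_shift) auto
  ultimately have e: "cmap p (\<omega> n) (address_point p (\<lambda>k. \<omega> (Suc k + n)))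
      = cmap p (\<omega>' n) (address_point p (\<lambda>k. \<omega>' (Suc k + n)))" by simp
  have "address_point p (\<lambda>k. \<omega> (Suc k + n)) = p (\<omega>' n)"
    by (rule cmap_eq_cmapD(1)[OF _ _ n _ _ e]) (use \<omega> \<omega>' in \<open>auto intro!: address_in_gasket\<close>)
  hence "\<omega> (Suc k + n) = \<omega>' n" for k
    using \<omega> \<omega>' by (intro address_eq_vertexD[where \<omega>="\<lambda>k. \<omega> (Suc k + n)"]) auto
  hence "\<forall>m\<ge>Suc n. \<omega> m = \<omega>' n" by (metis add.commute add_Suc_right le_Suc_ex)
  thus ?thesis by blast
qed

lemma cell_subset: "set w \<subseteq> S \<Longrightarrow> cell N p w \<subseteq> K"
  by (auto simp: cell_def intro: psi_in_gasket)

lemma closed_cell: "closed (cell N p w)"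
  unfolding cell_def
  by (intro compact_imp_closed compact_continuous_image continuous_on_psi compact_gasket)

lemma coding_point_eq:
  assumes "range \<omega> \<subseteq> S"
  shows "coding_point N p w \<omega> = psi p w (address_point p \<omega>)"
proof -
  let ?x = "psi p w (address_point p \<omega>)"
  obtain D where D: "\<And>x y. x \<in> K \<Longrightarrow> y \<in> K \<Longrightarrow> norm (x - y) \<le> D" using gasket_diameter by metis
  have mem: "?x \<in> cell N p (w @ map \<omega> [0..<n])" for n
    unfolding cell_def psi_append using assms address_point_prefix[OF assms, of n]
    by (auto intro!: imageI address_in_gasket)
  have "y = ?x" if y: "\<And>n. y \<in> cell N p (w @ map \<omega> [0..<n])" for y
  proof (rule ccontr)
    assume "y \<noteq> ?x"
    have *: "norm (y - ?x) \<le> (1 / 2) ^ n * D" for n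
    proof -
      obtain a b where ab: "a \<in> K" "b \<in> K" "y = psi p (w @ map \<omega> [0..<n]) a" "?x = psi p (w @ map \<omega> [0..<n]) b"
        using y[of n] mem[of n] unfolding cell_def by blast
      have "norm (y - ?x) = (1 / 2) ^ (length w + n) * norm (a - b)"
        unfolding ab psi_diff by simp
      also have "\<dots> \<le> (1 / 2) ^ n * D"
        using D[of a b] ab by (intro mult_mono power_decreasing) auto
      finally show ?thesis .
    qed
    have "norm (y - ?x) \<le> 0" by (rule LIMSEQ_le_const[OF half_power_LIMSEQ[of D]]) (use * in auto)
    thus False using \<open>y \<noteq> ?x\<close> by simp
  qed
  with mem have "(\<Inter>n. cell N p (w @ map \<omega> [0..<n])) = {?x}" by blast
  thus ?thesis by (simp add: coding_point_def)
qed

end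

section \<open>Energies and their domain\<close>

lemma words_len_iff: "w \<in> words_len N m \<longleftrightarrow> set w \<subseteq> letters N \<and> length w = m"
  by (auto simp: words_len_def words_def lists_eq_set)

lemma words_len_0 [simp]: "words_len N 0 = {[]}"
  by (auto simp: words_len_iff)

lemma sum_words_Suc:
  "(\<Sum>w\<in>words_len N (Suc m). f w) = (\<Sum>i\<in>letters N. \<Sum>w\<in>words_len N m. f (i # w))"
proof -
  have "bij_betw (\<lambda>(i, w). i # w) (letters N \<times> words_len N m) (words_len N (Suc m))"
    by (auto simp: bij_betw_def inj_on_def words_len_iff image_iff length_Suc_conv)
  from sum.reindex_bij_betw[OF this, of f] show ?thesis
    by (simp add: sum.cartesian_product case_prod_unfold)
qed

text \<open>
  This approximates the functional \<open>2 \<E>(f, f g) - \<E>(f\<^sup>2, g)\<close> defining the energy measure: the two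
  bilinear terms combine pairwise into \<open>(f x - f y)\<^sup>2 (g x + g y)\<close>.
\<close>

definition level_measure_form ::
    "nat \<Rightarrow> (nat \<Rightarrow> real ^ 'n) \<Rightarrow> nat \<Rightarrow> (real ^ 'n \<Rightarrow> real) \<Rightarrow> (real ^ 'n \<Rightarrow> real) \<Rightarrow> real" where
  "level_measure_form N p m f g = ((real N + 3) / (real N + 1)) ^ m * (\<Sum>w\<in>words_len N m.
     1 / 2 * (\<Sum>i\<in>letters N. \<Sum>j\<in>letters N.
       (f (psi p w (p i)) - f (psi p w (p j)))\<^sup>2 * (g (psi p w (p i)) + g (psi p w (p j)))))"

definition level_form ::
    "nat \<Rightarrow> (nat \<Rightarrow> real ^ 'n) \<Rightarrow> nat \<Rightarrow> (real ^ 'n \<Rightarrow> real) \<Rightarrow> (real ^ 'n \<Rightarrow> real) \<Rightarrow> real" where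
  "level_form N p m f g = ((real N + 3) / (real N + 1)) ^ m * (\<Sum>w\<in>words_len N m.
     1 / 2 * (\<Sum>i\<in>letters N. \<Sum>j\<in>letters N.
       (f (psi p w (p i)) - f (psi p w (p j))) * (g (psi p w (p i)) - g (psi p w (p j)))))"

lemma level_energy_0 [simp]: "level_energy N p 0 f = boundary_energy N (\<lambda>i. f (p i))"
  by (simp add: level_energy_def Q0_eq_boundary_energy)

lemma level_energy_Suc:
  "level_energy N p (Suc m) f = (real N + 3) / (real N + 1) * (\<Sum>i\<in>letters N. level_energy N p m (f \<circ> cmap p i))"
  by (simp add: level_energy_def sum_words_Suc sum_distrib_left[symmetric] o_assoc mult_ac)

lemma level_energy_nonneg: "level_energy N p m f \<ge> 0"
  unfolding level_energy_def
  by (auto intro!: mult_nonneg_nonneg sum_nonneg simp: Q0_eq_boundary_energy boundary_energy_nonneg)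

lemma level_measure_form_Suc:
  "level_measure_form N p (Suc m) f g =
     (real N + 3) / (real N + 1) * (\<Sum>i\<in>letters N. level_measure_form N p m (f \<circ> cmap p i) (g \<circ> cmap p i))"
  by (simp add: level_measure_form_def sum_words_Suc sum_distrib_left[symmetric] mult_ac)

lemma level_energy_add:
  "level_energy N p m (\<lambda>x. f x + g x) = level_energy N p m f + level_energy N p m g + 2 * level_form N p m f g"
proof -
  have "Q0 N p ((\<lambda>x. f x + g x) \<circ> psi p w) = Q0 N p (f \<circ> psi p w) + Q0 N p (g \<circ> psi p w)
     + (\<Sum>i\<in>letters N. \<Sum>j\<in>letters N. (f (psi p w (p i)) - f (psi p w (p j))) * (g (psi p w (p i)) - g (psi p w (p j))))" for w
  proof -
    let ?d = "\<lambda>f i j. f (psi p w (p i)) - f (psi p w (p j)) :: real"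
    have "(\<Sum>i\<in>letters N. \<Sum>j\<in>letters N. ((f (psi p w (p i)) + g (psi p w (p i))) - (f (psi p w (p j)) + g (psi p w (p j))))\<^sup>2)
      = (\<Sum>i\<in>letters N. \<Sum>j\<in>letters N. (?d f i j)\<^sup>2 + (?d g i j)\<^sup>2 + 2 * (?d f i j * ?d g i j))"
      by (intro sum.cong refl) (simp add: power2_eq_square algebra_simps)
    thus ?thesis unfolding Q0_def o_def sum.distrib sum_distrib_left[symmetric] by simp
  qed
  thus ?thesis
    by (simp add: level_energy_def level_form_def sum.distrib algebra_simps sum_distrib_left sum_divide_distrib)
qed

lemma level_measure_form_eq:
  "level_measure_form N p m f g =
     2 * level_form N p m f (\<lambda>x. f x * g x) - level_form N p m (\<lambda>x. (f x)\<^sup>2) g"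
proof -
  have *: "(a - b)\<^sup>2 * (c + d) = 2 * ((a - b) * (a * c - b * d)) - (a\<^sup>2 - b\<^sup>2) * (c - d)" for a b c d :: real
    by (simp add: power2_eq_square algebra_simps)
  show ?thesis
    unfolding level_measure_form_def level_form_def * sum_subtractf sum_distrib_left[symmetric]
      right_diff_distrib
    by (simp add: mult_ac)
qed

context sierpinski
begin

lemma level_energy_cong:
  assumes "\<And>x. x \<in> K \<Longrightarrow> f x = g x"
  shows "level_energy N p m f = level_energy N p m g"
  using assms
proof (induction m arbitrary: f g)
  case 0
  thus ?case by (auto intro!: boundary_energy_cong vertex_in_gasket)
next
  case (Suc m)
  have "level_energy N p m (f \<circ> cmap p i) = level_energy N p m (g \<circ> cmap p i)" if "i \<in> S" for i
    by (rule Suc.IH) (use that Suc.prems cmap_in_gasket in simp)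
  thus ?case by (simp add: level_energy_Suc)
qed

text \<open>
  This identity yields both that the level energies increase and, through its remainder term, that
  constancy of the level energies forces the values given by \<open>restr\<close>.
\<close>

lemma first_level_energy_split:
  "level_energy N p (Suc 0) f = boundary_energy N (\<lambda>i. f (p i))
     + (real N + 3) / (real N + 1) *
       (\<Sum>i\<in>S. boundary_energy N (\<lambda>j. f (cmap p i (p j)) - restr N i (\<lambda>k. f (p k)) j))"
proof -
  have "(\<Sum>i\<in>S. boundary_energy N (\<lambda>j. f (cmap p i (p j)))) =
     (real N + 1) / (real N + 3) * boundary_energy N (\<lambda>i. f (p i))
     + (\<Sum>i\<in>S. boundary_energy N (\<lambda>j. f (cmap p i (p j)) - restr N i (\<lambda>k. f (p k)) j))"
    by (rule sum_boundary_energy_split) (simp_all add: cmap_vertex_sym)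
  thus ?thesis
    by (simp add: level_energy_Suc distrib_left)
qed

lemma level_energy_mono_Suc: "level_energy N p m f \<le> level_energy N p (Suc m) f"
proof (induction m arbitrary: f)
  case 0
  have "0 \<le> (real N + 3) / (real N + 1) *
       (\<Sum>i\<in>S. boundary_energy N (\<lambda>j. f (cmap p i (p j)) - restr N i (\<lambda>k. f (p k)) j))"
    by (intro mult_nonneg_nonneg sum_nonneg boundary_energy_nonneg) simp
  thus ?case unfolding first_level_energy_split by simp
next
  case (Suc m)
  show ?case unfolding level_energy_Suc[of N p m f] level_energy_Suc[of N p "Suc m" f]
    by (intro mult_left_mono sum_mono Suc.IH) auto
qed

lemma level_energy_mono: "m \<le> n \<Longrightarrow> level_energy N p m f \<le> level_energy N p n f"
  by (rule lift_Suc_mono_le[of "\<lambda>m. level_energy N p m f"]) (rule level_energy_mono_Suc)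

lemma energy_eq_SUP: "energy N p f = (SUP m. ennreal (level_energy N p m f))"
  and energy_LIMSEQ: "(\<lambda>m. ennreal (level_energy N p m f)) \<longlonglongrightarrow> energy N p f"
proof -
  have "incseq (\<lambda>m. ennreal (level_energy N p m f))"
    by (intro monoI ennreal_leI level_energy_mono)
  hence *: "(\<lambda>m. ennreal (level_energy N p m f)) \<longlonglongrightarrow> (SUP m. ennreal (level_energy N p m f))"
    by (rule LIMSEQ_SUP)
  thus "energy N p f = (SUP m. ennreal (level_energy N p m f))"
    unfolding energy_def by (rule limI)
  with * show "(\<lambda>m. ennreal (level_energy N p m f)) \<longlonglongrightarrow> energy N p f" by simp
qed

lemma level_le_energy: "ennreal (level_energy N p m f) \<le> energy N p f"
  unfolding energy_eq_SUP by (rule SUP_upper) simp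

lemma energy_domainI:
  assumes "continuous_on K f" "\<And>m. level_energy N p m f \<le> c"
  shows "f \<in> energy_domain N p"
proof -
  have "energy N p f \<le> ennreal c"
    unfolding energy_eq_SUP by (intro SUP_least ennreal_leI assms)
  also have "\<dots> < \<infinity>" by simp
  finally show ?thesis using assms by (simp add: energy_domain_def)
qed

lemma
  assumes "f \<in> energy_domain N p"
  shows energy_domain_continuous: "continuous_on K f"
    and energy_domain_LIMSEQ: "(\<lambda>m. level_energy N p m f) \<longlonglongrightarrow> enn2real (energy N p f)"
    and energy_domain_level_le: "level_energy N p m f \<le> enn2real (energy N p f)"
proof -
  show "continuous_on K f" using assms by (simp add: energy_domain_def)
  have e: "ennreal (enn2real (energy N p f)) = energy N p f"
    using assms by (simp add: energy_domain_def)
  show "(\<lambda>m. level_energy N p m f) \<longlonglongrightarrow> enn2real (energy N p f)"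
  proof (rule tendsto_ennrealD)
    show "(\<lambda>m. ennreal (level_energy N p m f)) \<longlonglongrightarrow> ennreal (enn2real (energy N p f))"
      unfolding e by (rule energy_LIMSEQ)
    show "\<forall>\<^sub>F m in sequentially. 0 \<le> level_energy N p m f"
      by (intro always_eventually allI level_energy_nonneg)
  qed simp
  have "ennreal (level_energy N p m f) \<le> ennreal (enn2real (energy N p f))"
    unfolding e by (rule level_le_energy)
  thus "level_energy N p m f \<le> enn2real (energy N p f)"
    by (subst (asm) ennreal_le_iff) simp_all
qed

lemma word_vertex_in_gasket: "w \<in> words_len N m \<Longrightarrow> i \<in> S \<Longrightarrow> psi p w (p i) \<in> K"
  by (intro psi_in_gasket vertex_in_gasket) (auto simp: words_len_iff)

lemma level_energy_le_comb:
  assumes "\<And>x y. x \<in> K \<Longrightarrow> y \<in> K \<Longrightarrow> (f x - f y)\<^sup>2 \<le> a * (g x - g y)\<^sup>2 + b * (h x - h y)\<^sup>2"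
  shows "level_energy N p m f \<le> a * level_energy N p m g + b * level_energy N p m h"
proof -
  have "Q0 N p (f \<circ> psi p w) \<le> a * Q0 N p (g \<circ> psi p w) + b * Q0 N p (h \<circ> psi p w)"
    if w: "w \<in> words_len N m" for w
  proof -
    have "(\<Sum>i\<in>S. \<Sum>j\<in>S. ((f \<circ> psi p w) (p i) - (f \<circ> psi p w) (p j))\<^sup>2)
       \<le> (\<Sum>i\<in>S. \<Sum>j\<in>S. a * ((g \<circ> psi p w) (p i) - (g \<circ> psi p w) (p j))\<^sup>2 + b * ((h \<circ> psi p w) (p i) - (h \<circ> psi p w) (p j))\<^sup>2)"
      using w by (intro sum_mono) (simp add: assms word_vertex_in_gasket)
    thus ?thesis unfolding Q0_def by (simp add: sum.distrib sum_distrib_left[symmetric])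
  qed
  hence "(\<Sum>w\<in>words_len N m. Q0 N p (f \<circ> psi p w)) \<le>
     (\<Sum>w\<in>words_len N m. a * Q0 N p (g \<circ> psi p w) + b * Q0 N p (h \<circ> psi p w))"
    by (rule sum_mono)
  also have "\<dots> = a * (\<Sum>w\<in>words_len N m. Q0 N p (g \<circ> psi p w)) + b * (\<Sum>w\<in>words_len N m. Q0 N p (h \<circ> psi p w))"
    by (simp add: sum.distrib sum_distrib_left)
  finally have "level_energy N p m f \<le> ((real N + 3) / (real N + 1)) ^ m * (a * (\<Sum>w\<in>words_len N m. Q0 N p (g \<circ> psi p w)) + b * (\<Sum>w\<in>words_len N m. Q0 N p (h \<circ> psi p w)))"
    unfolding level_energy_def by (rule mult_left_mono) simp
  also have "\<dots> = a * level_energy N p m g + b * level_energy N p m h"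
    by (simp add: level_energy_def algebra_simps)
  finally show ?thesis .
qed

text \<open>
  A criterion from which the domain is seen to be an algebra.
\<close>

lemma energy_domain_comb:
  assumes "g \<in> energy_domain N p" "h \<in> energy_domain N p" "continuous_on K f" "a \<ge> 0" "b \<ge> 0"
    and "\<And>x y. x \<in> K \<Longrightarrow> y \<in> K \<Longrightarrow> (f x - f y)\<^sup>2 \<le> a * (g x - g y)\<^sup>2 + b * (h x - h y)\<^sup>2"
  shows "f \<in> energy_domain N p"
proof (rule energy_domainI[OF assms(3)])
  fix m
  have "level_energy N p m f \<le> a * level_energy N p m g + b * level_energy N p m h"
    by (rule level_energy_le_comb) (rule assms(6))
  also have "\<dots> \<le> a * enn2real (energy N p g) + b * enn2real (energy N p h)"
    using assms by (intro add_mono mult_left_mono energy_domain_level_le)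
  finally show "level_energy N p m f \<le> a * enn2real (energy N p g) + b * enn2real (energy N p h)" .
qed

lemma energy_domain_add:
  assumes f: "f \<in> energy_domain N p" and g: "g \<in> energy_domain N p"
  shows "(\<lambda>x. f x + g x) \<in> energy_domain N p"
proof (rule energy_domain_comb[OF f g, of _ 2 2])
  show "continuous_on K (\<lambda>x. f x + g x)"
    by (intro continuous_on_add energy_domain_continuous f g)
  fix x y
  have "((f x + g x) - (f y + g y))\<^sup>2 + ((f x - f y) - (g x - g y))\<^sup>2 = 2 * (f x - f y)\<^sup>2 + 2 * (g x - g y)\<^sup>2"
    by (simp add: power2_eq_square algebra_simps)
  thus "((f x + g x) - (f y + g y))\<^sup>2 \<le> 2 * (f x - f y)\<^sup>2 + 2 * (g x - g y)\<^sup>2"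
    by (metis le_add_same_cancel1 zero_le_power2)
qed auto

lemma energy_domain_bounded:
  assumes "continuous_on K (f :: _ \<Rightarrow> real)"
  obtains B where "B \<ge> 0" "\<And>x. x \<in> K \<Longrightarrow> \<bar>f x\<bar> \<le> B"
proof -
  have "bounded (f ` K)" by (intro compact_imp_bounded compact_continuous_image assms compact_gasket)
  then obtain B where B: "\<forall>y\<in>f ` K. norm y \<le> B" by (auto simp: bounded_iff)
  show ?thesis by (rule that[of "max B 0"]) (use B in auto)
qed

lemma energy_domain_mult:
  assumes f: "f \<in> energy_domain N p" and g: "g \<in> energy_domain N p"
  shows "(\<lambda>x. f x * g x) \<in> energy_domain N p"
proof -
  obtain A where A: "A \<ge> 0" "\<And>x. x \<in> K \<Longrightarrow> \<bar>f x\<bar> \<le> A"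
    using energy_domain_bounded[OF energy_domain_continuous[OF f]] by metis
  obtain B where B: "B \<ge> 0" "\<And>x. x \<in> K \<Longrightarrow> \<bar>g x\<bar> \<le> B"
    using energy_domain_bounded[OF energy_domain_continuous[OF g]] by metis
  show ?thesis
  proof (rule energy_domain_comb[OF f g, of _ "2 * B\<^sup>2" "2 * A\<^sup>2"])
    show "continuous_on K (\<lambda>x. f x * g x)"
      by (intro continuous_on_mult energy_domain_continuous f g)
    fix x y assume x: "x \<in> K" and y: "y \<in> K"
    have "(f x * g x - f y * g y)\<^sup>2 = (g x * (f x - f y) + f y * (g x - g y))\<^sup>2"
      by (simp add: algebra_simps)
    also have "\<dots> \<le> 2 * (g x * (f x - f y))\<^sup>2 + 2 * (f y * (g x - g y))\<^sup>2"
      using zero_le_power2[of "g x * (f x - f y) - f y * (g x - g y)"]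
      unfolding power2_diff power2_sum by linarith
    also have "\<dots> = 2 * ((g x)\<^sup>2 * (f x - f y)\<^sup>2) + 2 * ((f y)\<^sup>2 * (g x - g y)\<^sup>2)"
      by (simp add: power_mult_distrib)
    also have "\<dots> \<le> 2 * (B\<^sup>2 * (f x - f y)\<^sup>2) + 2 * (A\<^sup>2 * (g x - g y)\<^sup>2)"
      using A(2)[OF y] B(2)[OF x] A(1) B(1)
      by (intro add_mono mult_left_mono mult_right_mono) (auto simp: abs_le_square_iff[symmetric])
    finally show "(f x * g x - f y * g y)\<^sup>2 \<le> 2 * B\<^sup>2 * (f x - f y)\<^sup>2 + 2 * A\<^sup>2 * (g x - g y)\<^sup>2"
      by simp
  qed auto
qed

lemma level_form_LIMSEQ:
  assumes f: "f \<in> energy_domain N p" and g: "g \<in> energy_domain N p"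
  shows "(\<lambda>m. level_form N p m f g) \<longlonglongrightarrow> energy_form N p f g"
proof -
  have "(\<lambda>m. 1 / 2 * (level_energy N p m (\<lambda>x. f x + g x) - level_energy N p m f - level_energy N p m g))
     \<longlonglongrightarrow> energy_form N p f g"
    unfolding energy_form_def
    by (intro tendsto_intros energy_domain_LIMSEQ energy_domain_add f g)
  thus ?thesis by (simp add: level_energy_add)
qed

lemma level_measure_form_LIMSEQ:
  assumes f: "f \<in> energy_domain N p" and g: "g \<in> energy_domain N p"
  shows "(\<lambda>m. level_measure_form N p m f g)
     \<longlonglongrightarrow> 2 * energy_form N p f (\<lambda>x. f x * g x) - energy_form N p (\<lambda>x. (f x)\<^sup>2) g"
  unfolding level_measure_form_eq
  by (intro tendsto_intros level_form_LIMSEQ energy_domain_mult f g)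
     (use energy_domain_mult[OF f f] in \<open>simp add: power2_eq_square\<close>)

section \<open>Harmonic functions\<close>

text \<open>
  Functions on the first-level cells that agree at the midpoints, where these cells meet, can be
  pasted together.
\<close>

definition glue :: "(nat \<Rightarrow> real ^ 'n \<Rightarrow> real) \<Rightarrow> real ^ 'n \<Rightarrow> real" where
  "glue F x = (let i = SOME i. i \<in> S \<and> x \<in> cmap p i ` K in F i (2 *\<^sub>R x - p i))"

definition compatible :: "(nat \<Rightarrow> real ^ 'n \<Rightarrow> real) \<Rightarrow> bool" where
  "compatible F \<longleftrightarrow> (\<forall>i\<in>S. \<forall>j\<in>S. F i (p j) = F j (p i))"

lemma glue_cmap:
  assumes "compatible F" and i: "i \<in> S" and y: "y \<in> K"
  shows "glue F (cmap p i y) = F i y"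
proof -
  define j where "j = (SOME j. j \<in> S \<and> cmap p i y \<in> cmap p j ` K)"
  have "j \<in> S \<and> cmap p i y \<in> cmap p j ` K"
    unfolding j_def by (rule someI[of _ i]) (use i y in blast)
  then obtain z where z: "j \<in> S" "z \<in> K" "cmap p i y = cmap p j z" by blast
  have "glue F (cmap p i y) = F j (2 *\<^sub>R cmap p i y - p j)"
    unfolding glue_def Let_def j_def[symmetric] ..
  also have "\<dots> = F j z" unfolding z(3) cmap_inverse ..
  also have "\<dots> = F i y"
  proof (cases "i = j")
    case True thus ?thesis using z(3) by simp
  next
    case False
    from cmap_eq_cmapD[OF i z(1) False y z(2,3)] have "y = p j" "z = p i" .
    thus ?thesis using assms z(1) unfolding compatible_def by simp
  qed
  finally show ?thesis .
qed

lemma continuous_on_glue: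
  assumes F: "compatible F" and cont: "\<And>i. i \<in> S \<Longrightarrow> continuous_on K (F i)"
  shows "continuous_on K (glue F)"
proof -
  have "continuous_on (\<Union>i\<in>S. cmap p i ` K) (glue F)"
  proof (rule continuous_on_closed_Union)
    fix i assume i: "i \<in> S"
    show "closed (cmap p i ` K)"
      by (intro compact_imp_closed compact_continuous_image continuous_on_cmap compact_gasket)
    have "continuous_on (cmap p i ` K) (\<lambda>x. F i (2 *\<^sub>R x - p i))"
      by (rule continuous_on_compose2[OF cont[OF i]]) (auto intro!: continuous_intros simp: cmap_inverse)
    thus "continuous_on (cmap p i ` K) (glue F)"
      by (rule continuous_on_eq) (use glue_cmap[OF F i] in \<open>auto simp: cmap_inverse\<close>)
  qed simp
  thus ?thesis using gasket_invariant by simp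
qed

text \<open>
  Harmonic functions are constructed as uniform limits: affine interpolation is pushed to finer and
  finer cells, and by contraction of the oscillation the changes decrease geometrically.
\<close>

primrec harmonic_approx :: "nat \<Rightarrow> (nat \<Rightarrow> real) \<Rightarrow> real ^ 'n \<Rightarrow> real" where
  "harmonic_approx 0 = (\<lambda>u x. \<Sum>k\<in>S. u k * barycentric k x)"
| "harmonic_approx (Suc n) = (\<lambda>u. glue (\<lambda>i. harmonic_approx n (restr N i u)))"

lemma harmonic_approx_props:
  shows harmonic_approx_vertex: "j \<in> S \<Longrightarrow> harmonic_approx n u (p j) = u j"
    and harmonic_approx_compatible: "compatible (\<lambda>i. harmonic_approx n (restr N i u))"
proof -
  have c: "compatible (\<lambda>i. harmonic_approx n (restr N i u))"
    if "\<And>u j. j \<in> S \<Longrightarrow> harmonic_approx n u (p j) = u j" for n u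
    unfolding compatible_def by (simp add: that restr_sym)
  have v: "j \<in> S \<Longrightarrow> harmonic_approx n u (p j) = u j" for n u j
  proof (induction n arbitrary: u j)
    case 0
    hence "harmonic_approx 0 u (p j) = (\<Sum>k\<in>S. if k = j then u k else 0)"
      unfolding harmonic_approx.simps by (intro sum.cong refl) (simp add: barycentric_vertex)
    thus ?case using 0 by simp
  next
    case (Suc n)
    have "harmonic_approx (Suc n) u (cmap p j (p j)) = harmonic_approx n (restr N j u) (p j)"
      unfolding harmonic_approx.simps
      by (intro glue_cmap c Suc.IH Suc.prems vertex_in_gasket)
    thus ?case using Suc by simp
  qed
  show "j \<in> S \<Longrightarrow> harmonic_approx n u (p j) = u j" by (rule v)
  show "compatible (\<lambda>i. harmonic_approx n (restr N i u))" by (rule c) (rule v)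
qed

lemma harmonic_approx_cmap:
  "i \<in> S \<Longrightarrow> y \<in> K \<Longrightarrow> harmonic_approx (Suc n) u (cmap p i y) = harmonic_approx n (restr N i u) y"
  unfolding harmonic_approx.simps by (intro glue_cmap harmonic_approx_compatible)

lemma continuous_on_harmonic_approx: "continuous_on K (harmonic_approx n u)"
proof (induction n arbitrary: u)
  case 0 show ?case
    unfolding harmonic_approx.simps by (intro continuous_intros continuous_on_barycentric)
next
  case (Suc n) show ?case
    unfolding harmonic_approx.simps by (intro continuous_on_glue harmonic_approx_compatible Suc.IH)
qed

lemma harmonic_approx_bounds:
  assumes "\<And>j. j \<in> S \<Longrightarrow> A \<le> u j" "\<And>j. j \<in> S \<Longrightarrow> u j \<le> B" "x \<in> K"
  shows "A \<le> harmonic_approx n u x \<and> harmonic_approx n u x \<le> B"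
  using assms
proof (induction n arbitrary: u x)
  case 0
  have "(\<Sum>k\<in>S. A * barycentric k x) \<le> (\<Sum>k\<in>S. u k * barycentric k x)"
       "(\<Sum>k\<in>S. u k * barycentric k x) \<le> (\<Sum>k\<in>S. B * barycentric k x)"
    using 0 barycentric_gasket(1) by (intro sum_mono mult_right_mono; simp)+
  thus ?case using barycentric_gasket(2)[OF 0(3)] by (simp add: sum_distrib_left[symmetric])
next
  case (Suc n)
  obtain i y where iy: "i \<in> S" "y \<in> K" "x = cmap p i y" using Suc.prems(3) by (rule gasket_cases)
  have "A \<le> harmonic_approx n (restr N i u) y \<and> harmonic_approx n (restr N i u) y \<le> B"
    using restr_bounds[OF iy(1) _ Suc.prems(1,2)] by (intro Suc.IH iy(2)) auto
  thus ?case unfolding iy(3) harmonic_approx_cmap[OF iy(1,2)] .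
qed

lemma harmonic_approx_step:
  assumes "\<And>j k. j \<in> S \<Longrightarrow> k \<in> S \<Longrightarrow> \<bar>u j - u k\<bar> \<le> c" "x \<in> K"
  shows "\<bar>harmonic_approx (Suc n) u x - harmonic_approx n u x\<bar> \<le> ((real N + 1) / (real N + 3)) ^ n * c"
  using assms
proof (induction n arbitrary: u x c)
  case 0
  define A B where "A = Min (u ` S)" and "B = Max (u ` S)"
  have AB: "A \<le> u j" "u j \<le> B" if "j \<in> S" for j using that by (auto simp: A_def B_def)
  obtain a b where ab: "a \<in> S" "b \<in> S" "A = u a" "B = u b"
  proof -
    have "A \<in> u ` S" "B \<in> u ` S" unfolding A_def B_def by (intro Min_in Max_in; simp)+
    thus ?thesis using that by blast
  qed
  have "A \<le> harmonic_approx n u x \<and> harmonic_approx n u x \<le> B" for n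
    by (rule harmonic_approx_bounds[OF _ _ 0(2)]) (use AB in auto)
  from this[of 0] this[of 1] have "\<bar>harmonic_approx (Suc 0) u x - harmonic_approx 0 u x\<bar> \<le> B - A"
    unfolding One_nat_def by linarith
  also have "\<dots> \<le> c" using 0(1)[OF ab(2,1)] ab by simp
  finally show ?case by simp
next
  case (Suc n)
  obtain i y where iy: "i \<in> S" "y \<in> K" "x = cmap p i y" using Suc.prems(2) by (rule gasket_cases)
  have "\<bar>harmonic_approx (Suc n) (restr N i u) y - harmonic_approx n (restr N i u) y\<bar>
      \<le> ((real N + 1) / (real N + 3)) ^ n * ((real N + 1) / (real N + 3) * c)"
    by (rule Suc.IH[OF _ iy(2)]) (rule restr_osc[OF iy(1)]; use Suc.prems in simp)
  thus ?case unfolding iy(3) harmonic_approx_cmap[OF iy(1,2)] by (simp add: mult_ac)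
qed

definition harmonic_extension :: "(nat \<Rightarrow> real) \<Rightarrow> real ^ 'n \<Rightarrow> real" where
  "harmonic_extension u x = lim (\<lambda>n. harmonic_approx n u x)"

lemma osc_bound: obtains c where "\<And>j k. j \<in> S \<Longrightarrow> k \<in> S \<Longrightarrow> \<bar>u j - u k\<bar> \<le> (c :: real)"
proof
  show "\<bar>u j - u k\<bar> \<le> 2 * (\<Sum>i\<in>S. \<bar>u i\<bar>)" if "j \<in> S" "k \<in> S" for j k
    using member_le_sum[of j S "\<lambda>i. \<bar>u i\<bar>"] member_le_sum[of k S "\<lambda>i. \<bar>u i\<bar>"] that by auto
qed

lemma harmonic_extension_limits:
  shows harmonic_approx_LIMSEQ: "x \<in> K \<Longrightarrow> (\<lambda>n. harmonic_approx n u x) \<longlonglongrightarrow> harmonic_extension u x"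
    and continuous_on_harmonic_extension: "continuous_on K (harmonic_extension u)"
proof -
  obtain c where c: "\<And>j k. j \<in> S \<Longrightarrow> k \<in> S \<Longrightarrow> \<bar>u j - u k\<bar> \<le> c" using osc_bound by metis
  define d where "d n x = harmonic_approx (Suc n) u x - harmonic_approx n u x" for n x
  define g where "g x = harmonic_approx 0 u x + (\<Sum>n. d n x)" for x
  have "uniform_limit K (\<lambda>n x. \<Sum>i<n. d i x) (\<lambda>x. \<Sum>i. d i x) sequentially"
  proof (rule Weierstrass_m_test)
    show "norm (d n x) \<le> ((real N + 1) / (real N + 3)) ^ n * c" if "x \<in> K" for n x
      unfolding d_def real_norm_def by (rule harmonic_approx_step[OF c that])
    show "summable (\<lambda>n. ((real N + 1) / (real N + 3)) ^ n * c)"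
      by (intro summable_mult2 summable_geometric) simp
  qed
  hence "uniform_limit K (\<lambda>n x. harmonic_approx 0 u x + (\<Sum>i<n. d i x)) g sequentially"
    unfolding g_def by (intro uniform_limit_add uniform_limit_const)
  moreover have "harmonic_approx 0 u x + (\<Sum>i<n. d i x) = harmonic_approx n u x" for n x
    unfolding d_def sum_lessThan_telescope[of "\<lambda>n. harmonic_approx n u x"] by simp
  ultimately have ul: "uniform_limit K (\<lambda>n. harmonic_approx n u) g sequentially" by simp
  have t: "(\<lambda>n. harmonic_approx n u x) \<longlonglongrightarrow> g x" if "x \<in> K" for x
    by (rule tendsto_uniform_limitI[OF ul that])
  have e: "harmonic_extension u x = g x" if "x \<in> K" for x
    unfolding harmonic_extension_def by (rule limI[OF t[OF that]])
  show "x \<in> K \<Longrightarrow> (\<lambda>n. harmonic_approx n u x) \<longlonglongrightarrow> harmonic_extension u x"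
    using t e by simp
  have "continuous_on K g"
    by (rule uniform_limit_theorem[OF _ ul]) (auto simp: continuous_on_harmonic_approx simp del: harmonic_approx.simps)
  thus "continuous_on K (harmonic_extension u)"
    by (rule continuous_on_eq) (simp add: e)
qed

lemma harmonic_extension_vertex: "j \<in> S \<Longrightarrow> harmonic_extension u (p j) = u j"
  unfolding harmonic_extension_def by (rule limI) (simp add: harmonic_approx_vertex)

lemma harmonic_extension_cmap:
  assumes "i \<in> S" "y \<in> K"
  shows "harmonic_extension u (cmap p i y) = harmonic_extension (restr N i u) y"
proof (rule LIMSEQ_unique)
  show "(\<lambda>n. harmonic_approx (Suc n) u (cmap p i y)) \<longlonglongrightarrow> harmonic_extension u (cmap p i y)"
    by (intro LIMSEQ_Suc harmonic_approx_LIMSEQ cmap_in_gasket assms)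
  show "(\<lambda>n. harmonic_approx (Suc n) u (cmap p i y)) \<longlonglongrightarrow> harmonic_extension (restr N i u) y"
    unfolding harmonic_approx_cmap[OF assms] by (intro harmonic_approx_LIMSEQ assms)
qed

lemma harmonic_extension_bounds:
  assumes "\<And>j. j \<in> S \<Longrightarrow> A \<le> u j" "\<And>j. j \<in> S \<Longrightarrow> u j \<le> B" "x \<in> K"
  shows "A \<le> harmonic_extension u x" "harmonic_extension u x \<le> B"
proof -
  note b = harmonic_approx_bounds[of A u B, OF _ _ assms(3)] and l = harmonic_approx_LIMSEQ[OF assms(3)]
  show "A \<le> harmonic_extension u x" by (rule LIMSEQ_le_const[OF l]) (use b assms in blast)
  show "harmonic_extension u x \<le> B" by (rule LIMSEQ_le_const2[OF l]) (use b assms in blast)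
qed

lemma level_energy_harmonic_extension:
  "level_energy N p m (harmonic_extension u) = boundary_energy N u"
proof (induction m arbitrary: u)
  case 0
  show ?case unfolding level_energy_0
    by (intro boundary_energy_cong) (rule harmonic_extension_vertex)
next
  case (Suc m)
  have "level_energy N p m (harmonic_extension u \<circ> cmap p i) = boundary_energy N (restr N i u)" if "i \<in> S" for i
    unfolding Suc.IH[symmetric]
    by (rule level_energy_cong) (use harmonic_extension_cmap[OF that] in simp)
  thus ?case by (simp add: level_energy_Suc sum_boundary_energy_restr)
qed

lemma harmonic_extension_domain: "harmonic_extension u \<in> energy_domain N p"
  by (rule energy_domainI[where c="boundary_energy N u"])
     (simp_all add: continuous_on_harmonic_extension level_energy_harmonic_extension)

lemma energy_harmonic_extension: "energy N p (harmonic_extension u) = ennreal (boundary_energy N u)"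
  unfolding energy_eq_SUP level_energy_harmonic_extension by simp

lemma boundary_energy_le_energy:
  assumes "\<And>i. i \<in> S \<Longrightarrow> f (p i) = u i"
  shows "ennreal (boundary_energy N u) \<le> energy N p f"
proof -
  have "boundary_energy N u = level_energy N p 0 f"
    unfolding level_energy_0 by (rule boundary_energy_cong) (simp add: assms)
  thus ?thesis using level_le_energy[of 0 f] by simp
qed

text \<open>
  No function with boundary values \<open>u\<close> has less energy than its restriction to the boundary, and the
  harmonic extension has exactly that energy.
\<close>

lemma Inf_energy:
  "Inf (energy N p ` {f \<in> energy_domain N p. \<forall>i\<in>S. f (p i) = u i}) = ennreal (boundary_energy N u)"
proof (rule antisym)
  show "Inf (energy N p ` {f \<in> energy_domain N p. \<forall>i\<in>S. f (p i) = u i}) \<le> ennreal (boundary_energy N u)"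
    by (rule Inf_lower, rule image_eqI[where x="harmonic_extension u"])
       (simp_all add: harmonic_extension_domain harmonic_extension_vertex energy_harmonic_extension)
  show "ennreal (boundary_energy N u) \<le> Inf (energy N p ` {f \<in> energy_domain N p. \<forall>i\<in>S. f (p i) = u i})"
    by (rule Inf_greatest) (auto intro!: boundary_energy_le_energy)
qed

lemma harmonic_extension_harmonic: "harmonic_extension u \<in> harmonic N p"
proof -
  have "boundary_energy N (\<lambda>i. harmonic_extension u (p i)) = boundary_energy N u"
    by (intro boundary_energy_cong) (rule harmonic_extension_vertex)
  thus ?thesis
    unfolding harmonic_def using Inf_energy[of "\<lambda>i. harmonic_extension u (p i)"]
    by (simp add: harmonic_extension_domain energy_harmonic_extension)
qed

lemma harmonic_level_energy:
  assumes "h \<in> harmonic N p"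
  shows "level_energy N p m h = level_energy N p 0 h"
proof (rule antisym)
  have "ennreal (level_energy N p m h) \<le> energy N p h" by (rule level_le_energy)
  also have "\<dots> = ennreal (boundary_energy N (\<lambda>i. h (p i)))"
    using assms Inf_energy[of "\<lambda>i. h (p i)"] by (simp add: harmonic_def)
  finally show "level_energy N p m h \<le> level_energy N p 0 h"
    by (simp add: boundary_energy_nonneg)
  show "level_energy N p 0 h \<le> level_energy N p m h" by (rule level_energy_mono) simp
qed

text \<open>
  If no level adds energy, then neither does any level within a first-level cell, since the level
  energies of the cells are monotone and add up. So the extension rule applies in every cell.
\<close>

lemma constant_level_energy_values:
  assumes "\<And>m. level_energy N p m h = level_energy N p 0 h" "set w \<subseteq> S" "k \<in> S"
  shows "h (psi p w (p k)) = restrs N w (\<lambda>i. h (p i)) k"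
  using assms
proof (induction w arbitrary: h)
  case (Cons i w)
  have i: "i \<in> S" and w: "set w \<subseteq> S" using Cons.prems by auto
  let ?d = "\<lambda>i j. h (cmap p i (p j)) - restr N i (\<lambda>k. h (p k)) j"
  have "(real N + 3) / (real N + 1) * (\<Sum>i\<in>S. boundary_energy N (?d i)) = 0"
    using first_level_energy_split[of h] Cons.prems(1)[of "Suc 0"] by simp
  hence "(\<Sum>i\<in>S. boundary_energy N (?d i)) = 0" by simp
  hence "boundary_energy N (?d i) = 0"
    using i by (subst (asm) sum_nonneg_eq_0_iff) (auto simp: boundary_energy_nonneg)
  hence "?d i j = ?d i i" if "j \<in> S" for j
    using boundary_energy_eq_0D[of N "?d i" j i] that i by blast
  hence v: "h (cmap p i (p j)) = restr N i (\<lambda>k. h (p k)) j" if "j \<in> S" for j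
    using that by simp
  have const: "level_energy N p m (h \<circ> cmap p i) = level_energy N p 0 (h \<circ> cmap p i)" for m
  proof (rule ccontr)
    assume ne: "level_energy N p m (h \<circ> cmap p i) \<noteq> level_energy N p 0 (h \<circ> cmap p i)"
    have le: "level_energy N p 0 (h \<circ> cmap p j) \<le> level_energy N p m (h \<circ> cmap p j)" for j
      by (rule level_energy_mono) simp
    have "(\<Sum>j\<in>S. level_energy N p 0 (h \<circ> cmap p j)) < (\<Sum>j\<in>S. level_energy N p m (h \<circ> cmap p j))"
    proof (rule sum_strict_mono_ex1)
      show "\<exists>j\<in>S. level_energy N p 0 (h \<circ> cmap p j) < level_energy N p m (h \<circ> cmap p j)"
        by (rule bexI[OF _ i]) (use le[of i] ne in linarith)
    qed (use le in simp_all)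
    hence "level_energy N p (Suc 0) h < level_energy N p (Suc m) h"
      unfolding level_energy_Suc by (intro mult_strict_left_mono) auto
    thus False using Cons.prems(1)[of "Suc 0"] Cons.prems(1)[of "Suc m"] by simp
  qed
  have "h (psi p (i # w) (p k)) = (h \<circ> cmap p i) (psi p w (p k))" by simp
  also have "\<dots> = restrs N w (\<lambda>j. (h \<circ> cmap p i) (p j)) k"
    by (rule Cons.IH[OF const w Cons.prems(3)])
  also have "\<dots> = restrs N w (restr N i (\<lambda>k. h (p k))) k"
    by (rule restrs_cong[OF w]) (use v Cons.prems in simp_all)
  finally show ?case by simp
qed simp

lemma harmonic_values:
  assumes "h \<in> harmonic N p" "set w \<subseteq> S" "k \<in> S"
  shows "h (psi p w (p k)) = restrs N w (\<lambda>i. h (p i)) k"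
  by (rule constant_level_energy_values[OF harmonic_level_energy[OF assms(1)] assms(2,3)])

text \<open>
  The closure of the set of vertices is invariant, and \<open>invariant_subset\<close> applies.
\<close>

lemma gasket_subset_closure_vertices:
  "K \<subseteq> closure {psi p w (p k) | w k. set w \<subseteq> S \<and> k \<in> S}" (is "_ \<subseteq> closure ?V")
proof (rule invariant_subset)
  have "?V \<subseteq> K" by (auto intro: psi_in_gasket vertex_in_gasket)
  hence "closure ?V \<subseteq> K" using closed_gasket by (rule closure_minimal)
  thus "compact (closure ?V)" using compact_gasket
    by (meson bounded_subset closed_closure compact_eq_bounded_closed)
  have "psi p [] (p (Suc 0)) \<in> ?V" using one_in_letters by fastforce
  thus "closure ?V \<noteq> {}" by auto
  have "cmap p i ` closure ?V \<subseteq> closure ?V" if i: "i \<in> S" for i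
  proof (rule image_closure_subset)
    show "continuous_on (closure ?V) (cmap p i)" by (rule continuous_on_cmap)
    have "cmap p i (psi p w (p k)) \<in> ?V" if "set w \<subseteq> S" "k \<in> S" for w k
      using that i by (intro CollectI exI[of _ "i # w"] exI[of _ k]) simp
    thus "cmap p i ` ?V \<subseteq> closure ?V" using closure_subset[of ?V] by blast
  qed simp
  thus "(\<Union>i\<in>S. cmap p i ` closure ?V) \<subseteq> closure ?V" by blast
qed (use compact_gasket gasket_invariant in simp_all)

lemma harmonic_const_boundary:
  assumes "h \<in> harmonic N p" "\<And>i. i \<in> S \<Longrightarrow> h (p i) = c" "x \<in> K"
  shows "h x = c"
proof -
  let ?V = "{psi p w (p k) | w k. set w \<subseteq> S \<and> k \<in> S}"
  have VK: "?V \<subseteq> K" by (auto intro: psi_in_gasket vertex_in_gasket)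
  hence "closure ?V \<subseteq> K" using closed_gasket by (rule closure_minimal)
  hence cl: "closure ?V = K" using gasket_subset_closure_vertices by blast
  have "continuous_on (closure ?V) h"
    unfolding cl using assms(1) by (intro energy_domain_continuous) (simp add: harmonic_def)
  moreover have "restrs N w u k = c" if "set w \<subseteq> S" "k \<in> S" "\<And>i. i \<in> S \<Longrightarrow> u i = c" for w k u
    using that
  proof (induction w arbitrary: u)
    case (Cons i w)
    have "c \<le> restr N i u j" "restr N i u j \<le> c" if "j \<in> S" for j
      using restr_bounds[of i N j c u c] Cons.prems that by simp_all
    hence "restr N i u j = c" if "j \<in> S" for j using that by (meson antisym)
    thus ?case using Cons.IH[of "restr N i u"] Cons.prems by simp
  qed simp
  hence "h y = c" if "y \<in> ?V" for y using that harmonic_values[OF assms(1)] assms(2) by auto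
  ultimately show ?thesis
    by (rule continuous_constant_on_closure) (use assms(3) cl in simp_all)
qed

lemma harmonic_basis_props:
  assumes "k \<in> S"
  shows "harmonic_basis N p k \<in> harmonic N p"
    and "i \<in> S \<Longrightarrow> harmonic_basis N p k (p i) = unit_boundary k i"
proof -
  have "\<exists>h. h \<in> harmonic N p \<and> (\<forall>i\<in>S. h (p i) = unit_boundary k i)"
    by (intro exI[of _ "harmonic_extension (unit_boundary k)"])
       (simp add: harmonic_extension_harmonic harmonic_extension_vertex)
  from someI_ex[OF this] show "harmonic_basis N p k \<in> harmonic N p"
    and "i \<in> S \<Longrightarrow> harmonic_basis N p k (p i) = unit_boundary k i"
    unfolding harmonic_basis_def[folded unit_boundary_def, symmetric] by auto
qed


section \<open>Self-similar construction of the energy measure\<close>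

abbreviation scale :: real where "scale \<equiv> (real N + 3) / (real N + 1)"

text \<open>
  The interval \<open>{0..<mass u}\<close> parametrises the gasket. It is divided into one piece per letter, and
  the piece of \<open>i\<close> is an affine copy of the parameter interval belonging to \<open>restr N i u\<close>. The lengths
  add up by \<open>sum_boundary_energy_restr\<close>.
\<close>

definition mass :: "(nat \<Rightarrow> real) \<Rightarrow> real" where
  "mass u = 2 * boundary_energy N u"

definition offset :: "(nat \<Rightarrow> real) \<Rightarrow> nat \<Rightarrow> real" where
  "offset u i = (\<Sum>j = 1..<i. scale * mass (restr N j u))"

definition piece :: "(nat \<Rightarrow> real) \<Rightarrow> nat \<Rightarrow> real set" where
  "piece u i = {offset u i ..< offset u i + scale * mass (restr N i u)}"

lemma mass_nonneg: "mass u \<ge> 0"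
  by (simp add: mass_def boundary_energy_nonneg)

lemma scale_pos: "scale > 0"
  by simp

lemma scale_mass_nonneg: "scale * mass u \<ge> 0"
  by (intro mult_nonneg_nonneg mass_nonneg) simp

lemma sum_mass_restr: "(\<Sum>i\<in>S. scale * mass (restr N i u)) = mass u"
proof -
  have "(\<Sum>i\<in>S. scale * mass (restr N i u)) = scale * 2 * (\<Sum>i\<in>S. boundary_energy N (restr N i u))"
    unfolding mass_def sum_distrib_left by (simp only: mult_ac)
  also have "\<dots> = scale * ((real N + 1) / (real N + 3)) * mass u"
    unfolding sum_boundary_energy_restr mass_def by (simp only: mult_ac)
  also have "scale * ((real N + 1) / (real N + 3)) * mass u = mass u" by simp
  finally show ?thesis .
qed

lemma offset_Suc: "i \<ge> 1 \<Longrightarrow> offset u (Suc i) = offset u i + scale * mass (restr N i u)"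
  by (simp add: offset_def)

lemma offset_nonneg: "0 \<le> offset u i"
  unfolding offset_def by (intro sum_nonneg scale_mass_nonneg)

lemma offset_mono: "i \<le> j \<Longrightarrow> offset u i \<le> offset u j"
  unfolding offset_def by (intro sum_mono2 scale_mass_nonneg) auto

lemma offset_last: "offset u (Suc (N + 1)) = mass u"
proof -
  have "{1..<Suc (N + 1)} = S" by (auto simp: letters_def)
  thus ?thesis using sum_mass_restr[of u] by (simp only: offset_def)
qed

lemma sum_indicator_piece:
  "(\<Sum>i\<in>S. indicator (piece u i) t) = (indicator {0..<mass u} t :: real)"
proof -
  have "(\<Sum>i = 1..n. indicator (piece u i) t) = (indicator {0..<offset u (Suc n)} t :: real)" for n
  proof (induction n)
    case 0 show ?case by (simp add: offset_def)
  next
    case (Suc n)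
    have "piece u (Suc n) = {offset u (Suc n)..<offset u (Suc (Suc n))}"
      by (simp add: piece_def offset_Suc)
    moreover have "0 \<le> offset u (Suc n)" "offset u (Suc n) \<le> offset u (Suc (Suc n))"
      by (auto intro: offset_nonneg offset_mono)
    ultimately show ?case using Suc by (auto simp: indicator_def)
  qed
  from this[of "N + 1"] show ?thesis unfolding offset_last letters_def .
qed

lemma piece_disjoint:
  assumes "i \<in> S" "j \<in> S" "t \<in> piece u i" "t \<in> piece u j" shows "i = j"
proof -
  have *: False if "i < j" "i \<in> S" "t \<in> piece u i" "t \<in> piece u j" for i j
  proof -
    have "offset u i + scale * mass (restr N i u) \<le> offset u j"
      using offset_mono[of "Suc i" j u] that by (simp add: offset_Suc letters_def)
    thus False using that by (auto simp: piece_def)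
  qed
  show ?thesis using *[of i j] *[of j i] assms by (metis linorder_neqE_nat)
qed

lemma piece_cases:
  assumes "t \<in> {0..<mass u}" obtains i where "i \<in> S" "t \<in> piece u i"
proof -
  have "(\<Sum>i\<in>S. indicator (piece u i) t) \<noteq> (0 :: real)"
    using assms unfolding sum_indicator_piece by simp
  then obtain i where "i \<in> S" "indicator (piece u i) t \<noteq> (0 :: real)"
    by (rule sum.not_neutral_contains_not_neutral)
  thus ?thesis using that by (auto simp: indicator_def split: if_splits)
qed

lemma piece_subset: "i \<in> S \<Longrightarrow> t \<in> piece u i \<Longrightarrow> t \<in> {0..<mass u}"
proof -
  assume i: "i \<in> S" and t: "t \<in> piece u i"
  have "indicator (piece u i) t \<le> (\<Sum>i\<in>S. indicator (piece u i) t :: real)"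
    using i by (intro member_le_sum) auto
  hence "1 \<le> (indicator {0..<mass u} t :: real)" unfolding sum_indicator_piece using t by simp
  thus "t \<in> {0..<mass u}" by (rule contrapos_pp) simp
qed

lemma piece_rescale:
  "t \<in> piece u i \<longleftrightarrow> (t - offset u i) / scale \<in> {0..<mass (restr N i u)}"
proof -
  have *: "(a \<le> t \<and> t < a + s * m) \<longleftrightarrow> (0 \<le> (t - a) / s \<and> (t - a) / s < m)" if "s > 0" for a s m :: real
    using that by (auto simp: zero_le_divide_iff pos_divide_less_eq mult.commute)
  show ?thesis unfolding piece_def atLeastLessThan_iff by (rule *[OF scale_pos])
qed

text \<open>
  Locating a parameter in ever finer pieces determines a nested sequence of cells; \<open>sample n u t\<close>
  belongs to the cell found after \<open>n\<close> steps. Any point of the gasket may serve as the start.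
\<close>

primrec sample :: "nat \<Rightarrow> (nat \<Rightarrow> real) \<Rightarrow> real \<Rightarrow> real ^ 'n" where
  "sample 0 = (\<lambda>u t. p (Suc 0))"
| "sample (Suc n) = (\<lambda>u t. \<Sum>i\<in>S. indicator (piece u i) t *\<^sub>R cmap p i (sample n (restr N i u) ((t - offset u i) / scale)))"

definition sample_point :: "(nat \<Rightarrow> real) \<Rightarrow> real \<Rightarrow> real ^ 'n" where
  "sample_point u t = lim (\<lambda>n. sample n u t)"

lemma sample_Suc:
  assumes "i \<in> S" "t \<in> piece u i"
  shows "sample (Suc n) u t = cmap p i (sample n (restr N i u) ((t - offset u i) / scale))"
proof -
  let ?f = "\<lambda>i. cmap p i (sample n (restr N i u) ((t - offset u i) / scale))"
  have "sample (Suc n) u t = (\<Sum>j\<in>S. if j = i then ?f i else 0)"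
    unfolding sample.simps
    by (intro sum.cong refl) (use assms piece_disjoint in \<open>auto simp: indicator_def\<close>)
  thus ?thesis using assms by simp
qed

lemma sample_props:
  assumes D: "\<And>x y. x \<in> K \<Longrightarrow> y \<in> K \<Longrightarrow> norm (x - y) \<le> D"
    and "t \<in> {0..<mass u}"
  shows "sample n u t \<in> K \<and> norm (sample (Suc n) u t - sample n u t) \<le> (1 / 2) ^ n * D"
  using assms(2)
proof (induction n arbitrary: u t)
  case 0
  obtain i where i: "i \<in> S" "t \<in> piece u i" using 0 by (rule piece_cases)
  have "sample (Suc 0) u t \<in> K"
    unfolding sample_Suc[OF i] sample.simps(1) by (intro cmap_in_gasket vertex_in_gasket i one_in_letters)
  thus ?case using D[of "sample (Suc 0) u t" "p (Suc 0)"] vertex_in_gasket[OF one_in_letters]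
    by (simp del: sample.simps(2))
next
  case (Suc n)
  obtain i where i: "i \<in> S" "t \<in> piece u i" using Suc.prems by (rule piece_cases)
  let ?s = "(t - offset u i) / scale"
  have "?s \<in> {0..<mass (restr N i u)}" using i(2) unfolding piece_rescale .
  from Suc.IH[OF this] have IH: "sample n (restr N i u) ?s \<in> K"
    "norm (sample (Suc n) (restr N i u) ?s - sample n (restr N i u) ?s) \<le> (1 / 2) ^ n * D" by blast+
  show ?case
  proof
    show "sample (Suc n) u t \<in> K" unfolding sample_Suc[OF i] by (intro cmap_in_gasket i IH)
    show "norm (sample (Suc (Suc n)) u t - sample (Suc n) u t) \<le> (1 / 2) ^ Suc n * D"
      unfolding sample_Suc[OF i] cmap_diff using IH(2) by simp
  qed
qed

lemma sample_LIMSEQ: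
  assumes t: "t \<in> {0..<mass u}"
  shows "(\<lambda>n. sample n u t) \<longlonglongrightarrow> sample_point u t"
proof -
  obtain D where D: "\<And>x y. x \<in> K \<Longrightarrow> y \<in> K \<Longrightarrow> norm (x - y) \<le> D" using gasket_diameter by metis
  have "summable (\<lambda>n. sample (Suc n) u t - sample n u t)"
  proof (rule summable_comparison_test)
    show "\<exists>N. \<forall>n\<ge>N. norm (sample (Suc n) u t - sample n u t) \<le> (1 / 2) ^ n * D"
      using sample_props[OF D t] by blast
    show "summable (\<lambda>n. (1 / 2) ^ n * D)" by (intro summable_mult2 summable_geometric) simp
  qed
  hence "(\<lambda>n. \<Sum>i<n. sample (Suc i) u t - sample i u t) \<longlonglongrightarrow> (\<Sum>i. sample (Suc i) u t - sample i u t)"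
    by (rule summable_LIMSEQ)
  hence "(\<lambda>n. (sample n u t - sample 0 u t) + sample 0 u t) \<longlonglongrightarrow> (\<Sum>i. sample (Suc i) u t - sample i u t) + sample 0 u t"
    unfolding sum_lessThan_telescope[of "\<lambda>n. sample n u t"] by (intro tendsto_add tendsto_const)
  hence "convergent (\<lambda>n. sample n u t)" by (auto simp: convergent_def)
  thus ?thesis unfolding sample_point_def by (simp add: convergent_LIMSEQ_iff)
qed

lemma sample_point_in_gasket:
  assumes t: "t \<in> {0..<mass u}" shows "sample_point u t \<in> K"
proof -
  obtain D where D: "\<And>x y. x \<in> K \<Longrightarrow> y \<in> K \<Longrightarrow> norm (x - y) \<le> D" using gasket_diameter by metis
  have "\<forall>n. sample n u t \<in> K" using sample_props[OF D t] by blast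
  thus ?thesis using sample_LIMSEQ[OF t] closed_gasket closed_sequentially by metis
qed

lemma sample_point_piece:
  assumes i: "i \<in> S" "t \<in> piece u i"
  shows "sample_point u t = cmap p i (sample_point (restr N i u) ((t - offset u i) / scale))"
proof (rule LIMSEQ_unique)
  show "(\<lambda>n. sample (Suc n) u t) \<longlonglongrightarrow> sample_point u t"
    by (intro LIMSEQ_Suc sample_LIMSEQ piece_subset[OF i])
  show "(\<lambda>n. sample (Suc n) u t) \<longlonglongrightarrow> cmap p i (sample_point (restr N i u) ((t - offset u i) / scale))"
    unfolding sample_Suc[OF i]
    by (rule continuous_on_tendsto_compose[OF continuous_on_cmap[of UNIV]])
       (use i(2) in \<open>auto simp: piece_rescale intro!: sample_LIMSEQ\<close>)
qed

lemma measurable_sample: "sample n u \<in> borel_measurable borel"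
proof (induction n arbitrary: u)
  case (Suc n)
  note Suc.IH[measurable]
  have [measurable]: "cmap p i \<in> borel_measurable borel" for i
    by (intro borel_measurable_continuous_onI continuous_on_cmap)
  have [measurable]: "piece u i \<in> sets borel" for i by (simp add: piece_def)
  show ?case unfolding sample.simps by measurable
qed simp

lemma measurable_sample_point: "sample_point u \<in> borel_measurable borel"
  unfolding sample_point_def by (intro borel_measurable_lim_metric measurable_sample)

abbreviation "borel_K \<equiv> restrict_space borel K"

text \<open>
  This turns out to be the energy measure of the harmonic function with boundary values \<open>u\<close>.
\<close>

definition self_similar_measure :: "(nat \<Rightarrow> real) \<Rightarrow> (real ^ 'n) measure" where
  "self_similar_measure u = distr (restrict_space lborel {0..<mass u}) borel_K (sample_point u)"

lemma sets_self_similar [simp, measurable_cong]: "sets (self_similar_measure u) = sets borel_K"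
  by (simp add: self_similar_measure_def)

lemma space_borel_K [simp]: "space borel_K = K"
  by (simp add: space_restrict_space)

lemma space_self_similar [simp]: "space (self_similar_measure u) = K"
  by (simp add: self_similar_measure_def)

lemma measurable_sample_point':
  "sample_point u \<in> measurable (restrict_space lborel {0..<mass u}) borel_K"
  by (intro measurable_restrict_space2 measurable_restrict_space1)
     (auto simp: space_restrict_space measurable_sample_point sample_point_in_gasket)

lemma sets_borel_KI: "A \<in> sets borel \<Longrightarrow> A \<subseteq> K \<Longrightarrow> A \<in> sets borel_K"
  using closed_gasket by (auto simp: sets_restrict_space_iff borel_closed)

lemma measure_self_similar_total: "measure (self_similar_measure u) K = mass u"
  and finite_self_similar: "finite_measure (self_similar_measure u)"
proof -
  have "sample_point u -` K \<inter> {0..<mass u} = {0..<mass u}"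
    using sample_point_in_gasket by auto
  hence e: "emeasure (self_similar_measure u) K = ennreal (mass u)"
    unfolding self_similar_measure_def
    by (subst emeasure_distr[OF measurable_sample_point'])
       (auto simp: space_restrict_space emeasure_restrict_space mass_nonneg closed_gasket borel_closed intro!: sets_borel_KI)
  thus "measure (self_similar_measure u) K = mass u" by (simp add: measure_def mass_nonneg)
  show "finite_measure (self_similar_measure u)" by (rule finite_measureI) (simp add: e)
qed

lemma bounded_integrable:
  assumes "finite_measure M" "sets M = sets borel_K" "g \<in> borel_measurable borel_K"
    and "\<And>x. x \<in> K \<Longrightarrow> \<bar>g x\<bar> \<le> (B :: real)"
  shows "integrable M g"
proof -
  interpret finite_measure M by fact
  have "space M = K" using sets_eq_imp_space_eq[OF assms(2)] by simp
  moreover have "g \<in> borel_measurable M" using assms(3) measurable_cong_sets[OF assms(2) refl] by blast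
  ultimately show ?thesis using assms(4)
    by (intro integrable_const_bound[where B=B]) auto
qed

lemma integral_self_similar_measure:
  assumes g: "g \<in> borel_measurable borel_K"
  shows "(\<integral>x. g x \<partial>self_similar_measure u) = (\<integral>t. indicator {0..<mass u} t * g (sample_point u t) \<partial>lborel)"
    and "integrable (self_similar_measure u) g \<longleftrightarrow> integrable lborel (\<lambda>t. indicator {0..<mass u} t * (g (sample_point u t) :: real))"
  unfolding self_similar_measure_def
  by (simp_all add: integral_distr[OF measurable_sample_point' g] integral_restrict_space
     integrable_distr_eq[OF measurable_sample_point' g] integrable_restrict_space)

lemma measurable_compose_cmap:
  assumes "g \<in> borel_measurable borel_K" "i \<in> S"
  shows "(\<lambda>x. g (cmap p i x)) \<in> borel_measurable borel_K"
proof -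
  have "cmap p i \<in> measurable borel_K borel_K"
    by (intro measurable_restrict_space2 measurable_restrict_space1 borel_measurable_continuous_onI continuous_on_cmap)
       (use assms cmap_in_gasket in auto)
  from measurable_compose[OF this assms(1)] show ?thesis .
qed

text \<open>
  Reparametrising the subinterval of the \<open>i\<close>-th cell by the affine map onto the full parameter
  interval of \<open>restr N i u\<close> stretches lengths by \<open>scale\<close>.
\<close>

lemma integral_self_similar:
  assumes g: "g \<in> borel_measurable borel_K" and B: "\<And>x. x \<in> K \<Longrightarrow> \<bar>g x\<bar> \<le> (B :: real)"
  shows "(\<integral>x. g x \<partial>self_similar_measure u) =
     scale * (\<Sum>i\<in>S. \<integral>x. g (cmap p i x) \<partial>self_similar_measure (restr N i u))"
proof -
  define F where "F i x = indicator {0..<mass (restr N i u)} x * g (cmap p i (sample_point (restr N i u) x))" for i x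
  define G where "G i t = indicator (piece u i) t * g (cmap p i (sample_point (restr N i u) ((t - offset u i) / scale)))" for i t
  have GF: "G i (offset u i + scale * x) = F i x" for i x
  proof -
    have "(offset u i + scale * x - offset u i) / scale = x" by simp
    thus ?thesis unfolding G_def F_def indicator_def piece_rescale[of "offset u i + scale * x"] by simp
  qed
  have int: "integrable lborel (F i)" "integral\<^sup>L lborel (F i) = (\<integral>x. g (cmap p i x) \<partial>self_similar_measure (restr N i u))"
    if i: "i \<in> S" for i
  proof -
    have "integrable (self_similar_measure (restr N i u)) (\<lambda>x. g (cmap p i x))"
      by (rule bounded_integrable[OF finite_self_similar sets_self_similar measurable_compose_cmap[OF g i]])
         (use i B cmap_in_gasket in blast)
    thus "integrable lborel (F i)"
      unfolding F_def integral_self_similar_measure(2)[OF measurable_compose_cmap[OF g i]] .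
    show "integral\<^sup>L lborel (F i) = (\<integral>x. g (cmap p i x) \<partial>self_similar_measure (restr N i u))"
      unfolding F_def integral_self_similar_measure(1)[OF measurable_compose_cmap[OF g i]] ..
  qed
  have intG: "integrable lborel (G i)" if "i \<in> S" for i
    using int(1)[OF that] lborel_integrable_real_affine_iff[of scale "G i" "offset u i"]
    unfolding GF by simp
  have "indicator {0..<mass u} t * g (sample_point u t) = (\<Sum>i\<in>S. G i t)" for t
  proof -
    have "indicator {0..<mass u} t * g (sample_point u t) = (\<Sum>i\<in>S. indicator (piece u i) t * g (sample_point u t))"
      unfolding sum_indicator_piece[symmetric] sum_distrib_right ..
    also have "\<dots> = (\<Sum>i\<in>S. G i t)"
      unfolding G_def by (intro sum.cong refl) (auto simp: indicator_def sample_point_piece)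
    finally show ?thesis .
  qed
  hence "(\<integral>x. g x \<partial>self_similar_measure u) = (\<integral>t. (\<Sum>i\<in>S. G i t) \<partial>lborel)"
    unfolding integral_self_similar_measure(1)[OF g] by simp
  also have "\<dots> = (\<Sum>i\<in>S. integral\<^sup>L lborel (G i))"
    by (rule Bochner_Integration.integral_sum) (rule intG)
  also have "\<dots> = (\<Sum>i\<in>S. scale * integral\<^sup>L lborel (F i))"
  proof (intro sum.cong refl)
    fix i
    show "integral\<^sup>L lborel (G i) = scale * integral\<^sup>L lborel (F i)"
      using lborel_integral_real_affine[of scale "G i" "offset u i"] unfolding GF by simp
  qed
  also have "\<dots> = scale * (\<Sum>i\<in>S. \<integral>x. g (cmap p i x) \<partial>self_similar_measure (restr N i u))"
    by (simp add: int sum_distrib_left)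
  finally show ?thesis .
qed

lemma measure_self_similar:
  assumes A: "A \<in> sets borel_K"
  shows "measure (self_similar_measure u) A =
     scale * (\<Sum>i\<in>S. measure (self_similar_measure (restr N i u)) (cmap p i -` A \<inter> K))"
proof -
  have AK: "A \<subseteq> K" using sets.sets_into_space[OF A] by simp
  have ind: "indicator A \<in> borel_measurable borel_K" using A by simp
  have int: "(\<integral>x. indicator A x \<partial>self_similar_measure u) = measure (self_similar_measure u) A"
    if "A \<subseteq> K" for A u using that by (simp add: Int_absorb2)
  have *: "(\<integral>x. indicator A (cmap p i x) \<partial>self_similar_measure (restr N i u)) =
     measure (self_similar_measure (restr N i u)) (cmap p i -` A \<inter> K)" for i
  proof -
    have "(\<integral>x. indicator A (cmap p i x) \<partial>self_similar_measure (restr N i u))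
      = (\<integral>x. indicator (cmap p i -` A \<inter> K) x \<partial>self_similar_measure (restr N i u))"
      by (intro Bochner_Integration.integral_cong refl) (auto simp: indicator_def)
    also have "\<dots> = measure (self_similar_measure (restr N i u)) (cmap p i -` A \<inter> K)"
      by (rule int) simp
    finally show ?thesis .
  qed
  have "measure (self_similar_measure u) A = (\<integral>x. indicator A x \<partial>self_similar_measure u)"
    using int[OF AK] by simp
  also have "\<dots> = scale * (\<Sum>i\<in>S. \<integral>x. indicator A (cmap p i x) \<partial>self_similar_measure (restr N i u))"
    by (rule integral_self_similar[OF ind, of 1]) (auto simp: indicator_def)
  finally show ?thesis unfolding * .
qed

lemma closed_in_borel_K: "closed A \<Longrightarrow> A \<subseteq> K \<Longrightarrow> A \<in> sets borel_K"
  by (intro sets_borel_KI borel_closed)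

text \<open>
  Energies are quadratic in the oscillation, which gains a factor \<open>1 / scale\<close> per letter; this
  outweighs the normalisation \<open>scale ^ length w\<close>.
\<close>

lemma mass_restrs_le:
  assumes "set w \<subseteq> S"
    and c: "\<And>j k. j \<in> S \<Longrightarrow> k \<in> S \<Longrightarrow> \<bar>u j - u k\<bar> \<le> c"
  shows "scale ^ length w * mass (restrs N w u) \<le> (1 / scale) ^ length w * (2 * (real N + 1)\<^sup>2 * c\<^sup>2)"
proof -
  have "boundary_energy N (restrs N w u) \<le> (real N + 1)\<^sup>2 * (((real N + 1) / (real N + 3)) ^ length w * c)\<^sup>2"
    by (intro boundary_energy_le restrs_osc assms)
  hence "scale ^ length w * mass (restrs N w u) \<le>
     scale ^ length w * (2 * (real N + 1)\<^sup>2 * (((real N + 1) / (real N + 3)) ^ length w * c)\<^sup>2)"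
    unfolding mass_def by (intro mult_left_mono) auto
  also have "((real N + 1) / (real N + 3)) = 1 / scale" by simp
  also have "scale ^ length w * (2 * (real N + 1)\<^sup>2 * ((1 / scale) ^ length w * c)\<^sup>2)
     = (scale * (1 / scale)) ^ length w * (1 / scale) ^ length w * (2 * (real N + 1)\<^sup>2 * c\<^sup>2)"
    unfolding power_mult_distrib power2_eq_square by (simp only: mult_ac)
  also have "scale * (1 / scale) = 1" by simp
  finally show ?thesis by simp
qed

text \<open>
  A vertex of the simplex carries no mass: it lies in a single cell of each level, and the masses of these cells
  tend to zero.
\<close>

lemma measure_vertex:
  assumes i: "i \<in> S" shows "measure (self_similar_measure u) {p i} = 0"
proof -
  obtain c where c: "\<And>j k. j \<in> S \<Longrightarrow> k \<in> S \<Longrightarrow> \<bar>u j - u k\<bar> \<le> c" using osc_bound by metis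
  have step: "measure (self_similar_measure u) {p i} = scale * measure (self_similar_measure (restr N i u)) {p i}" for u
  proof -
    have pre: "cmap p j -` {p i} \<inter> K = (if j = i then {p i} else {})" if "j \<in> S" for j
      using vertex_eq_cmapD[OF that i] vertex_in_gasket[OF i] by (auto dest: sym)
    have "measure (self_similar_measure u) {p i} =
      scale * (\<Sum>j\<in>S. measure (self_similar_measure (restr N j u)) (cmap p j -` {p i} \<inter> K))"
      by (intro measure_self_similar closed_in_borel_K) (use vertex_in_gasket[OF i] in auto)
    also have "(\<Sum>j\<in>S. measure (self_similar_measure (restr N j u)) (cmap p j -` {p i} \<inter> K))
      = (\<Sum>j\<in>S. if j = i then measure (self_similar_measure (restr N i u)) {p i} else 0)"
      by (intro sum.cong refl) (simp add: pre)
    finally show ?thesis using i by simp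
  qed
  have iter: "measure (self_similar_measure u) {p i} = scale ^ n * measure (self_similar_measure (restrs N (replicate n i) u)) {p i}" for n u
  proof (induction n arbitrary: u)
    case (Suc n)
    show ?case using step[of u] Suc[of "restr N i u"] by simp
  qed simp
  have "measure (self_similar_measure u) {p i} \<le> (1 / scale) ^ n * (2 * (real N + 1)\<^sup>2 * c\<^sup>2)" for n
  proof -
    interpret finite_measure "self_similar_measure (restrs N (replicate n i) u)" by (rule finite_self_similar)
    have "measure (self_similar_measure (restrs N (replicate n i) u)) {p i} \<le> mass (restrs N (replicate n i) u)"
      using bounded_measure[of "{p i}"] by (simp add: measure_self_similar_total)
    hence "measure (self_similar_measure u) {p i} \<le> scale ^ n * mass (restrs N (replicate n i) u)"
      unfolding iter[of u n] by (intro mult_left_mono) auto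
    also have "\<dots> \<le> (1 / scale) ^ n * (2 * (real N + 1)\<^sup>2 * c\<^sup>2)"
    proof -
      have "set (replicate n i) \<subseteq> S" using i by auto
      from mass_restrs_le[OF this c] show ?thesis unfolding length_replicate .
    qed
    finally show ?thesis .
  qed
  moreover have "(\<lambda>n. (1 / scale) ^ n * (2 * (real N + 1)\<^sup>2 * c\<^sup>2)) \<longlonglongrightarrow> 0 * (2 * (real N + 1)\<^sup>2 * c\<^sup>2)"
    by (intro tendsto_mult tendsto_const LIMSEQ_power_zero) simp
  ultimately have "measure (self_similar_measure u) {p i} \<le> 0 * (2 * (real N + 1)\<^sup>2 * c\<^sup>2)"
    by (intro LIMSEQ_le_const[where X="\<lambda>n. (1 / scale) ^ n * (2 * (real N + 1)\<^sup>2 * c\<^sup>2)"]) auto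
  thus ?thesis by (simp add: antisym)
qed

text \<open>
  Pulled back to another first-level cell, the cell reduces to a vertex of the simplex at most, and
  such a vertex is a null set.
\<close>

lemma measure_cell:
  assumes "set w \<subseteq> S"
  shows "measure (self_similar_measure u) (cell N p w) = scale ^ length w * mass (restrs N w u)"
  using assms
proof (induction w arbitrary: u)
  case Nil
  show ?case by (simp add: cell_def measure_self_similar_total)
next
  case (Cons i w)
  have i: "i \<in> S" and w: "set w \<subseteq> S" using Cons.prems by auto
  have c: "cell N p (i # w) = cmap p i ` cell N p w" by (auto simp: cell_def)
  have "measure (self_similar_measure (restr N j u)) (cmap p j -` cell N p (i # w) \<inter> K) =
     (if j = i then measure (self_similar_measure (restr N i u)) (cell N p w) else 0)" if j: "j \<in> S" for j
  proof (cases "j = i")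
    case True
    have "cmap p i -` cell N p (i # w) \<inter> K = cell N p w"
      unfolding c using cell_subset[OF w] by auto
    thus ?thesis using True by simp
  next
    case False
    interpret finite_measure "self_similar_measure (restr N j u)" by (rule finite_self_similar)
    have "cmap p j -` cell N p (i # w) \<inter> K \<subseteq> {p i}"
      unfolding c using cmap_eq_cmapD(1)[OF j i False] cell_subset[OF w] by auto
    hence "measure (self_similar_measure (restr N j u)) (cmap p j -` cell N p (i # w) \<inter> K)
       \<le> measure (self_similar_measure (restr N j u)) {p i}"
      by (rule finite_measure_mono) (auto intro!: closed_in_borel_K vertex_in_gasket[OF i])
    hence "measure (self_similar_measure (restr N j u)) (cmap p j -` cell N p (i # w) \<inter> K) = 0"
      unfolding measure_vertex[OF i] by (simp add: antisym)
    thus ?thesis using False by simp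
  qed
  hence "(\<Sum>j\<in>S. measure (self_similar_measure (restr N j u)) (cmap p j -` cell N p (i # w) \<inter> K))
     = (\<Sum>j\<in>S. if j = i then measure (self_similar_measure (restr N i u)) (cell N p w) else 0)"
    by (intro sum.cong refl)
  also have "\<dots> = measure (self_similar_measure (restr N i u)) (cell N p w)" using i by simp
  finally have "measure (self_similar_measure u) (cell N p (i # w)) =
     scale * measure (self_similar_measure (restr N i u)) (cell N p w)"
    by (subst measure_self_similar) (auto intro!: closed_in_borel_K closed_cell cell_subset Cons.prems)
  thus ?case unfolding Cons.IH[OF w] by simp
qed


section \<open>Identification of the energy and Kusuoka measures\<close>

lemma level_measure_form_cong:
  assumes "\<And>w i. w \<in> words_len N m \<Longrightarrow> i \<in> S \<Longrightarrow> f (psi p w (p i)) = f' (psi p w (p i))"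
  shows "level_measure_form N p m f g = level_measure_form N p m f' g"
  unfolding level_measure_form_def
  by (intro arg_cong2[where f="(*)"] refl sum.cong) (simp_all add: assms)

lemma small_oscillation:
  assumes g: "continuous_on K (g :: _ \<Rightarrow> real)" and "\<epsilon> > 0"
  shows "\<exists>m. \<forall>n\<ge>m. \<forall>w\<in>words_len N n. \<forall>x\<in>K. \<forall>y\<in>K. \<bar>g (psi p w x) - g (psi p w y)\<bar> \<le> \<epsilon>"
proof -
  have "uniformly_continuous_on K g" by (rule compact_uniformly_continuous[OF g compact_gasket])
  then obtain d where d: "d > 0" "\<And>x y. x \<in> K \<Longrightarrow> y \<in> K \<Longrightarrow> dist y x < d \<Longrightarrow> dist (g y) (g x) < \<epsilon>"
    using \<open>\<epsilon> > 0\<close> unfolding uniformly_continuous_on_def by metis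
  obtain D where D: "\<And>x y. x \<in> K \<Longrightarrow> y \<in> K \<Longrightarrow> norm (x - y) \<le> D" using gasket_diameter by metis
  have "eventually (\<lambda>n. (1 / 2) ^ n * D < d) sequentially"
    using d(1) half_power_LIMSEQ by (intro order_tendstoD) auto
  then obtain m where m: "\<And>n. n \<ge> m \<Longrightarrow> (1 / 2) ^ n * D < d" by (auto simp: eventually_sequentially)
  show ?thesis
  proof (intro exI[of _ m] allI impI ballI)
    fix n w x y assume n: "n \<ge> m" and w: "w \<in> words_len N n" and x: "x \<in> K" and y: "y \<in> K"
    have w': "set w \<subseteq> S" "length w = n" using w by (auto simp: words_len_iff)
    have "dist (psi p w x) (psi p w y) = (1 / 2) ^ n * norm (x - y)"
      by (simp add: dist_norm psi_diff w')
    also have "\<dots> \<le> (1 / 2) ^ n * D" using D[OF x y] by (intro mult_left_mono) auto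
    also have "\<dots> < d" using m[OF n] .
    finally have "dist (g (psi p w x)) (g (psi p w y)) < \<epsilon>"
      by (intro d(2) psi_in_gasket w' x y)
    thus "\<bar>g (psi p w x) - g (psi p w y)\<bar> \<le> \<epsilon>" by (simp add: dist_real_def)
  qed
qed

lemma continuous_measurable_K: "continuous_on K g \<Longrightarrow> (g :: _ \<Rightarrow> real) \<in> borel_measurable borel_K"
  by (rule borel_measurable_continuous_on_restrict)

lemma continuous_integrable:
  assumes "finite_measure M" "sets M = sets borel_K" "continuous_on K (g :: _ \<Rightarrow> real)"
  shows "integrable M g"
proof -
  obtain B where "\<And>x. x \<in> K \<Longrightarrow> \<bar>g x\<bar> \<le> B" using energy_domain_bounded[OF assms(3)] by metis
  thus ?thesis by (rule bounded_integrable[OF assms(1,2) continuous_measurable_K[OF assms(3)]])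
qed

lemma integral_close:
  assumes M: "finite_measure M" "sets M = sets borel_K"
    and "continuous_on K f" "continuous_on K g"
    and "\<And>x. x \<in> K \<Longrightarrow> \<bar>f x - g x\<bar> \<le> (\<epsilon> :: real)"
  shows "\<bar>integral\<^sup>L M f - integral\<^sup>L M g\<bar> \<le> \<epsilon> * measure M K"
proof -
  interpret finite_measure M by fact
  have sp: "space M = K" using sets_eq_imp_space_eq[OF M(2)] by simp
  have f: "integrable M f" and g: "integrable M g" using continuous_integrable[OF M] assms by auto
  have "\<bar>integral\<^sup>L M f - integral\<^sup>L M g\<bar> = \<bar>\<integral>x. f x - g x \<partial>M\<bar>" using f g by simp
  also have "\<dots> \<le> (\<integral>x. \<bar>f x - g x\<bar> \<partial>M)" by (rule integral_abs_bound)
  also have "\<dots> \<le> (\<integral>x. \<epsilon> \<partial>M)"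
    using f g assms(5) sp by (intro integral_mono) auto
  also have "\<dots> = \<epsilon> * measure M K" by (simp add: sp)
  finally show ?thesis .
qed

text \<open>
  Both quantities satisfy the same self-similar recursion. On the whole gasket each of them differs
  from \<open>mass u\<close> times a value of \<open>g\<close> by at most \<open>\<epsilon> * mass u\<close>.
\<close>

lemma integral_approximation:
  assumes "continuous_on K g"
    and "\<And>w x y. w \<in> words_len N m \<Longrightarrow> x \<in> K \<Longrightarrow> y \<in> K \<Longrightarrow> \<bar>g (psi p w x) - g (psi p w y)\<bar> \<le> \<epsilon>"
  shows "\<bar>integral\<^sup>L (self_similar_measure u) g - level_measure_form N p m (harmonic_extension u) g\<bar> \<le> 2 * \<epsilon> * mass u"
  using assms
proof (induction m arbitrary: g u)
  case 0
  define a where "a = g (p (Suc 0))"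
  have V: "p i \<in> K" if "i \<in> S" for i using that by (rule vertex_in_gasket)
  have osc: "\<bar>g x - a\<bar> \<le> \<epsilon>" if "x \<in> K" for x
    unfolding a_def using 0(2)[of "[]" x "p (Suc 0)"] that V[OF one_in_letters] by simp
  interpret finite_measure "self_similar_measure u" by (rule finite_self_similar)
  have "\<bar>integral\<^sup>L (self_similar_measure u) g - (\<integral>x. a \<partial>self_similar_measure u)\<bar> \<le> \<epsilon> * mass u"
    unfolding measure_self_similar_total[symmetric]
    by (intro integral_close finite_self_similar sets_self_similar 0(1) continuous_on_const osc)
  hence 1: "\<bar>integral\<^sup>L (self_similar_measure u) g - mass u * a\<bar> \<le> \<epsilon> * mass u"
    by (simp add: measure_self_similar_total)
  define c where "c i j = (u i - u j)\<^sup>2" for i j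
  have lev: "level_measure_form N p 0 (harmonic_extension u) g = 1 / 2 * (\<Sum>i\<in>S. \<Sum>j\<in>S. c i j * (g (p i) + g (p j)))"
    unfolding level_measure_form_def c_def
    by (simp add: harmonic_extension_vertex cong: sum.cong)
  have mass: "mass u = (\<Sum>i\<in>S. \<Sum>j\<in>S. c i j)" by (simp add: mass_def boundary_energy_def c_def)
  have "(\<Sum>i\<in>S. \<Sum>j\<in>S. c i j * (g (p i) + g (p j))) - 2 * (mass u * a)
     = (\<Sum>i\<in>S. \<Sum>j\<in>S. c i j * ((g (p i) - a) + (g (p j) - a)))"
    unfolding mass sum_distrib_left sum_distrib_right sum_subtractf[symmetric]
    by (intro sum.cong refl) (simp add: algebra_simps)
  also have "\<bar>\<dots>\<bar> \<le> (\<Sum>i\<in>S. \<Sum>j\<in>S. c i j * (2 * \<epsilon>))"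
  proof (intro order_trans[OF sum_abs] sum_mono)
    fix i j assume "i \<in> S" "j \<in> S"
    hence "\<bar>(g (p i) - a) + (g (p j) - a)\<bar> \<le> 2 * \<epsilon>"
      using osc[OF V, of i] osc[OF V, of j] by linarith
    thus "\<bar>c i j * ((g (p i) - a) + (g (p j) - a))\<bar> \<le> c i j * (2 * \<epsilon>)"
      unfolding abs_mult c_def by (simp add: mult_left_mono)
  qed
  also have "\<dots> = 2 * (\<epsilon> * mass u)" unfolding mass sum_distrib_left by (simp add: mult_ac)
  finally show ?case unfolding lev using 1 by linarith
next
  case (Suc m)
  have c: "continuous_on K (g \<circ> cmap p i)" if "i \<in> S" for i
    by (rule continuous_on_compose[OF continuous_on_cmap])
       (rule continuous_on_subset[OF Suc.prems(1)], use that cmap_in_gasket in blast)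
  have IH: "\<bar>integral\<^sup>L (self_similar_measure (restr N i u)) (g \<circ> cmap p i)
      - level_measure_form N p m (harmonic_extension (restr N i u)) (g \<circ> cmap p i)\<bar> \<le> 2 * \<epsilon> * mass (restr N i u)"
    if i: "i \<in> S" for i
  proof (rule Suc.IH[OF c[OF i]])
    fix w x y assume "w \<in> words_len N m" "x \<in> K" "y \<in> K"
    thus "\<bar>(g \<circ> cmap p i) (psi p w x) - (g \<circ> cmap p i) (psi p w y)\<bar> \<le> \<epsilon>"
      using Suc.prems(2)[of "i # w" x y] i by (simp add: words_len_iff)
  qed
  obtain B where B: "\<And>x. x \<in> K \<Longrightarrow> \<bar>g x\<bar> \<le> B" using energy_domain_bounded[OF Suc.prems(1)] by metis
  have e1: "integral\<^sup>L (self_similar_measure u) g = scale * (\<Sum>i\<in>S. integral\<^sup>L (self_similar_measure (restr N i u)) (g \<circ> cmap p i))"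
    using integral_self_similar[OF continuous_measurable_K[OF Suc.prems(1)] B] by (simp add: o_def)
  have "level_measure_form N p m (harmonic_extension u \<circ> cmap p i) g' = level_measure_form N p m (harmonic_extension (restr N i u)) g'"
    if "i \<in> S" for i g'
    by (rule level_measure_form_cong) (simp add: harmonic_extension_cmap that word_vertex_in_gasket)
  hence e2: "level_measure_form N p (Suc m) (harmonic_extension u) g =
     scale * (\<Sum>i\<in>S. level_measure_form N p m (harmonic_extension (restr N i u)) (g \<circ> cmap p i))"
    unfolding level_measure_form_Suc by simp
  have "\<bar>integral\<^sup>L (self_similar_measure u) g - level_measure_form N p (Suc m) (harmonic_extension u) g\<bar>
    = scale * \<bar>\<Sum>i\<in>S. integral\<^sup>L (self_similar_measure (restr N i u)) (g \<circ> cmap p i)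
       - level_measure_form N p m (harmonic_extension (restr N i u)) (g \<circ> cmap p i)\<bar>"
    unfolding e1 e2 sum_subtractf right_diff_distrib[symmetric] abs_mult by simp
  also have "\<dots> \<le> scale * (\<Sum>i\<in>S. 2 * \<epsilon> * mass (restr N i u))"
    by (intro mult_left_mono order_trans[OF sum_abs] sum_mono IH) auto
  also have "\<dots> = 2 * \<epsilon> * mass u"
    unfolding sum_mass_restr[of u, symmetric] sum_distrib_left by (simp only: mult_ac)
  finally show ?case .
qed

lemma level_measure_form_tendsto_integral:
  assumes g: "continuous_on K g"
  shows "(\<lambda>m. level_measure_form N p m (harmonic_extension u) g) \<longlonglongrightarrow> integral\<^sup>L (self_similar_measure u) g"
proof (rule LIMSEQ_I)
  fix e :: real assume "e > 0"
  \<comment> \<open>The summand \<open>1\<close> covers constant boundary values, which have mass \<open>0\<close>.\<close>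
  define \<epsilon> where "\<epsilon> = e / (2 * mass u + 1)"
  have \<epsilon>: "\<epsilon> > 0" using \<open>e > 0\<close> mass_nonneg[of u] unfolding \<epsilon>_def by (intro divide_pos_pos) auto
  have lt: "2 * \<epsilon> * mass u < e"
  proof -
    have "2 * \<epsilon> * mass u < \<epsilon> * (2 * mass u + 1)" using \<epsilon> by (simp add: algebra_simps)
    also have "\<dots> = e" using mass_nonneg[of u] by (simp add: \<epsilon>_def)
    finally show ?thesis .
  qed
  obtain m where m: "\<forall>n\<ge>m. \<forall>w\<in>words_len N n. \<forall>x\<in>K. \<forall>y\<in>K. \<bar>g (psi p w x) - g (psi p w y)\<bar> \<le> \<epsilon>"
    using small_oscillation[OF g \<epsilon>] by blast
  have "norm (level_measure_form N p n (harmonic_extension u) g - integral\<^sup>L (self_similar_measure u) g) < e" if "n \<ge> m" for n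
    using integral_approximation[OF g, of n \<epsilon> u] m that lt by (auto simp: abs_minus_commute)
  thus "\<exists>m. \<forall>n\<ge>m. norm (level_measure_form N p n (harmonic_extension u) g - integral\<^sup>L (self_similar_measure u) g) < e"
    by blast
qed

lemma has_bochner_integral_self_similar:
  assumes h: "h \<in> harmonic N p" and g: "g \<in> energy_domain N p"
  shows "has_bochner_integral (self_similar_measure (\<lambda>i. h (p i))) g
     (2 * energy_form N p h (\<lambda>x. h x * g x) - energy_form N p (\<lambda>x. (h x)\<^sup>2) g)"
proof -
  let ?u = "\<lambda>i. h (p i)"
  have hd: "h \<in> energy_domain N p" using h by (simp add: harmonic_def)
  have "level_measure_form N p m (harmonic_extension ?u) g = level_measure_form N p m h g" for m
  proof (rule level_measure_form_cong)
    fix w i assume w: "w \<in> words_len N m" and i: "i \<in> S"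
    have ws: "set w \<subseteq> S" using w by (simp add: words_len_iff)
    have "restrs N w (\<lambda>i. harmonic_extension ?u (p i)) i = restrs N w ?u i"
      by (rule restrs_cong[OF ws _ i]) (rule harmonic_extension_vertex)
    thus "harmonic_extension ?u (psi p w (p i)) = h (psi p w (p i))"
      unfolding harmonic_values[OF harmonic_extension_harmonic ws i] harmonic_values[OF h ws i] .
  qed
  hence "(\<lambda>m. level_measure_form N p m h g) \<longlonglongrightarrow> integral\<^sup>L (self_similar_measure ?u) g"
    using level_measure_form_tendsto_integral[OF energy_domain_continuous[OF g], of ?u] by simp
  with level_measure_form_LIMSEQ[OF hd g]
  have "integral\<^sup>L (self_similar_measure ?u) g = 2 * energy_form N p h (\<lambda>x. h x * g x) - energy_form N p (\<lambda>x. (h x)\<^sup>2) g"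
    by (rule LIMSEQ_unique[symmetric])
  moreover have "integrable (self_similar_measure ?u) g"
    by (rule continuous_integrable[OF finite_self_similar sets_self_similar energy_domain_continuous[OF g]])
  ultimately show ?thesis by (simp add: has_bochner_integral_iff)
qed

text \<open>
  Interpolating a continuous function harmonically on the cells of a fine level gives a uniform
  approximation of finite energy; hence the defining identity determines the energy measure.
\<close>

lemma energy_domain_glue:
  assumes F: "compatible F" "\<And>i. i \<in> S \<Longrightarrow> F i \<in> energy_domain N p"
  shows "glue F \<in> energy_domain N p"
proof (rule energy_domainI)
  show "continuous_on K (glue F)"
    by (intro continuous_on_glue F energy_domain_continuous)
  fix m
  have "level_energy N p m (glue F) \<le> level_energy N p (Suc m) (glue F)" by (rule level_energy_mono_Suc)
  also have "\<dots> = scale * (\<Sum>i\<in>S. level_energy N p m (F i))"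
    unfolding level_energy_Suc
    by (intro arg_cong2[where f="(*)"] refl sum.cong level_energy_cong) (simp add: glue_cmap[OF F(1)])
  also have "\<dots> \<le> scale * (\<Sum>i\<in>S. enn2real (energy N p (F i)))"
    by (intro mult_left_mono sum_mono energy_domain_level_le F) auto
  finally show "level_energy N p m (glue F) \<le> scale * (\<Sum>i\<in>S. enn2real (energy N p (F i)))" .
qed

lemma energy_domain_approximation:
  assumes "continuous_on K g"
    and "\<And>w x y. w \<in> words_len N m \<Longrightarrow> x \<in> K \<Longrightarrow> y \<in> K \<Longrightarrow> \<bar>g (psi p w x) - g (psi p w y)\<bar> \<le> \<epsilon>"
  shows "\<exists>f\<in>energy_domain N p. (\<forall>i\<in>S. f (p i) = g (p i)) \<and> (\<forall>x\<in>K. \<bar>f x - g x\<bar> \<le> \<epsilon>)"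
  using assms
proof (induction m arbitrary: g)
  case 0
  let ?f = "harmonic_extension (\<lambda>i. g (p i))"
  have "\<bar>?f x - g x\<bar> \<le> \<epsilon>" if x: "x \<in> K" for x
  proof -
    have "g x - \<epsilon> \<le> g (p i)" "g (p i) \<le> g x + \<epsilon>" if "i \<in> S" for i
      using 0(2)[of "[]" x "p i"] x vertex_in_gasket[OF that] by (simp_all add: abs_le_iff algebra_simps)
    from harmonic_extension_bounds[OF this x] show ?thesis by (simp add: abs_le_iff algebra_simps)
  qed
  thus ?case by (intro bexI[of _ ?f]) (simp_all add: harmonic_extension_vertex harmonic_extension_domain)
next
  case (Suc m)
  have "\<exists>f. f \<in> energy_domain N p \<and> (\<forall>j\<in>S. f (p j) = g (cmap p i (p j))) \<and> (\<forall>x\<in>K. \<bar>f x - g (cmap p i x)\<bar> \<le> \<epsilon>)"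
    if i: "i \<in> S" for i
  proof -
    have "continuous_on K (g \<circ> cmap p i)"
      by (rule continuous_on_compose[OF continuous_on_cmap])
         (rule continuous_on_subset[OF Suc.prems(1)], use i cmap_in_gasket in blast)
    from Suc.IH[OF this] show ?thesis
      using Suc.prems(2)[of "i # _"] i by (fastforce simp: words_len_iff)
  qed
  then obtain F where F: "\<And>i. i \<in> S \<Longrightarrow> F i \<in> energy_domain N p"
    "\<And>i j. i \<in> S \<Longrightarrow> j \<in> S \<Longrightarrow> F i (p j) = g (cmap p i (p j))"
    "\<And>i x. i \<in> S \<Longrightarrow> x \<in> K \<Longrightarrow> \<bar>F i x - g (cmap p i x)\<bar> \<le> \<epsilon>"
    by metis
  have comp: "compatible F" unfolding compatible_def by (simp add: F(2) cmap_vertex_sym)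
  show ?case
  proof (intro bexI[of _ "glue F"] conjI ballI)
    fix i assume i: "i \<in> S"
    have "glue F (cmap p i (p i)) = F i (p i)" by (rule glue_cmap[OF comp i vertex_in_gasket[OF i]])
    thus "glue F (p i) = g (p i)" using F(2)[OF i i] by simp
  next
    fix x assume "x \<in> K"
    then obtain i y where iy: "i \<in> S" "y \<in> K" "x = cmap p i y" by (rule gasket_cases)
    show "\<bar>glue F x - g x\<bar> \<le> \<epsilon>" unfolding iy(3) glue_cmap[OF comp iy(1,2)] by (rule F(3)[OF iy(1,2)])
  qed (rule energy_domain_glue[OF comp F(1)])
qed

lemma energy_domain_dense:
  assumes g: "continuous_on K g" and "\<epsilon> > 0"
  shows "\<exists>f\<in>energy_domain N p. \<forall>x\<in>K. \<bar>f x - g x\<bar> \<le> \<epsilon>"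
proof -
  obtain m where m: "\<forall>n\<ge>m. \<forall>w\<in>words_len N n. \<forall>x\<in>K. \<forall>y\<in>K. \<bar>g (psi p w x) - g (psi p w y)\<bar> \<le> \<epsilon>"
    using small_oscillation[OF assms] by blast
  show ?thesis using energy_domain_approximation[OF g, of m \<epsilon>] m by blast
qed

lemma integrals_eq_imp_measure_closed_eq:
  assumes M: "finite_measure M" "sets M = sets borel_K" and M': "finite_measure M'" "sets M' = sets borel_K"
    and eq: "\<And>g :: _ \<Rightarrow> real. continuous_on K g \<Longrightarrow> integral\<^sup>L M g = integral\<^sup>L M' g"
    and C: "closed C" "C \<subseteq> K"
  shows "measure M C = measure M' C"
proof (cases "C = {}")
  case False
  \<comment> \<open>Continuous functions decreasing to the indicator function of \<open>C\<close>.\<close>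
  define \<phi> where "\<phi> n x = max 0 (1 - real n * infdist x C)" for n x
  have cont: "continuous_on K (\<phi> n)" for n unfolding \<phi>_def by (intro continuous_intros)
  have lim: "(\<lambda>n. \<phi> n x) \<longlonglongrightarrow> indicator C x" for x
  proof (cases "x \<in> C")
    case True thus ?thesis by (simp add: \<phi>_def)
  next
    case x: False
    hence pos: "infdist x C > 0" using C(1) False by (simp add: infdist_pos_not_in_closed)
    obtain m where m: "1 < real m * infdist x C" using reals_Archimedean3[OF pos] by blast
    have "\<phi> n x = 0" if "n \<ge> m" for n
    proof -
      have "real m * infdist x C \<le> real n * infdist x C" using that pos by (intro mult_right_mono) auto
      thus ?thesis using m by (simp add: \<phi>_def)
    qed
    hence "eventually (\<lambda>n. \<phi> n x = 0) sequentially" by (auto simp: eventually_sequentially)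
    thus ?thesis using x by (simp add: tendsto_eventually)
  qed
  have conv: "(\<lambda>n. integral\<^sup>L M (\<phi> n)) \<longlonglongrightarrow> measure M C"
    if M: "finite_measure M" "sets M = sets borel_K" for M
  proof -
    interpret finite_measure M by fact
    have sp: "space M = K" using sets_eq_imp_space_eq[OF M(2)] by simp
    have Cm: "C \<in> sets M" using C closed_in_borel_K M(2) by simp
    have "(\<lambda>n. integral\<^sup>L M (\<phi> n)) \<longlonglongrightarrow> integral\<^sup>L M (indicator C)"
    proof (rule integral_dominated_convergence[where w="\<lambda>_. 1"])
      show "\<phi> n \<in> borel_measurable M" for n
        using continuous_integrable[OF M cont] by (rule borel_measurable_integrable)
      show "AE x in M. norm (\<phi> n x) \<le> 1" for n by (simp add: \<phi>_def infdist_nonneg)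
    qed (use Cm lim in simp_all)
    thus ?thesis using C(2) sp by (simp add: Int_absorb2)
  qed
  show ?thesis
    using conv[OF M] conv[OF M'] unfolding eq[OF cont] by (rule LIMSEQ_unique)
qed simp

text \<open>
  By density the integrals of all continuous functions agree, hence so do the measures of closed sets,
  which generate the Borel sets and are stable under intersection.
\<close>

lemma measure_eqI_energy_domain:
  assumes M: "finite_measure M" "sets M = sets borel_K" and M': "finite_measure M'" "sets M' = sets borel_K"
    and eq: "\<And>g. g \<in> energy_domain N p \<Longrightarrow> integral\<^sup>L M g = integral\<^sup>L M' g"
  shows "M = M'"
proof -
  have eqc: "integral\<^sup>L M g = integral\<^sup>L M' g" if g: "continuous_on K (g :: _ \<Rightarrow> real)" for g
  proof (rule ccontr)
    assume ne: "integral\<^sup>L M g \<noteq> integral\<^sup>L M' g"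
    define T where "T = measure M K + measure M' K + 1"
    have T: "T > 0" by (simp add: T_def add_nonneg_pos)
    define \<epsilon> where "\<epsilon> = \<bar>integral\<^sup>L M g - integral\<^sup>L M' g\<bar> / T"
    have \<epsilon>: "\<epsilon> > 0" using ne T by (simp add: \<epsilon>_def)
    obtain f where f: "f \<in> energy_domain N p" "\<And>x. x \<in> K \<Longrightarrow> \<bar>f x - g x\<bar> \<le> \<epsilon>"
      using energy_domain_dense[OF g \<epsilon>] by blast
    have "\<bar>integral\<^sup>L M f - integral\<^sup>L M g\<bar> \<le> \<epsilon> * measure M K"
      by (intro integral_close M energy_domain_continuous f g)
    moreover have "\<bar>integral\<^sup>L M' f - integral\<^sup>L M' g\<bar> \<le> \<epsilon> * measure M' K"
      by (intro integral_close M' energy_domain_continuous f g)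
    ultimately have "\<bar>integral\<^sup>L M g - integral\<^sup>L M' g\<bar> \<le> \<epsilon> * measure M K + \<epsilon> * measure M' K"
      using eq[OF f(1)] by linarith
    also have "\<dots> < \<epsilon> * T" using \<epsilon> by (simp add: T_def algebra_simps)
    also have "\<dots> = \<bar>integral\<^sup>L M g - integral\<^sup>L M' g\<bar>" using T by (simp add: \<epsilon>_def)
    finally show False by simp
  qed
  have closed_eq: "emeasure M C = emeasure M' C" if "closed C" "C \<subseteq> K" for C
    using integrals_eq_imp_measure_closed_eq[OF M M' eqc that]
    by (simp add: finite_measure.emeasure_eq_measure M(1) M'(1))
  have meas: "(\<lambda>x. x) \<in> measurable L borel" if "sets L = sets borel_K" for L
    by (subst measurable_cong_sets[OF that refl]) (intro measurable_restrict_space1 measurable_ident_sets refl)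
  define push where "push L = distr L borel (\<lambda>x. x)" for L :: "(real ^ 'n) measure"
  have push: "emeasure (push L) A = emeasure L (A \<inter> K)" if "sets L = sets borel_K" "A \<in> sets borel" for L A
    using emeasure_distr[OF meas[OF that(1)] that(2)] sets_eq_imp_space_eq[OF that(1)] by (simp add: push_def)
  have "push M = push M'"
  proof (rule measure_eqI_generator_eq[where E="Collect closed" and \<Omega>=UNIV and A="\<lambda>_. UNIV"])
    show "Int_stable (Collect closed)" by (auto simp: Int_stable_def)
    show "sets (push M) = sigma_sets UNIV (Collect closed)" "sets (push M') = sigma_sets UNIV (Collect closed)"
      by (simp_all add: push_def borel_eq_closed)
    show "emeasure (push M) X = emeasure (push M') X" if "X \<in> Collect closed" for X
      unfolding push[OF M(2) borel_closed[OF that[simplified]]] push[OF M'(2) borel_closed[OF that[simplified]]]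
      by (rule closed_eq) (use that closed_gasket in auto)
    show "emeasure (push M) UNIV \<noteq> \<infinity>"
      using push[OF M(2), of UNIV] by (simp add: finite_measure.emeasure_eq_measure M(1))
  qed auto
  show ?thesis
  proof (rule measure_eqI)
    show "sets M = sets M'" using M M' by simp
    fix A assume "A \<in> sets M"
    hence "A \<in> sets borel" "A \<subseteq> K"
      using M(2) closed_gasket by (auto simp: sets_restrict_space_iff borel_closed)
    thus "emeasure M A = emeasure M' A"
      using push[OF M(2), of A] push[OF M'(2), of A] \<open>push M = push M'\<close> by (simp add: Int_absorb2)
  qed
qed

lemma energy_measure_eq:
  assumes h: "h \<in> harmonic N p"
  shows "energy_measure N p h = self_similar_measure (\<lambda>i. h (p i))"
  unfolding energy_measure_def
proof (rule the_equality)
  let ?u = "\<lambda>i. h (p i)"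
  let ?I = "\<lambda>g. 2 * energy_form N p h (\<lambda>x. h x * g x) - energy_form N p (\<lambda>x. (h x)\<^sup>2) g"
  show "sets (self_similar_measure ?u) = sets borel_K \<and> (\<forall>g\<in>energy_domain N p. has_bochner_integral (self_similar_measure ?u) g (?I g))"
    using has_bochner_integral_self_similar[OF h] by simp
  fix M assume "sets M = sets borel_K \<and> (\<forall>g\<in>energy_domain N p. has_bochner_integral M g (?I g))"
  hence M: "sets M = sets borel_K" and I: "\<And>g. g \<in> energy_domain N p \<Longrightarrow> has_bochner_integral M g (?I g)"
    by blast+
  have "(\<lambda>_. 1) \<in> energy_domain N p"
    by (rule energy_domainI[of _ 0]) (simp_all add: level_energy_def Q0_def)
  from I[OF this] have "integrable M (\<lambda>_. 1 :: real)" by (rule integrable.intros)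
  hence "emeasure M (space M) < \<infinity>" by (simp add: integrable_iff_bounded)
  hence fin: "finite_measure M" by (intro finite_measureI) simp
  show "M = self_similar_measure ?u"
  proof (rule measure_eqI_energy_domain[OF fin M finite_self_similar sets_self_similar])
    fix g assume "g \<in> energy_domain N p"
    thus "integral\<^sup>L M g = integral\<^sup>L (self_similar_measure ?u) g"
      using I[of g] has_bochner_integral_self_similar[OF h, of g] by (simp add: has_bochner_integral_iff)
  qed
qed

lemma measure_energy_measure_cell:
  assumes "h \<in> harmonic N p" "set w \<subseteq> S"
  shows "measure (energy_measure N p h) (cell N p w) =
     scale ^ length w * (2 * boundary_energy N (restrs N w (\<lambda>i. h (p i))))"
  unfolding energy_measure_eq[OF assms(1)] measure_cell[OF assms(2)] mass_def ..

lemma emeasure_kusuoka: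
  assumes A: "A \<in> sets borel_K"
  shows "emeasure (kusuoka_measure N p) A = (\<Sum>k\<in>S. emeasure (energy_measure N p (harmonic_basis N p k)) A)"
  unfolding kusuoka_measure_def
proof (rule emeasure_measure_of_sigma)
  let ?\<nu> = "\<lambda>k. energy_measure N p (harmonic_basis N p k)"
  have sets: "sets (?\<nu> k) = sets borel_K" if "k \<in> S" for k
    using energy_measure_eq[OF harmonic_basis_props(1)[OF that]] by simp
  show "sigma_algebra K (sets borel_K)"
    using sets.sigma_algebra_axioms[of borel_K] by simp
  show "positive (sets borel_K) (\<lambda>A. \<Sum>k\<in>S. emeasure (?\<nu> k) A)" by (simp add: positive_def)
  show "countably_additive (sets borel_K) (\<lambda>A. \<Sum>k\<in>S. emeasure (?\<nu> k) A)"
  proof (rule countably_additiveI)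
    fix A :: "nat \<Rightarrow> (real ^ 'n) set"
    assume A: "range A \<subseteq> sets borel_K" "disjoint_family A" "(\<Union>i. A i) \<in> sets borel_K"
    have "(\<Sum>i. \<Sum>k\<in>S. emeasure (?\<nu> k) (A i)) = (\<Sum>k\<in>S. \<Sum>i. emeasure (?\<nu> k) (A i))"
      by (rule suminf_sum) (rule summableI)
    also have "\<dots> = (\<Sum>k\<in>S. emeasure (?\<nu> k) (\<Union>i. A i))"
      using A sets by (intro sum.cong refl suminf_emeasure) auto
    finally show "(\<Sum>i. \<Sum>k\<in>S. emeasure (?\<nu> k) (A i)) = (\<Sum>k\<in>S. emeasure (?\<nu> k) (\<Union>i. A i))" .
  qed
qed (rule A)

lemma measure_kusuoka_cell:
  assumes w: "set w \<subseteq> S"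
  shows "measure (kusuoka_measure N p) (cell N p w) =
     scale ^ length w * (\<Sum>k\<in>S. 2 * boundary_energy N (restrs N w (unit_boundary k)))"
proof -
  have "cell N p w \<in> sets borel_K" using w by (intro closed_in_borel_K closed_cell cell_subset)
  hence "emeasure (kusuoka_measure N p) (cell N p w) =
     (\<Sum>k\<in>S. emeasure (energy_measure N p (harmonic_basis N p k)) (cell N p w))"
    by (rule emeasure_kusuoka)
  also have "\<dots> = (\<Sum>k\<in>S. ennreal (measure (energy_measure N p (harmonic_basis N p k)) (cell N p w)))"
    by (intro sum.cong refl finite_measure.emeasure_eq_measure)
       (simp add: energy_measure_eq harmonic_basis_props(1) finite_self_similar)
  also have "\<dots> = ennreal (\<Sum>k\<in>S. measure (energy_measure N p (harmonic_basis N p k)) (cell N p w))"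
    by (rule sum_ennreal) simp
  finally have "measure (kusuoka_measure N p) (cell N p w) =
     (\<Sum>k\<in>S. measure (energy_measure N p (harmonic_basis N p k)) (cell N p w))"
    by (simp add: measure_def sum_nonneg)
  also have "\<dots> = (\<Sum>k\<in>S. scale ^ length w * (2 * boundary_energy N (restrs N w (unit_boundary k))))"
  proof (intro sum.cong refl)
    fix k assume k: "k \<in> S"
    have "boundary_energy N (restrs N w (\<lambda>i. harmonic_basis N p k (p i))) =
       boundary_energy N (restrs N w (unit_boundary k))"
      by (intro boundary_energy_cong restrs_cong w harmonic_basis_props(2) k)
    thus "measure (energy_measure N p (harmonic_basis N p k)) (cell N p w) =
       scale ^ length w * (2 * boundary_energy N (restrs N w (unit_boundary k)))"
      by (simp only: measure_energy_measure_cell[OF harmonic_basis_props(1)[OF k] w])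
  qed
  finally show ?thesis unfolding sum_distrib_left .
qed

end

section \<open>Harmonic restriction along an edge\<close>

text \<open>
  Points whose address alternates between two letters from some place on have no other address, so
  the trace there is a limit along a single sequence of cells.
\<close>

definition alternating :: "nat \<Rightarrow> nat \<Rightarrow> nat \<Rightarrow> nat" where
  "alternating i j n = (if even n then i else j)"

text \<open>
  For the roots \<open>\<mu>\<close> of \<open>\<mu>\<^sup>2 + \<mu> = N + 1\<close> these are the eigenfunctionals of restriction to the cell of
  \<open>i\<close> followed by exchanging \<open>i\<close> and \<open>j\<close>.
\<close>

definition edge_functional :: "nat \<Rightarrow> real \<Rightarrow> nat \<Rightarrow> nat \<Rightarrow> (nat \<Rightarrow> real) \<Rightarrow> real" where
  "edge_functional N \<mu> i j u = ((real N + 1) / 2 - \<mu>) * (u j - u i)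
     + (\<Sum>k\<in>letters N - {i, j}. u k - (u i + u j) / 2)"

text \<open>
  Up to the factor \<open>N + 1\<close>, the part of the energy that depends neither on \<open>u j - u i\<close> nor on
  the mean over the other vertices.
\<close>

definition off_edge_spread :: "nat \<Rightarrow> nat \<Rightarrow> nat \<Rightarrow> (nat \<Rightarrow> real) \<Rightarrow> real" where
  "off_edge_spread N i j u =
     (\<Sum>k\<in>letters N - {i, j}. (u k - sum u (letters N - {i, j}) / (real N - 1))\<^sup>2)"

definition disc :: "nat \<Rightarrow> real" where "disc N = sqrt (4 * real N + 5)"

text \<open>
  The two roots of \<open>\<mu>\<^sup>2 + \<mu> = N + 1\<close>; the negative root \<open>mu1\<close> has the larger modulus.
\<close>

definition mu1 :: "nat \<Rightarrow> real" where "mu1 N = - (1 + disc N) / 2"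
definition mu2 :: "nat \<Rightarrow> real" where "mu2 N = (disc N - 1) / 2"

text \<open>
  The coefficient that expresses the functionals of the reversed edge in those of the edge itself.
\<close>

definition flip_coeff :: "nat \<Rightarrow> real" where "flip_coeff N = (real N + 2) / disc N"

lemma flip_coeff_pos: "flip_coeff N > 0"
  unfolding flip_coeff_def disc_def by (intro divide_pos_pos) auto

lemma disc_square: "disc N * disc N = 4 * real N + 5"
  by (simp add: disc_def)

lemma disc_gt_1: "disc N > 1"
  unfolding disc_def by (rule real_less_rsqrt) simp

lemma mu_roots: "mu1 N * mu1 N + mu1 N = real N + 1" "mu2 N * mu2 N + mu2 N = real N + 1"
  using disc_square[of N] by (simp_all add: mu1_def mu2_def field_simps)

lemma alternating_Suc: "alternating i j (Suc n) = alternating j i n"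
  by (simp add: alternating_def)

lemma alternating_Suc_fun: "(\<lambda>n. alternating i j (Suc n)) = alternating j i"
  by (simp add: alternating_Suc fun_eq_iff)

lemma map_alternating_Suc: "map (alternating i j) [0..<Suc n] = i # map (alternating j i) [0..<n]"
  unfolding map_Suc_unfold alternating_Suc_fun by (simp add: alternating_def)

lemma set_map_alternating: "set (map (alternating i j) [0..<n]) \<subseteq> {i, j}"
  by (auto simp: alternating_def)

context
  fixes N :: nat and i j :: nat
  assumes N: "N \<ge> 2" and i: "i \<in> letters N" and j: "j \<in> letters N" and ij: "i \<noteq> j"
begin

lemma card_off_edge: "real (card (letters N - {i, j})) = real N - 1"
  using N i j ij by (simp add: card_Diff_subset of_nat_diff)

lemma sum_letters_split: "sum f (letters N) = f i + f j + sum f (letters N - {i, j})" for f :: "nat \<Rightarrow> real"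
proof -
  have "sum f (letters N) = f i + sum f (letters N - {i})" using i by (intro sum.remove) auto
  also have "sum f (letters N - {i}) = f j + sum f (letters N - {i} - {j})" using j ij by (intro sum.remove) auto
  also have "letters N - {i} - {j} = letters N - {i, j}" by auto
  finally show ?thesis by simp
qed

lemma sum_restr_off_edge:
  "sum (restr N i u) (letters N - {i, j}) =
     ((real N - 1) * (u i + sum u (letters N)) + sum u (letters N - {i, j})) / (real N + 3)"
proof -
  have "sum (restr N i u) (letters N - {i, j}) =
      (\<Sum>k\<in>letters N - {i, j}. ((u i + sum u (letters N)) + u k) / (real N + 3))"
    by (intro sum.cong refl) (auto simp: restr_def algebra_simps)
  thus ?thesis by (simp add: sum_divide_distrib[symmetric] sum.distrib card_off_edge)
qed

lemma edge_functional_alt: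
  "edge_functional N \<mu> i j u = ((real N + 1) / 2 - \<mu>) * (u j - u i)
     + (sum u (letters N - {i, j}) - (real N - 1) * (u i + u j) / 2)"
  unfolding edge_functional_def sum_subtractf by (simp add: card_off_edge)

text \<open>
  Reversing the edge after each step turns the two restriction maps along an edge into one map, whose
  eigenvalue equation is the assumption on \<open>\<mu>\<close>.
\<close>

lemma edge_functional_restr:
  assumes \<mu>: "\<mu> * \<mu> + \<mu> = real N + 1"
  shows "edge_functional N \<mu> j i (restr N i u) = \<mu> / (real N + 3) * edge_functional N \<mu> i j u"
proof -
  define s where "s = sum u (letters N - {i, j})"
  define U where "U = u i + u j + s"
  have U: "sum u (letters N) = U" unfolding U_def s_def by (rule sum_letters_split)
  have r: "restr N i u i = u i" "restr N i u j = (u i + u j + U) / (real N + 3)"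
    using ij by (simp_all add: restr_def U)
  note s' = sum_restr_off_edge[of u, unfolded U s_def[symmetric]]
  have "edge_functional N \<mu> j i (restr N i u) = ((real N + 1) / 2 - \<mu>) * (restr N i u i - restr N i u j)
     + (sum (restr N i u) (letters N - {i, j}) - (real N - 1) * (restr N i u i + restr N i u j) / 2)"
    unfolding edge_functional_def sum_subtractf
    by (simp add: card_off_edge insert_commute[of j i] add.commute)
  also have "\<dots> = \<mu> / (real N + 3) * (((real N + 1) / 2 - \<mu>) * (u j - u i)
     + (s - (real N - 1) * (u i + u j) / 2))"
  proof -
    have N1: "real N = \<mu> * \<mu> + \<mu> - 1" using \<mu> by simp
    have "\<mu> * \<mu> + \<mu> + 2 \<noteq> 0" using \<mu> by simp
    thus ?thesis unfolding r s' U_def N1 by (simp add: divide_simps) (simp add: algebra_simps)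
  qed
  finally show ?thesis unfolding edge_functional_alt s_def .
qed

lemma off_edge_spread_restr:
  "off_edge_spread N j i (restr N i u) = off_edge_spread N i j u / (real N + 3)\<^sup>2"
proof -
  define s where "s = sum u (letters N - {i, j})"
  define U where "U = sum u (letters N)"
  have N1: "real N - 1 \<noteq> 0" using N by simp
  note s' = sum_restr_off_edge[of u, folded U_def s_def]
  have "restr N i u k - sum (restr N i u) (letters N - {i, j}) / (real N - 1) = (u k - s / (real N - 1)) / (real N + 3)"
    if "k \<in> letters N - {i, j}" for k
  proof -
    have "(a + b + c) / e - ((d * (a + c) + s) / e) / d = (b - s / d) / e" if "d \<noteq> 0" "e \<noteq> 0" for a b c d e :: real
      using that by (simp add: field_simps)
    from this[OF N1, of "real N + 3" "u i" "u k" U] show ?thesis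
      using that unfolding s' restr_def U_def[symmetric] by simp
  qed
  thus ?thesis unfolding off_edge_spread_def insert_commute[of j i]
    by (simp add: power_divide sum_divide_distrib s_def)
qed

lemma boundary_energy_edge_coordinates:
  "boundary_energy N u = (real N + 1) / 2 * (u j - u i)\<^sup>2
     + 2 / (real N - 1) * (sum u (letters N - {i, j}) - (real N - 1) * (u i + u j) / 2)\<^sup>2
     + (real N + 1) * off_edge_spread N i j u"
proof -
  define s where "s = sum u (letters N - {i, j})"
  have N1: "real N - 1 \<noteq> 0" using N by simp
  have "off_edge_spread N i j u = (\<Sum>k\<in>letters N - {i, j}. (u k)\<^sup>2 - 2 * (s / (real N - 1)) * u k + (s / (real N - 1))\<^sup>2)"
    unfolding off_edge_spread_def s_def[symmetric] by (intro sum.cong refl) (simp add: power2_diff)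
  also have "\<dots> = (\<Sum>k\<in>letters N - {i, j}. (u k)\<^sup>2) - 2 * (s / (real N - 1)) * s + (real N - 1) * (s / (real N - 1))\<^sup>2"
    by (simp only: sum.distrib sum_subtractf sum_distrib_left[symmetric] s_def[symmetric] sum_constant card_off_edge)
  finally have "(\<Sum>k\<in>letters N - {i, j}. (u k)\<^sup>2) = off_edge_spread N i j u + s\<^sup>2 / (real N - 1)"
    using N1 by (simp add: power2_eq_square divide_simps)
  hence "boundary_energy N u = (real N + 1) * ((u i)\<^sup>2 + (u j)\<^sup>2 + (off_edge_spread N i j u + s\<^sup>2 / (real N - 1))) - (u i + u j + s)\<^sup>2"
    unfolding boundary_energy_expand sum_letters_split s_def by simp
  also have "\<dots> = (real N + 1) / 2 * (u j - u i)\<^sup>2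
     + 2 / (real N - 1) * (s - (real N - 1) * (u i + u j) / 2)\<^sup>2 + (real N + 1) * off_edge_spread N i j u"
    using N1 by (simp add: power2_eq_square divide_simps) (simp add: algebra_simps)
  finally show ?thesis unfolding s_def .
qed

text \<open>
  The first two squares are \<open>u j - u i\<close> and the sum of the deviations at the other vertices, recovered
  from the values of the two eigenfunctionals.
\<close>

lemma boundary_energy_functionals:
  "boundary_energy N u =
     (real N + 1) / 2 * ((edge_functional N (mu1 N) i j u - edge_functional N (mu2 N) i j u) / disc N)\<^sup>2
     + 2 / (real N - 1) * ((((real N + 1) / 2 - mu1 N) * edge_functional N (mu2 N) i j u
           - ((real N + 1) / 2 - mu2 N) * edge_functional N (mu1 N) i j u) / disc N)\<^sup>2
     + (real N + 1) * off_edge_spread N i j u"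
proof -
  define a where "a = u j - u i"
  define s where "s = sum u (letters N - {i, j}) - (real N - 1) * (u i + u j) / 2"
  have l: "edge_functional N \<mu> i j u = ((real N + 1) / 2 - \<mu>) * a + s" for \<mu>
    unfolding edge_functional_alt a_def s_def ..
  have d: "disc N \<noteq> 0" using disc_gt_1[of N] by simp
  have "(edge_functional N (mu1 N) i j u - edge_functional N (mu2 N) i j u) / disc N = a"
    unfolding l using d by (simp add: mu1_def mu2_def divide_simps) (simp add: algebra_simps)
  moreover have "(((real N + 1) / 2 - mu1 N) * edge_functional N (mu2 N) i j u
           - ((real N + 1) / 2 - mu2 N) * edge_functional N (mu1 N) i j u) / disc N = s"
    unfolding l using d by (simp add: mu1_def mu2_def divide_simps) (simp add: algebra_simps)
  ultimately show ?thesis unfolding boundary_energy_edge_coordinates a_def[symmetric] s_def[symmetric] by simp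
qed

text \<open>
  Reversal changes the sign of \<open>u j - u i\<close> only. The assumption states the resulting linear equation
  for the coefficient \<open>c\<close>; the two coefficients sum to \<open>1\<close> because all functionals agree when
  \<open>u j = u i\<close>.
\<close>

lemma edge_functional_flip:
  assumes "c * disc N = real N + 3 / 2 - \<mu> + disc N / 2"
  shows "edge_functional N \<mu> j i u =
     (1 - c) * edge_functional N (mu1 N) i j u + c * edge_functional N (mu2 N) i j u"
proof -
  define a where "a = u j - u i"
  define s where "s = sum u (letters N - {i, j}) - (real N - 1) * (u i + u j) / 2"
  have l: "edge_functional N \<mu> i j u = ((real N + 1) / 2 - \<mu>) * a + s" for \<mu>
    unfolding edge_functional_alt a_def s_def ..
  have l': "edge_functional N \<mu> j i u = - ((real N + 1) / 2 - \<mu>) * a + s"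
    unfolding edge_functional_def sum_subtractf a_def s_def
    by (simp add: card_off_edge insert_commute[of j i] field_simps)
  have "(1 - c) * (((real N + 1) / 2 - mu1 N) * a + s) + c * (((real N + 1) / 2 - mu2 N) * a + s)
     = ((real N + 1 + (1 + disc N)) / 2 - c * disc N) * a + s"
    by (simp add: mu1_def mu2_def field_simps)
  also have "\<dots> = - ((real N + 1) / 2 - \<mu>) * a + s" unfolding assms by (simp add: field_simps)
  finally show ?thesis unfolding l l' ..
qed

lemma edge_functional_flip1:
    "edge_functional N (mu1 N) j i u =
       - flip_coeff N * edge_functional N (mu1 N) i j u + (1 + flip_coeff N) * edge_functional N (mu2 N) i j u"
  and edge_functional_flip2:
    "edge_functional N (mu2 N) j i u =
       (1 - flip_coeff N) * edge_functional N (mu1 N) i j u + flip_coeff N * edge_functional N (mu2 N) i j u"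
proof -
  have "flip_coeff N * disc N = real N + 2" using disc_gt_1[of N] by (simp add: flip_coeff_def)
  hence "(1 + flip_coeff N) * disc N = real N + 3 / 2 - mu1 N + disc N / 2"
    "flip_coeff N * disc N = real N + 3 / 2 - mu2 N + disc N / 2"
    by (simp_all add: mu1_def mu2_def field_simps)
  from this[THEN edge_functional_flip, of u] show
    "edge_functional N (mu1 N) j i u =
       - flip_coeff N * edge_functional N (mu1 N) i j u + (1 + flip_coeff N) * edge_functional N (mu2 N) i j u"
    "edge_functional N (mu2 N) j i u =
       (1 - flip_coeff N) * edge_functional N (mu1 N) i j u + flip_coeff N * edge_functional N (mu2 N) i j u"
    by simp_all
qed

end

lemma edge_functional_alternating:
  assumes "N \<ge> 2" "i \<in> letters N" "j \<in> letters N" "i \<noteq> j" "\<mu> * \<mu> + \<mu> = real N + 1"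
  shows "edge_functional N \<mu> (alternating i j n) (alternating j i n) (restrs N (map (alternating i j) [0..<n]) u)
     = (\<mu> / (real N + 3)) ^ n * edge_functional N \<mu> i j u"
  using assms(2-4)
proof (induction n arbitrary: i j u)
  case (Suc n)
  show ?case
    using Suc.IH[of j i "restr N i u"] Suc.prems edge_functional_restr[OF assms(1) Suc.prems assms(5)]
    unfolding map_alternating_Suc alternating_Suc by simp
qed (simp add: alternating_def)

text \<open>
  After \<open>n\<close> periods the functional \<open>l\<^sub>1\<close> of the reversed edge is proportional to \<open>l\<^sub>1 + \<epsilon> l\<^sub>2\<close> with
  this coefficient \<open>\<epsilon>\<close>.
\<close>

definition flip_deviation :: "nat \<Rightarrow> nat \<Rightarrow> real" where
  "flip_deviation N n = - ((1 + flip_coeff N) / flip_coeff N) * ((mu2 N / mu1 N)\<^sup>2) ^ n"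

lemma mu_nonzero: "mu1 N \<noteq> 0" "mu2 N \<noteq> 0"
  using disc_gt_1[of N] by (simp_all add: mu1_def mu2_def)

lemma edge_functional_flip_alternating:
  assumes N: "N \<ge> 2" and ij: "i \<in> letters N" "j \<in> letters N" "i \<noteq> j"
  shows "edge_functional N (mu1 N) j i (restrs N (map (alternating i j) [0..<2 * n]) u) =
     - flip_coeff N * (mu1 N / (real N + 3)) ^ (2 * n) *
       (edge_functional N (mu1 N) i j u + flip_deviation N n * edge_functional N (mu2 N) i j u)"
proof -
  let ?c = "flip_coeff N" and ?r1 = "mu1 N / (real N + 3)" and ?r2 = "mu2 N / (real N + 3)"
  have even: "alternating i j (2 * n) = i" "alternating j i (2 * n) = j" by (simp_all add: alternating_def)
  note A = edge_functional_alternating[OF N ij, of _ "2 * n" u, unfolded even]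
  have r2: "?r2 ^ (2 * n) = ?r1 ^ (2 * n) * ((mu2 N / mu1 N)\<^sup>2) ^ n"
    unfolding power_mult[symmetric] power_mult_distrib[symmetric] using mu_nonzero[of N] by simp
  have dev: "(1 + ?c) * ((mu2 N / mu1 N)\<^sup>2) ^ n = - ?c * flip_deviation N n"
    using flip_coeff_pos[of N] by (simp add: flip_deviation_def)
  have gen: "- c * (r * P) + (1 + c) * ((r * q) * M) = - c * r * (P + d * M)"
    if "(1 + c) * q = - c * d" for c r P q M d :: real
  proof -
    have "(1 + c) * ((r * q) * M) = ((1 + c) * q) * (r * M)" by (simp only: mult_ac)
    thus ?thesis unfolding that by (simp add: algebra_simps)
  qed
  show ?thesis
    unfolding edge_functional_flip1[OF N ij] A[OF mu_roots(1)] A[OF mu_roots(2)] r2 by (rule gen[OF dev])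
qed

lemma flip_deviation_filterlim: "filterlim (flip_deviation N) (at 0) sequentially"
proof -
  have "norm ((mu2 N / mu1 N)\<^sup>2) < 1"
    unfolding power2_eq_square mu1_def mu2_def using disc_gt_1[of N]
    by (simp add: divide_simps) (simp add: algebra_simps)
  hence "(\<lambda>n. - ((1 + flip_coeff N) / flip_coeff N) * ((mu2 N / mu1 N)\<^sup>2) ^ n)
      \<longlonglongrightarrow> - ((1 + flip_coeff N) / flip_coeff N) * 0"
    by (intro tendsto_mult tendsto_const LIMSEQ_power_zero)
  hence "flip_deviation N \<longlonglongrightarrow> 0" by (simp add: flip_deviation_def[abs_def])
  moreover have "flip_deviation N n \<noteq> 0" for n
    using flip_coeff_pos[of N] mu_nonzero[of N] by (simp add: flip_deviation_def)
  ultimately show ?thesis by (simp add: filterlim_at)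
qed

lemma off_edge_spread_alternating:
  assumes "N \<ge> 2" "i \<in> letters N" "j \<in> letters N" "i \<noteq> j"
  shows "off_edge_spread N (alternating i j n) (alternating j i n) (restrs N (map (alternating i j) [0..<n]) u)
     = off_edge_spread N i j u / ((real N + 3)\<^sup>2) ^ n"
  using assms(2-4)
proof (induction n arbitrary: i j u)
  case (Suc n)
  show ?case
    using Suc.IH[of j i "restr N i u"] Suc.prems off_edge_spread_restr[OF assms(1) Suc.prems]
    unfolding map_alternating_Suc alternating_Suc by simp
qed (simp add: alternating_def)

text \<open>
  The energy of a vector with \<open>l\<^sub>1 = 1\<close>, \<open>l\<^sub>2 = 0\<close> and no further components.
\<close>

definition leading_coefficient :: "nat \<Rightarrow> real" where
  "leading_coefficient N = (real N + 1) / 2 * (1 / disc N)\<^sup>2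
     + 2 / (real N - 1) * (((real N + 1) / 2 - mu2 N) / disc N)\<^sup>2"

lemma leading_coefficient_pos: "N \<ge> 2 \<Longrightarrow> leading_coefficient N > 0"
  unfolding leading_coefficient_def using disc_gt_1[of N]
  by (intro add_pos_nonneg mult_pos_pos mult_nonneg_nonneg) auto

text \<open>
  Since \<open>mu1\<close> exceeds both \<open>mu2\<close> and \<open>1\<close> in modulus, only the component seen by \<open>l\<^sub>1\<close> survives.
\<close>

lemma boundary_energy_alternating_LIMSEQ:
  assumes N: "N \<ge> 2" and ij: "i \<in> letters N" "j \<in> letters N" "i \<noteq> j"
  shows "(\<lambda>n. boundary_energy N (restrs N (map (alternating i j) [0..<n]) u) / ((mu1 N / (real N + 3))\<^sup>2) ^ n)
     \<longlonglongrightarrow> leading_coefficient N * (edge_functional N (mu1 N) i j u)\<^sup>2"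
proof -
  let ?m = "mu1 N" and ?d = "disc N"
  define x1 x2 where "x1 = (real N + 1) / 2 - mu1 N" and "x2 = (real N + 1) / 2 - mu2 N"
  define l1 l2 where "l1 = edge_functional N (mu1 N) i j u" and "l2 = edge_functional N (mu2 N) i j u"
  define z where "z = off_edge_spread N i j u"
  define q where "q = mu2 N / mu1 N"
  have d: "?d > 1" by (rule disc_gt_1)
  have m: "\<bar>?m\<bar> > 1" "?m \<noteq> 0" using d by (auto simp: mu1_def)
  have q: "\<bar>q\<bar> < 1" using d unfolding q_def mu1_def mu2_def by (simp add: abs_divide divide_simps)
  have e: "boundary_energy N (restrs N (map (alternating i j) [0..<n]) u) / ((?m / (real N + 3))\<^sup>2) ^ n
     = (real N + 1) / 2 * ((l1 - q ^ n * l2) / ?d)\<^sup>2 + 2 / (real N - 1) * ((x1 * (q ^ n * l2) - x2 * l1) / ?d)\<^sup>2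
       + (real N + 1) * (z * ((1 / ?m)\<^sup>2) ^ n)" for n
  proof -
    let ?v = "restrs N (map (alternating i j) [0..<n]) u"
    define r where "r = (?m / (real N + 3)) ^ n"
    have r0: "r \<noteq> 0" using m by (simp add: r_def)
    have e2: "(mu2 N / (real N + 3)) ^ n = r * q ^ n"
      unfolding r_def q_def power_mult_distrib[symmetric] using m by simp
    have e3: "z / ((real N + 3)\<^sup>2) ^ n = r\<^sup>2 * (z * ((1 / ?m)\<^sup>2) ^ n)"
    proof -
      have "r\<^sup>2 * ((1 / ?m)\<^sup>2) ^ n = ((?m / (real N + 3) * (1 / ?m))\<^sup>2) ^ n"
        unfolding r_def power_mult_distrib by (simp add: power_mult[symmetric] mult.commute)
      also have "?m / (real N + 3) * (1 / ?m) = 1 / (real N + 3)" using m by simp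
      finally have "z * (r\<^sup>2 * ((1 / ?m)\<^sup>2) ^ n) = z / ((real N + 3)\<^sup>2) ^ n" by (simp add: power_divide)
      thus ?thesis by (simp only: mult_ac)
    qed
    have alt: "alternating i j n \<in> letters N" "alternating j i n \<in> letters N" "alternating i j n \<noteq> alternating j i n"
      using ij by (auto simp: alternating_def)
    have "boundary_energy N ?v = (real N + 1) / 2 * ((r * l1 - r * q ^ n * l2) / ?d)\<^sup>2
      + 2 / (real N - 1) * ((x1 * (r * q ^ n * l2) - x2 * (r * l1)) / ?d)\<^sup>2 + (real N + 1) * (r\<^sup>2 * (z * ((1 / ?m)\<^sup>2) ^ n))"
      unfolding boundary_energy_functionals[OF N alt] edge_functional_alternating[OF N ij mu_roots(1)]
        edge_functional_alternating[OF N ij mu_roots(2)] off_edge_spread_alternating[OF N ij] e2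
        r_def[symmetric] l1_def[symmetric] l2_def[symmetric] x1_def[symmetric] x2_def[symmetric] z_def[symmetric] e3 ..
    also have "\<dots> = r\<^sup>2 * ((real N + 1) / 2 * ((l1 - q ^ n * l2) / ?d)\<^sup>2 + 2 / (real N - 1) * ((x1 * (q ^ n * l2) - x2 * l1) / ?d)\<^sup>2
       + (real N + 1) * (z * ((1 / ?m)\<^sup>2) ^ n))"
    proof -
      have "(r * l1 - r * q ^ n * l2) / ?d = r * ((l1 - q ^ n * l2) / ?d)"
        "(x1 * (r * q ^ n * l2) - x2 * (r * l1)) / ?d = r * ((x1 * (q ^ n * l2) - x2 * l1) / ?d)"
        by (simp_all add: right_diff_distrib diff_divide_distrib mult_ac)
      thus ?thesis by (simp only: power_mult_distrib distrib_left mult_ac)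
    qed
    also have "\<dots> / ((?m / (real N + 3))\<^sup>2) ^ n = (real N + 1) / 2 * ((l1 - q ^ n * l2) / ?d)\<^sup>2
       + 2 / (real N - 1) * ((x1 * (q ^ n * l2) - x2 * l1) / ?d)\<^sup>2 + (real N + 1) * (z * ((1 / ?m)\<^sup>2) ^ n)"
    proof -
      have "((?m / (real N + 3))\<^sup>2) ^ n = r\<^sup>2" unfolding r_def by (simp add: power_mult[symmetric] mult.commute)
      thus ?thesis using r0 by simp
    qed
    finally show ?thesis .
  qed
  have qn: "(\<lambda>n. q ^ n) \<longlonglongrightarrow> 0" using q by (intro LIMSEQ_power_zero) simp
  have mn: "(\<lambda>n. ((1 / ?m)\<^sup>2) ^ n) \<longlonglongrightarrow> 0"
  proof (rule LIMSEQ_power_zero)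
    have "1 < ?m\<^sup>2" using m(1) by (metis one_less_power power2_abs zero_less_numeral)
    thus "norm ((1 / ?m)\<^sup>2) < 1" using m(2) by (simp add: power_divide divide_less_eq_1)
  qed
  have "(\<lambda>n. (real N + 1) / 2 * ((l1 - q ^ n * l2) / ?d)\<^sup>2 + 2 / (real N - 1) * ((x1 * (q ^ n * l2) - x2 * l1) / ?d)\<^sup>2
       + (real N + 1) * (z * ((1 / ?m)\<^sup>2) ^ n))
    \<longlonglongrightarrow> (real N + 1) / 2 * ((l1 - 0 * l2) / ?d)\<^sup>2 + 2 / (real N - 1) * ((x1 * (0 * l2) - x2 * l1) / ?d)\<^sup>2
       + (real N + 1) * (z * 0)"
    using d by (intro tendsto_intros qn mn) auto
  moreover have "(real N + 1) / 2 * ((l1 - 0 * l2) / ?d)\<^sup>2 + 2 / (real N - 1) * ((x1 * (0 * l2) - x2 * l1) / ?d)\<^sup>2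
       + (real N + 1) * (z * 0) = leading_coefficient N * l1\<^sup>2"
    unfolding leading_coefficient_def x2_def[symmetric]
    by (simp add: power_mult_distrib power_divide algebra_simps)
  ultimately show ?thesis unfolding e l1_def by simp
qed

lemma edge_functional_restrs_expand:
  assumes w: "set w \<subseteq> letters N" and ij: "i \<in> letters N" "j \<in> letters N"
  shows "edge_functional N \<mu> i j (restrs N w u) =
    (\<Sum>m\<in>letters N. u m * edge_functional N \<mu> i j (restrs N w (unit_boundary m)))"
proof -
  let ?S = "letters N" and ?e = "\<lambda>m. restrs N w (unit_boundary m)"
  have x: "restrs N w u k = (\<Sum>m\<in>?S. u m * ?e m k)" if "k \<in> ?S" for k
    by (rule restrs_expand[OF w that])
  have "(\<Sum>k\<in>?S - {i, j}. restrs N w u k - (restrs N w u i + restrs N w u j) / 2)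
     = (\<Sum>k\<in>?S - {i, j}. \<Sum>m\<in>?S. u m * (?e m k - (?e m i + ?e m j) / 2))"
    using ij by (intro sum.cong refl)
      (simp add: x sum.distrib sum_subtractf sum_divide_distrib algebra_simps add_divide_distrib)
  also have "\<dots> = (\<Sum>m\<in>?S. u m * (\<Sum>k\<in>?S - {i, j}. ?e m k - (?e m i + ?e m j) / 2))"
    unfolding sum_distrib_left by (rule sum.swap)
  finally have "edge_functional N \<mu> i j (restrs N w u) =
     ((real N + 1) / 2 - \<mu>) * ((\<Sum>m\<in>?S. u m * ?e m j) - (\<Sum>m\<in>?S. u m * ?e m i))
     + (\<Sum>m\<in>?S. u m * (\<Sum>k\<in>?S - {i, j}. ?e m k - (?e m i + ?e m j) / 2))"
    unfolding edge_functional_def x[OF ij(1)] x[OF ij(2)] by simp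
  also have "\<dots> = (\<Sum>m\<in>?S. u m * edge_functional N \<mu> i j (?e m))"
    unfolding sum_subtractf[symmetric] sum_distrib_left sum.distrib[symmetric] edge_functional_def
    by (intro sum.cong refl) (simp add: algebra_simps sum_distrib_left)
  finally show ?thesis .
qed

text \<open>
  The two eigenfunctionals remain independent after restriction to any cell, because the values of
  a harmonic function at the vertices of a cell are arbitrary.
\<close>

lemma edge_functionals_independent:
  assumes N: "N \<ge> 2" and ij: "i \<in> letters N" "j \<in> letters N" "i \<noteq> j" and w: "set w \<subseteq> letters N"
    and zero: "\<And>k. k \<in> letters N \<Longrightarrow> x * edge_functional N (mu1 N) i j (restrs N w (unit_boundary k))
       + y * edge_functional N (mu2 N) i j (restrs N w (unit_boundary k)) = 0"
  shows "x = 0 \<and> y = 0"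
proof -
  have z: "x * edge_functional N (mu1 N) i j v + y * edge_functional N (mu2 N) i j v = 0" for v
  proof -
    obtain u where "\<forall>k. restrs N w u k = v k" using restrs_surj[OF w] by blast
    hence v: "v = restrs N w u" by auto
    have "x * edge_functional N (mu1 N) i j v + y * edge_functional N (mu2 N) i j v
      = (\<Sum>m\<in>letters N. u m * (x * edge_functional N (mu1 N) i j (restrs N w (unit_boundary m))
         + y * edge_functional N (mu2 N) i j (restrs N w (unit_boundary m))))"
      unfolding v edge_functional_restrs_expand[OF w ij(1,2), of _ u] sum_distrib_left sum.distrib[symmetric]
      by (intro sum.cong refl) (simp add: algebra_simps)
    also have "\<dots> = 0" using zero by simp
    finally show ?thesis .
  qed
  have N1: "real N - 1 \<noteq> 0" using N by simp
  have "x * (real N - 1) + y * (real N - 1) = 0"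
    using z[of "\<lambda>k. if k \<in> {i, j} then 0 else 1"] card_off_edge[OF N ij]
    by (simp add: edge_functional_def)
  hence xy: "y = - x" using N1 by (metis add.commute distrib_right mult_eq_0_iff add_eq_0_iff)
  have "x * (((real N + 1) / 2 - mu1 N) - ((real N + 1) / 2 - mu2 N)) = 0"
    using z[of "unit_boundary j"] ij unfolding xy
    by (simp add: edge_functional_def unit_boundary_def) (auto simp add: field_simps)
  hence "x * disc N = 0" by (simp add: mu1_def mu2_def algebra_simps diff_divide_distrib add_divide_distrib)
  thus ?thesis using disc_gt_1[of N] xy by simp
qed

section \<open>Traces at points with eventually alternating addresses\<close>

definition prepend :: "nat list \<Rightarrow> (nat \<Rightarrow> nat) \<Rightarrow> nat \<Rightarrow> nat" where
  "prepend v \<omega> n = (if n < length v then v ! n else \<omega> (n - length v))"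

lemma map_prepend: "map (prepend v \<omega>) [0..<length v + n] = v @ map \<omega> [0..<n]"
  by (rule nth_equalityI) (auto simp: prepend_def nth_append)

lemma range_prepend: "set v \<subseteq> A \<Longrightarrow> range \<omega> \<subseteq> A \<Longrightarrow> range (prepend v \<omega>) \<subseteq> A"
  by (force simp: prepend_def)

lemma range_alternating: "range (alternating i j) \<subseteq> {i, j}"
  by (auto simp: alternating_def)

lemma prepend_alternating_not_constant:
  assumes "i \<noteq> j"
  shows "\<not> (\<exists>n b. \<forall>m\<ge>n. prepend v (alternating i j) m = b)"
proof
  assume "\<exists>n b. \<forall>m\<ge>n. prepend v (alternating i j) m = b"
  then obtain n b where b: "\<And>m. m \<ge> n \<Longrightarrow> prepend v (alternating i j) m = b" by blast
  have "prepend v (alternating i j) (length v + 2 * n) = i" "prepend v (alternating i j) (length v + 2 * n + 1) = j"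
    by (simp_all add: prepend_def alternating_def)
  with b[of "length v + 2 * n"] b[of "length v + 2 * n + 1"] assms show False by simp
qed

lemma Limsup_pos_sequence:
  fixes f :: "'a :: t1_space \<Rightarrow> real"
  assumes "\<And>n. y n \<in> A" "\<And>n. y n \<noteq> x" "y \<longlonglongrightarrow> x" "(\<lambda>n. f (y n)) \<longlonglongrightarrow> L" "L > 0"
  shows "Limsup (at x within A) (\<lambda>y. ereal (f y)) > 0"
proof (rule ccontr)
  assume "\<not> Limsup (at x within A) (\<lambda>y. ereal (f y)) > 0"
  hence "Limsup (at x within A) (\<lambda>y. ereal (f y)) \<le> 0" by simp
  also have "0 < ereal (L / 2)" using \<open>L > 0\<close> by simp
  finally have "\<forall>\<^sub>F y in at x within A. ereal (f y) < ereal (L / 2)" by (rule Limsup_lessD)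
  moreover have "filterlim y (at x within A) sequentially"
    using assms by (auto simp: filterlim_at)
  ultimately have "\<forall>\<^sub>F n in sequentially. ereal (f (y n)) < ereal (L / 2)"
    by (auto simp: filterlim_iff)
  moreover have "\<forall>\<^sub>F n in sequentially. L / 2 < f (y n)"
    using assms(4,5) by (intro order_tendstoD) auto
  ultimately have "\<forall>\<^sub>F n in sequentially. False" by eventually_elim auto
  thus False by simp
qed

lemma linear_forms_zero:
  fixes x y x' y' P M :: real
  assumes "x * P + y * M = 0" "x' * P + y' * M = 0" "x * y' - x' * y \<noteq> 0"
  shows "P = 0 \<and> M = 0"
proof -
  have "(x * y' - x' * y) * P = y' * (x * P + y * M) - y * (x' * P + y' * M)"
    "(x * y' - x' * y) * M = x * (x' * P + y' * M) - x' * (x * P + y * M)"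
    by (simp_all add: algebra_simps)
  hence "(x * y' - x' * y) * P = 0" "(x * y' - x' * y) * M = 0" unfolding assms(1,2) by simp_all
  thus ?thesis using assms(3) by simp
qed

text \<open>Two nonzero linear forms on the plane cannot both cover three pairwise independent vectors.\<close>

lemma linear_forms_choice:
  fixes P M P' M' x2 y2 x3 y3 :: real
  assumes ne: "P \<noteq> 0 \<or> M \<noteq> 0" "P' \<noteq> 0 \<or> M' \<noteq> 0" and y: "y2 \<noteq> 0" "y3 \<noteq> 0" and d: "x2 * y3 - x3 * y2 \<noteq> 0"
  shows "(P \<noteq> 0 \<and> P' \<noteq> 0) \<or> (x2 * P + y2 * M \<noteq> 0 \<and> x2 * P' + y2 * M' \<noteq> 0)
     \<or> (x3 * P + y3 * M \<noteq> 0 \<and> x3 * P' + y3 * M' \<noteq> 0)"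
proof (rule ccontr)
  assume "\<not> ?thesis"
  hence "P = 0 \<or> P' = 0" "x2 * P + y2 * M = 0 \<or> x2 * P' + y2 * M' = 0"
    "x3 * P + y3 * M = 0 \<or> x3 * P' + y3 * M' = 0" by blast+
  moreover have "\<not> (P = 0 \<and> x2 * P + y2 * M = 0)" "\<not> (P = 0 \<and> x3 * P + y3 * M = 0)"
    "\<not> (P' = 0 \<and> x2 * P' + y2 * M' = 0)" "\<not> (P' = 0 \<and> x3 * P' + y3 * M' = 0)"
    using ne y by auto
  moreover have "\<not> (x2 * P + y2 * M = 0 \<and> x3 * P + y3 * M = 0)"
    using linear_forms_zero[OF _ _ d, of P M] ne by blast
  moreover have "\<not> (x2 * P' + y2 * M' = 0 \<and> x3 * P' + y3 * M' = 0)"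
    using linear_forms_zero[OF _ _ d, of P' M'] ne by blast
  ultimately show False by blast
qed

text \<open>
  If both expressions vanished, the Gram matrix of \<open>f\<close> and \<open>g\<close> would have \<open>(M, - P)\<close> in its kernel,
  and \<open>M f - P g\<close> would be zero.
\<close>

lemma gram_nonzero:
  fixes P M :: real and f g :: "'a \<Rightarrow> real"
  assumes "finite A" "P \<noteq> 0 \<or> M \<noteq> 0"
    and indep: "\<And>x y. (\<And>k. k \<in> A \<Longrightarrow> x * f k + y * g k = 0) \<Longrightarrow> x = 0 \<and> y = 0"
  shows "(\<Sum>k\<in>A. f k * f k) * M - (\<Sum>k\<in>A. f k * g k) * P \<noteq> 0 \<or>
         (\<Sum>k\<in>A. f k * g k) * M - (\<Sum>k\<in>A. g k * g k) * P \<noteq> 0"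
proof (rule ccontr)
  assume "\<not> ?thesis"
  hence z: "(\<Sum>k\<in>A. f k * f k) * M - (\<Sum>k\<in>A. f k * g k) * P = 0"
    "(\<Sum>k\<in>A. f k * g k) * M - (\<Sum>k\<in>A. g k * g k) * P = 0" by simp_all
  have "(\<Sum>k\<in>A. (M * f k + (- P) * g k)\<^sup>2) =
     (\<Sum>k\<in>A. M * (M * (f k * f k)) - M * (P * (f k * g k)) - P * (M * (f k * g k)) + P * (P * (g k * g k)))"
    by (intro sum.cong refl) (simp add: power2_eq_square algebra_simps)
  also have "\<dots> = M * ((\<Sum>k\<in>A. f k * f k) * M - (\<Sum>k\<in>A. f k * g k) * P)
     - P * ((\<Sum>k\<in>A. f k * g k) * M - (\<Sum>k\<in>A. g k * g k) * P)"
    unfolding sum.distrib sum_subtractf sum_distrib_left[symmetric] by (simp add: algebra_simps)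
  also have "\<dots> = 0" unfolding z by simp
  finally have "\<forall>k\<in>A. (M * f k + (- P) * g k)\<^sup>2 = 0"
    using assms(1) by (subst (asm) sum_nonneg_eq_0_iff) auto
  hence "M = 0 \<and> - P = 0" by (intro indep) simp
  thus False using assms(2) by simp
qed

text \<open>
  Change of basis in the numerator of the derivative of \<open>\<epsilon> \<mapsto> (P + \<epsilon> M)\<^sup>2 / (\<Sum>k. (f k + \<epsilon> g k)\<^sup>2)\<close>.
\<close>

lemma gram_change_of_basis:
  fixes P M x y x' y' :: real and f g :: "'a \<Rightarrow> real"
  shows "(x' * P + y' * M) * (\<Sum>k\<in>A. (x * f k + y * g k)\<^sup>2)
      - (x * P + y * M) * (\<Sum>k\<in>A. (x * f k + y * g k) * (x' * f k + y' * g k))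
    = (x * y' - x' * y) * (x * ((\<Sum>k\<in>A. f k * f k) * M - (\<Sum>k\<in>A. f k * g k) * P)
       + y * ((\<Sum>k\<in>A. f k * g k) * M - (\<Sum>k\<in>A. g k * g k) * P))"
proof -
  have 1: "(\<Sum>k\<in>A. (x * f k + y * g k)\<^sup>2) = x * x * (\<Sum>k\<in>A. f k * f k) + 2 * x * y * (\<Sum>k\<in>A. f k * g k) + y * y * (\<Sum>k\<in>A. g k * g k)"
    unfolding sum_distrib_left sum.distrib[symmetric]
    by (intro sum.cong refl) (simp add: power2_eq_square algebra_simps)
  have 2: "(\<Sum>k\<in>A. (x * f k + y * g k) * (x' * f k + y' * g k)) = x * x' * (\<Sum>k\<in>A. f k * f k)
     + (x * y' + x' * y) * (\<Sum>k\<in>A. f k * g k) + y * y' * (\<Sum>k\<in>A. g k * g k)"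
    unfolding sum_distrib_left sum.distrib[symmetric]
    by (intro sum.cong refl) (simp add: algebra_simps)
  show ?thesis unfolding 1 2 by (simp add: algebra_simps)
qed

lemma quotient_derivative_at_0:
  fixes P M :: real and f g :: "'a \<Rightarrow> real"
  assumes A: "(\<Sum>k\<in>A. (f k)\<^sup>2) \<noteq> 0"
  shows "((\<lambda>\<epsilon>. (P + \<epsilon> * M)\<^sup>2 / (\<Sum>k\<in>A. (f k + \<epsilon> * g k)\<^sup>2)) has_real_derivative
     2 * P * (M * (\<Sum>k\<in>A. (f k)\<^sup>2) - P * (\<Sum>k\<in>A. f k * g k)) / (\<Sum>k\<in>A. (f k)\<^sup>2)\<^sup>2) (at 0)"
proof -
  have "((\<lambda>\<epsilon>. (P + \<epsilon> * M)\<^sup>2 / (\<Sum>k\<in>A. (f k + \<epsilon> * g k)\<^sup>2)) has_real_derivative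
     ((2 * P * M) * (\<Sum>k\<in>A. (f k)\<^sup>2) - P\<^sup>2 * (\<Sum>k\<in>A. 2 * (f k * g k)))
        / ((\<Sum>k\<in>A. (f k)\<^sup>2) * (\<Sum>k\<in>A. (f k)\<^sup>2))) (at 0)"
    using A by (auto intro!: derivative_eq_intros simp: power2_eq_square mult_ac)
  thus ?thesis
    unfolding sum_distrib_left[symmetric]
    by (rule DERIV_cong) (simp add: power2_eq_square algebra_simps)
qed

text \<open>
  The exponent is the one for which the distance \<open>4 ^ (- n)\<close> matches the decay of the deviation of the
  functionals.
\<close>

lemma gamma_exp_powr: "(1 / 4) powr gamma_exp N = (mu2 N / mu1 N)\<^sup>2"
proof -
  have d: "disc N > 1" by (rule disc_gt_1)
  have "gamma_exp N = log 2 ((disc N + 1) / (disc N - 1))" by (simp add: gamma_exp_def disc_def)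
  hence "2 powr gamma_exp N = (disc N + 1) / (disc N - 1)" using d by simp
  hence "(1 / 2) powr gamma_exp N = (disc N - 1) / (disc N + 1)"
    by (simp add: powr_divide)
  moreover have "(1 / 4 :: real) powr gamma_exp N = ((1 / 2) powr gamma_exp N)\<^sup>2"
    using powr_mult[of "1 / 2" "1 / 2" "gamma_exp N"] by (simp add: power2_eq_square)
  moreover have "mu2 N / mu1 N = - ((disc N - 1) / (disc N + 1))"
    using d by (simp add: mu1_def mu2_def divide_simps) (simp add: algebra_simps)
  ultimately show ?thesis by simp
qed

context sierpinski
begin

lemma address_point_prepend:
  assumes "set v \<subseteq> S" "range \<omega> \<subseteq> S"
  shows "address_point p (prepend v \<omega>) = psi p v (address_point p \<omega>)"
proof -
  have "(\<lambda>k. prepend v \<omega> (k + length v)) = \<omega>" by (simp add: prepend_def fun_eq_iff)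
  thus ?thesis
    using address_point_prefix[OF range_prepend[OF assms], of "length v"] map_prepend[of v \<omega> 0] by simp
qed

text \<open>
  Without a constant tail the address \<open>\<omega>\<close> is unique by \<open>address_eqD\<close>, and the description of the
  trace through all addresses of a point refers to \<open>\<omega>\<close> alone.
\<close>

lemma edge_trace_eq:
  assumes ij: "i \<in> S" "j \<in> S" and \<omega>: "range \<omega> \<subseteq> {i, j}" and nc: "\<not> (\<exists>n b. \<forall>m\<ge>n. \<omega> m = b)"
  shows "edge_trace N p h w i j (psi p w (address_point p \<omega>)) = trace_coded N p h w \<omega>"
  unfolding edge_trace_def
proof (rule the_equality)
  have S: "range \<omega>' \<subseteq> S" if "range \<omega>' \<subseteq> {i, j}" for \<omega>' using that ij by auto
  show "\<exists>\<omega>'. range \<omega>' \<subseteq> {i, j} \<and> coding_point N p w \<omega>' = psi p w (address_point p \<omega>) \<and> trace_coded N p h w \<omega> = trace_coded N p h w \<omega>'"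
    using \<omega> coding_point_eq[OF S[OF \<omega>]] by blast
  fix d assume "\<exists>\<omega>'. range \<omega>' \<subseteq> {i, j} \<and> coding_point N p w \<omega>' = psi p w (address_point p \<omega>) \<and> d = trace_coded N p h w \<omega>'"
  then obtain \<omega>' where \<omega>': "range \<omega>' \<subseteq> {i, j}" "coding_point N p w \<omega>' = psi p w (address_point p \<omega>)"
    "d = trace_coded N p h w \<omega>'" by blast
  have "address_point p \<omega> = address_point p \<omega>'"
    using \<omega>'(2) unfolding coding_point_eq[OF S[OF \<omega>'(1)]] by simp
  hence "\<omega> = \<omega>'" using address_eqD[OF S[OF \<omega>] S[OF \<omega>'(1)]] nc by blast
  thus "d = trace_coded N p h w \<omega>" using \<omega>'(3) by simp
qed

lemma functional_sum_pos:
  assumes ij: "i \<in> S" "j \<in> S" "i \<noteq> j" and w: "set w \<subseteq> S"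
  shows "(\<Sum>k\<in>S. (edge_functional N (mu1 N) i j (restrs N w (unit_boundary k)))\<^sup>2) > 0"
proof (rule ccontr)
  assume "\<not> ?thesis"
  moreover have "(\<Sum>k\<in>S. (edge_functional N (mu1 N) i j (restrs N w (unit_boundary k)))\<^sup>2) \<ge> 0"
    by (intro sum_nonneg) simp
  ultimately have "(\<Sum>k\<in>S. (edge_functional N (mu1 N) i j (restrs N w (unit_boundary k)))\<^sup>2) = 0" by linarith
  hence "\<forall>k\<in>S. edge_functional N (mu1 N) i j (restrs N w (unit_boundary k)) = 0"
    by (subst (asm) sum_nonneg_eq_0_iff) auto
  hence "(1 :: real) = 0 \<and> (0 :: real) = 0"
    by (intro edge_functionals_independent[OF N_ge ij w]) simp
  thus False by simp
qed

text \<open>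
  The normalisations of the cell masses and the growth of the dominant component cancel in the
  quotient; the positive denominator in the limit is provided by \<open>functional_sum_pos\<close>.
\<close>

lemma trace_coded_eq:
  assumes h: "h \<in> harmonic N p" and w: "set w \<subseteq> S" and v: "set v \<subseteq> S" and ij: "i \<in> S" "j \<in> S" "i \<noteq> j"
  shows "trace_coded N p h w (prepend v (alternating i j)) =
     (edge_functional N (mu1 N) i j (restrs N (w @ v) (\<lambda>k. h (p k))))\<^sup>2 /
     (\<Sum>k\<in>S. (edge_functional N (mu1 N) i j (restrs N (w @ v) (unit_boundary k)))\<^sup>2)"
  unfolding trace_coded_def
proof (rule limI)
  let ?\<omega> = "prepend v (alternating i j)" and ?l = "edge_functional N (mu1 N) i j"
  let ?u = "\<lambda>k. h (p k)" and ?a = "\<lambda>n. map (alternating i j) [0..<n]"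
  let ?R = "\<lambda>n. measure (energy_measure N p h) (cell N p (w @ map ?\<omega> [0..<n])) /
              measure (kusuoka_measure N p) (cell N p (w @ map ?\<omega> [0..<n]))"
  define D where "D = (mu1 N / (real N + 3))\<^sup>2"
  have D: "D \<noteq> 0" using disc_gt_1[of N] by (simp add: D_def mu1_def)
  define E where "E u n = boundary_energy N (restrs N (?a n) (restrs N (w @ v) u)) / D ^ n" for u n
  have E: "E u \<longlonglongrightarrow> leading_coefficient N * (?l (restrs N (w @ v) u))\<^sup>2" for u
    unfolding E_def D_def by (rule boundary_energy_alternating_LIMSEQ[OF N_ge ij])
  have "?R (n + length v) = E ?u n / (\<Sum>k\<in>S. E (unit_boundary k) n)" for n
  proof -
    have c: "w @ map ?\<omega> [0..<n + length v] = (w @ v) @ ?a n" using map_prepend[of v "alternating i j" n] by (simp add: add.commute)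
    have s: "set ((w @ v) @ ?a n) \<subseteq> S" using w v ij set_map_alternating[of i j n] by auto
    have f: "restrs N ((w @ v) @ ?a n) u = restrs N (?a n) (restrs N (w @ v) u)" for u by (simp only: fold_append o_apply)
    let ?C = "scale ^ length ((w @ v) @ ?a n) * 2 * D ^ n"
    have C: "?C \<noteq> 0" using D by simp
    have e: "boundary_energy N (restrs N (?a n) (restrs N (w @ v) u)) = E u n * D ^ n" for u
      using D by (simp add: E_def)
    have "measure (energy_measure N p h) (cell N p ((w @ v) @ ?a n)) = ?C * E ?u n"
      unfolding measure_energy_measure_cell[OF h s] f e by (simp only: mult_ac)
    moreover have "measure (kusuoka_measure N p) (cell N p ((w @ v) @ ?a n)) = ?C * (\<Sum>k\<in>S. E (unit_boundary k) n)"
      unfolding measure_kusuoka_cell[OF s] f e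
      unfolding sum_distrib_left by (simp only: mult_ac)
    ultimately show ?thesis unfolding c using nonzero_mult_divide_mult_cancel_left[OF C] by simp
  qed
  moreover have "(\<lambda>n. E ?u n / (\<Sum>k\<in>S. E (unit_boundary k) n)) \<longlonglongrightarrow>
     leading_coefficient N * (?l (restrs N (w @ v) ?u))\<^sup>2 /
     (\<Sum>k\<in>S. leading_coefficient N * (?l (restrs N (w @ v) (unit_boundary k)))\<^sup>2)"
  proof (intro tendsto_divide tendsto_sum E)
    have "(\<Sum>k\<in>S. (?l (restrs N (w @ v) (unit_boundary k)))\<^sup>2) > 0"
      by (rule functional_sum_pos[OF ij]) (use w v in auto)
    thus "(\<Sum>k\<in>S. leading_coefficient N * (?l (restrs N (w @ v) (unit_boundary k)))\<^sup>2) \<noteq> 0"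
      using leading_coefficient_pos[OF N_ge] unfolding sum_distrib_left[symmetric] by simp
  qed
  moreover have "leading_coefficient N * (?l (restrs N (w @ v) ?u))\<^sup>2 /
     (\<Sum>k\<in>S. leading_coefficient N * (?l (restrs N (w @ v) (unit_boundary k)))\<^sup>2) =
     (?l (restrs N (w @ v) ?u))\<^sup>2 / (\<Sum>k\<in>S. (?l (restrs N (w @ v) (unit_boundary k)))\<^sup>2)"
    using leading_coefficient_pos[OF N_ge] unfolding sum_distrib_left[symmetric] by simp
  ultimately have "(\<lambda>n. ?R (n + length v)) \<longlonglongrightarrow>
     (?l (restrs N (w @ v) ?u))\<^sup>2 / (\<Sum>k\<in>S. (?l (restrs N (w @ v) (unit_boundary k)))\<^sup>2)"
    by simp
  thus "?R \<longlonglongrightarrow> (?l (restrs N (w @ v) ?u))\<^sup>2 / (\<Sum>k\<in>S. (?l (restrs N (w @ v) (unit_boundary k)))\<^sup>2)"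
    by (rule LIMSEQ_offset)
qed

lemma edge_trace_alternating:
  assumes h: "h \<in> harmonic N p" and w: "set w \<subseteq> S" and v: "set v \<subseteq> {i, j}"
    and ij: "i \<in> S" "j \<in> S" "i \<noteq> j" and ab: "{a, b} = {i, j}"
  shows "edge_trace N p h w i j (psi p w (address_point p (prepend v (alternating a b)))) =
     (edge_functional N (mu1 N) a b (restrs N (w @ v) (\<lambda>k. h (p k))))\<^sup>2 /
     (\<Sum>k\<in>S. (edge_functional N (mu1 N) a b (restrs N (w @ v) (unit_boundary k)))\<^sup>2)"
proof -
  have abS: "a \<in> S" "b \<in> S" "a \<noteq> b" using ab ij by (auto simp: doubleton_eq_iff)
  have "range (prepend v (alternating a b)) \<subseteq> {i, j}"
    by (rule range_prepend[OF v]) (use range_alternating[of a b] ab in simp)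
  hence "edge_trace N p h w i j (psi p w (address_point p (prepend v (alternating a b)))) =
     trace_coded N p h w (prepend v (alternating a b))"
    by (rule edge_trace_eq[OF ij(1,2)]) (rule prepend_alternating_not_constant[OF abS(3)])
  also have "\<dots> = (edge_functional N (mu1 N) a b (restrs N (w @ v) (\<lambda>k. h (p k))))\<^sup>2 /
     (\<Sum>k\<in>S. (edge_functional N (mu1 N) a b (restrs N (w @ v) (unit_boundary k)))\<^sup>2)"
    by (rule trace_coded_eq[OF h w _ abS]) (use v ij in auto)
  finally show ?thesis .
qed

lemma alternating_distance:
  assumes v: "set v \<subseteq> S" and ij: "i \<in> S" "j \<in> S" "i \<noteq> j"
  obtains C where "C > 0" and "\<And>n. norm (psi p w (address_point p (prepend (v @ map (alternating i j) [0..<2 * n]) (alternating j i)))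
      - psi p w (address_point p (prepend v (alternating i j)))) = C * (1 / 4) ^ n"
proof
  let ?a = "\<lambda>n. map (alternating i j) [0..<2 * n]"
  let ?q = "address_point p (alternating i j)" and ?q' = "address_point p (alternating j i)"
  have rS: "range (alternating i j) \<subseteq> S" "range (alternating j i) \<subseteq> S"
    using range_alternating[of i j] range_alternating[of j i] ij by auto
  have "?q' \<noteq> ?q"
  proof
    assume "?q' = ?q"
    moreover have "alternating i j \<noteq> alternating j i"
      using ij(3) by (auto simp: alternating_def fun_eq_iff intro!: exI[of _ 0])
    ultimately obtain n b where "\<forall>m\<ge>n. alternating i j m = b" using address_eqD[OF rS] by metis
    hence "\<forall>m\<ge>n. prepend [] (alternating i j) m = b" by (simp add: prepend_def)
    thus False using prepend_alternating_not_constant[OF ij(3)] by blast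
  qed
  thus "(1 / 2) ^ (length w + length v) * norm (?q' - ?q) > 0" by simp
  fix n
  have "(\<lambda>k. alternating i j (k + 2 * n)) = alternating i j" by (simp add: alternating_def fun_eq_iff)
  hence q: "?q = psi p (?a n) ?q" using address_point_prefix[OF rS(1), of "2 * n"] by simp
  have "set (v @ ?a n) \<subseteq> S" using v set_map_alternating[of i j "2 * n"] ij by auto
  hence y: "address_point p (prepend (v @ ?a n) (alternating j i)) = psi p v (psi p (?a n) ?q')"
    by (simp add: address_point_prepend rS(2) psi_append)
  have x: "address_point p (prepend v (alternating i j)) = psi p v (psi p (?a n) ?q)"
    unfolding address_point_prepend[OF v rS(1)] q[symmetric] ..
  have "norm (psi p w (psi p v (psi p (?a n) ?q')) - psi p w (psi p v (psi p (?a n) ?q)))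
     = (1 / 2) ^ length w * ((1 / 2) ^ length v * ((1 / 2) ^ (2 * n) * norm (?q' - ?q)))"
    by (simp add: psi_diff)
  also have "(1 / 2 :: real) ^ (2 * n) = (1 / 4) ^ n" by (simp add: power_mult power2_eq_square)
  finally show "norm (psi p w (address_point p (prepend (v @ ?a n) (alternating j i)))
      - psi p w (address_point p (prepend v (alternating i j)))) = (1 / 2) ^ (length w + length v) * norm (?q' - ?q) * (1 / 4) ^ n"
    unfolding x y by (simp add: power_add mult_ac)
qed

text \<open>
  The assumption \<open>nz\<close> says that \<open>F t = (P + t M)\<^sup>2 / (\<Sum>k. (f k + t g k)\<^sup>2)\<close> has nonzero derivative at
  \<open>0\<close>. The points \<open>y n\<close> leave the address of \<open>x\<close> by repeating a letter after \<open>2 n\<close> alternating ones;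
  the trace there is \<open>F\<close> at an argument of the same order as \<open>|y n - x| powr gamma_exp N\<close>.
\<close>

lemma edge_limsup_pos:
  assumes h: "h \<in> harmonic N p" and w: "set w \<subseteq> S" and v: "set v \<subseteq> {i, j}" and ij: "i \<in> S" "j \<in> S" "i \<noteq> j"
  defines "P \<equiv> edge_functional N (mu1 N) i j (restrs N (w @ v) (\<lambda>k. h (p k)))"
    and "M \<equiv> edge_functional N (mu2 N) i j (restrs N (w @ v) (\<lambda>k. h (p k)))"
    and "f \<equiv> \<lambda>k. edge_functional N (mu1 N) i j (restrs N (w @ v) (unit_boundary k))"
    and "g \<equiv> \<lambda>k. edge_functional N (mu2 N) i j (restrs N (w @ v) (unit_boundary k))"
  assumes nz: "P \<noteq> 0" "M * (\<Sum>k\<in>S. (f k)\<^sup>2) - P * (\<Sum>k\<in>S. f k * g k) \<noteq> 0"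
  shows "\<exists>x\<in>edge p w i j. edge_limsup N p h w i j x > 0"
proof -
  have vS: "set v \<subseteq> S" and vw: "set (w @ v) \<subseteq> S" using v w ij by auto
  let ?a = "\<lambda>n. map (alternating i j) [0..<2 * n]"
  define x where "x = psi p w (address_point p (prepend v (alternating i j)))"
  define y where "y n = psi p w (address_point p (prepend (v @ ?a n) (alternating j i)))" for n
  have va: "set (v @ ?a n) \<subseteq> {i, j}" for n using v set_map_alternating[of i j "2 * n"] by auto
  have x_edge: "x \<in> edge p w i j"
    unfolding x_def edge_def by (intro imageI address_in_segment range_prepend v range_alternating ij)
  have y_edge: "y n \<in> edge p w i j" for n
    unfolding y_def edge_def
    by (intro imageI address_in_segment range_prepend va ij) (use range_alternating[of j i] in auto)
  define F where "F t = (P + t * M)\<^sup>2 / (\<Sum>k\<in>S. (f k + t * g k)\<^sup>2)" for t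
  have tx: "edge_trace N p h w i j x = F 0"
    unfolding x_def edge_trace_alternating[OF h w v ij refl] F_def P_def f_def by simp
  have ty: "edge_trace N p h w i j (y n) = F (flip_deviation N n)" for n
  proof -
    define r where "r = - flip_coeff N * (mu1 N / (real N + 3)) ^ (2 * n)"
    have r: "r \<noteq> 0" using flip_coeff_pos[of N] mu_nonzero[of N] by (simp add: r_def)
    have key: "edge_functional N (mu1 N) j i (restrs N (w @ v @ ?a n) u) = r * (edge_functional N (mu1 N) i j
        (restrs N (w @ v) u) + flip_deviation N n * edge_functional N (mu2 N) i j (restrs N (w @ v) u))" for u
      using edge_functional_flip_alternating[OF N_ge ij, of n "restrs N (w @ v) u"] by (simp add: r_def)
    have "edge_trace N p h w i j (y n) = (r * (P + flip_deviation N n * M))\<^sup>2 / (\<Sum>k\<in>S. (r * (f k + flip_deviation N n * g k))\<^sup>2)"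
      unfolding y_def edge_trace_alternating[OF h w va ij insert_commute] key P_def M_def f_def g_def ..
    also have "\<dots> = F (flip_deviation N n)"
      unfolding power_mult_distrib sum_distrib_left[symmetric] F_def using r by simp
    finally show ?thesis .
  qed
  obtain C where C: "C > 0" and dist: "\<And>n. norm (y n - x) = C * (1 / 4) ^ n"
    unfolding x_def y_def using alternating_distance[OF vS ij] by metis
  have yx: "y n \<noteq> x" for n using dist[of n] C by auto
  have "(\<lambda>n. C * (1 / 4) ^ n) \<longlonglongrightarrow> C * 0"
    by (intro tendsto_mult tendsto_const LIMSEQ_power_zero) simp
  hence "(\<lambda>n. norm (y n - x)) \<longlonglongrightarrow> 0" unfolding dist by simp
  hence y_lim: "y \<longlonglongrightarrow> x" by (simp add: LIM_zero_iff tendsto_norm_zero_iff)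
  define F' where "F' = 2 * P * (M * (\<Sum>k\<in>S. (f k)\<^sup>2) - P * (\<Sum>k\<in>S. f k * g k)) / (\<Sum>k\<in>S. (f k)\<^sup>2)\<^sup>2"
  have pos: "(\<Sum>k\<in>S. (f k)\<^sup>2) > 0" unfolding f_def by (rule functional_sum_pos[OF ij vw])
  have F'0: "F' \<noteq> 0" using pos nz unfolding F'_def by simp
  have "(F has_real_derivative F') (at 0)"
    unfolding F_def[abs_def] F'_def by (rule quotient_derivative_at_0) (use pos in simp)
  hence "((\<lambda>t. (F t - F 0) / t) \<longlongrightarrow> F') (at 0)" by (simp add: DERIV_def)
  from filterlim_compose[OF this flip_deviation_filterlim]
  have quot: "(\<lambda>n. (F (flip_deviation N n) - F 0) / flip_deviation N n) \<longlonglongrightarrow> F'" .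
  define G where "G z = \<bar>edge_trace N p h w i j z - edge_trace N p h w i j x\<bar> / norm (z - x) powr gamma_exp N" for z
  define D where "D = (1 + flip_coeff N) / flip_coeff N / C powr gamma_exp N"
  have D: "D > 0" using flip_coeff_pos[of N] C by (simp add: D_def)
  have G: "G (y n) = \<bar>(F (flip_deviation N n) - F 0) / flip_deviation N n\<bar> * D" for n
  proof -
    define q where "q = ((mu2 N / mu1 N)\<^sup>2) ^ n"
    have q: "q > 0" using mu_nonzero[of N] by (simp add: q_def)
    have "((1 / 4 :: real) ^ n) powr gamma_exp N = ((1 / 4) powr gamma_exp N) ^ n" for n
    proof (induction n)
      case (Suc n)
      have "((1 / 4 :: real) ^ Suc n) powr gamma_exp N = (1 / 4) powr gamma_exp N * ((1 / 4) ^ n) powr gamma_exp N"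
        unfolding power_Suc by (rule powr_mult)
      thus ?case unfolding Suc power_Suc .
    qed simp
    hence "norm (y n - x) powr gamma_exp N = C powr gamma_exp N * q"
      unfolding dist q_def gamma_exp_powr[symmetric] using C by (subst powr_mult) auto
    moreover have "\<bar>flip_deviation N n\<bar> = (1 + flip_coeff N) / flip_coeff N * q"
      using flip_coeff_pos[of N] q by (simp add: flip_deviation_def q_def abs_mult)
    ultimately show ?thesis
      unfolding G_def tx ty D_def abs_divide using flip_coeff_pos[of N] q C by simp
  qed
  have "(\<lambda>n. G (y n)) \<longlonglongrightarrow> \<bar>F'\<bar> * D"
    unfolding G by (intro tendsto_mult tendsto_rabs quot tendsto_const)
  moreover have "\<bar>F'\<bar> * D > 0" using F'0 D by simp
  ultimately have "Limsup (at x within edge p w i j) (\<lambda>z. ereal (G z)) > 0"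
    by (rule Limsup_pos_sequence[OF y_edge yx y_lim])
  hence "edge_limsup N p h w i j x > 0" by (simp add: edge_limsup_def G_def)
  thus ?thesis using x_edge by blast
qed

text \<open>
  Replacing the prefix \<open>v\<close> changes the pair \<open>l\<^sub>1, l\<^sub>2\<close> to another basis of the plane of functionals.
  By \<open>gram_change_of_basis\<close> the derivative vanishes for at most two directions of the first basis
  vector, and the three prefixes \<open>[]\<close>, \<open>[j]\<close>, \<open>[i]\<close> yield three different directions.
\<close>

lemma edge_limsup_pos_of_ends_distinct:
  assumes h: "h \<in> harmonic N p" and w: "set w \<subseteq> S" and ij: "i \<in> S" "j \<in> S" "i \<noteq> j"
    and ends: "restrs N w (\<lambda>k. h (p k)) i \<noteq> restrs N w (\<lambda>k. h (p k)) j"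
  shows "\<exists>x\<in>edge p w i j. edge_limsup N p h w i j x > 0"
proof -
  let ?u = "\<lambda>k. h (p k)"
  let ?l = "\<lambda>\<mu> z. edge_functional N \<mu> i j z"
  define P where "P = ?l (mu1 N) (restrs N w ?u)"
  define M where "M = ?l (mu2 N) (restrs N w ?u)"
  define f where "f k = ?l (mu1 N) (restrs N w (unit_boundary k))" for k
  define g where "g k = ?l (mu2 N) (restrs N w (unit_boundary k))" for k
  define c where "c = flip_coeff N"
  define r1 where "r1 = mu1 N / (real N + 3)"
  define r2 where "r2 = mu2 N / (real N + 3)"
  have d: "disc N > 1" by (rule disc_gt_1)
  have c: "c > 0" unfolding c_def by (rule flip_coeff_pos)
  have r: "r1 < 0" "r2 > 0" using d by (simp_all add: r1_def r2_def mu1_def mu2_def divide_simps)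
  have PM: "P \<noteq> 0 \<or> M \<noteq> 0"
  proof -
    have "M - P = (mu1 N - mu2 N) * (restrs N w ?u j - restrs N w ?u i)"
      by (simp add: P_def M_def edge_functional_def algebra_simps)
    moreover have "mu1 N - mu2 N \<noteq> 0" using d by (simp add: mu1_def mu2_def field_simps)
    ultimately have "M - P \<noteq> 0" using ends by simp
    thus ?thesis by auto
  qed
  define P' where "P' = (\<Sum>k\<in>S. f k * f k) * M - (\<Sum>k\<in>S. f k * g k) * P"
  define M' where "M' = (\<Sum>k\<in>S. f k * g k) * M - (\<Sum>k\<in>S. g k * g k) * P"
  have PM': "P' \<noteq> 0 \<or> M' \<noteq> 0"
    unfolding P'_def M'_def
  proof (rule gram_nonzero[OF finite_letters PM])
    fix x y assume "\<And>k. k \<in> S \<Longrightarrow> x * f k + y * g k = 0"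
    thus "x = 0 \<and> y = 0" unfolding f_def g_def by (rule edge_functionals_independent[OF N_ge ij w])
  qed
  have case_v: "\<exists>x\<in>edge p w i j. edge_limsup N p h w i j x > 0"
    if v: "set v \<subseteq> {i, j}"
      and l1: "\<And>u. ?l (mu1 N) (restrs N (w @ v) u) = x * ?l (mu1 N) (restrs N w u) + y * ?l (mu2 N) (restrs N w u)"
      and l2: "\<And>u. ?l (mu2 N) (restrs N (w @ v) u) = x' * ?l (mu1 N) (restrs N w u) + y' * ?l (mu2 N) (restrs N w u)"
      and det: "x * y' - x' * y \<noteq> 0" and nz: "x * P + y * M \<noteq> 0" "x * P' + y * M' \<noteq> 0"
    for v x y x' y'
  proof (rule edge_limsup_pos[OF h w v ij])
    show "?l (mu1 N) (restrs N (w @ v) ?u) \<noteq> 0" unfolding l1 using nz(1) unfolding P_def M_def .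
    have "(x' * P + y' * M) * (\<Sum>k\<in>S. (x * f k + y * g k)\<^sup>2)
      - (x * P + y * M) * (\<Sum>k\<in>S. (x * f k + y * g k) * (x' * f k + y' * g k)) \<noteq> 0"
      unfolding gram_change_of_basis P'_def[symmetric] M'_def[symmetric] using det nz(2) by simp
    thus "?l (mu2 N) (restrs N (w @ v) ?u) * (\<Sum>k\<in>S. (?l (mu1 N) (restrs N (w @ v) (unit_boundary k)))\<^sup>2)
      - ?l (mu1 N) (restrs N (w @ v) ?u) * (\<Sum>k\<in>S. ?l (mu1 N) (restrs N (w @ v) (unit_boundary k)) * ?l (mu2 N) (restrs N (w @ v) (unit_boundary k))) \<noteq> 0"
      unfolding l1 l2 P_def M_def f_def g_def .
  qed
  have app: "restrs N (w @ [a]) u = restr N a (restrs N w u)" for a u by simp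
  have flip1: "edge_functional N (mu1 N) a b z = - c * edge_functional N (mu1 N) b a z + (1 + c) * edge_functional N (mu2 N) b a z"
    and flip2: "edge_functional N (mu2 N) a b z = (1 - c) * edge_functional N (mu1 N) b a z + c * edge_functional N (mu2 N) b a z"
    if "a \<in> S" "b \<in> S" "a \<noteq> b" for a b z
    unfolding c_def
    by (rule edge_functional_flip1[OF N_ge that(2,1) that(3)[symmetric]],
        rule edge_functional_flip2[OF N_ge that(2,1) that(3)[symmetric]])
  have R: "edge_functional N (mu1 N) b a (restr N a z) = r1 * edge_functional N (mu1 N) a b z"
    "edge_functional N (mu2 N) b a (restr N a z) = r2 * edge_functional N (mu2 N) a b z"
    if "a \<in> S" "b \<in> S" "a \<noteq> b" for a b z
    using edge_functional_restr[OF N_ge that mu_roots(1)] edge_functional_restr[OF N_ge that mu_roots(2)]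
    by (simp_all add: r1_def r2_def)
  have "(P \<noteq> 0 \<and> P' \<noteq> 0)
     \<or> ((- c * r1) * P + ((1 + c) * r1) * M \<noteq> 0 \<and> (- c * r1) * P' + ((1 + c) * r1) * M' \<noteq> 0)
     \<or> ((- c * r1) * P + ((1 + c) * r2) * M \<noteq> 0 \<and> (- c * r1) * P' + ((1 + c) * r2) * M' \<noteq> 0)"
  proof (rule linear_forms_choice[OF PM PM'])
    have "(- c * r1) * ((1 + c) * r2) - (- c * r1) * ((1 + c) * r1) = c * (1 + c) * r1 * (r1 - r2)"
      by (simp add: algebra_simps)
    thus "(- c * r1) * ((1 + c) * r2) - (- c * r1) * ((1 + c) * r1) \<noteq> 0" using c r by simp
  qed (use c r in auto)
  then consider "P \<noteq> 0" "P' \<noteq> 0"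
    | "(- c * r1) * P + ((1 + c) * r1) * M \<noteq> 0" "(- c * r1) * P' + ((1 + c) * r1) * M' \<noteq> 0"
    | "(- c * r1) * P + ((1 + c) * r2) * M \<noteq> 0" "(- c * r1) * P' + ((1 + c) * r2) * M' \<noteq> 0"
    by blast
  thus ?thesis
  proof cases
    case 1
    show ?thesis by (rule case_v[of "[]" 1 0 0 1]) (use 1 in auto)
  next
    case 2
    show ?thesis
    proof (rule case_v[OF _ _ _ _ 2])
      show "set [j] \<subseteq> {i, j}" by simp
      show "?l (mu1 N) (restrs N (w @ [j]) u) = (- c * r1) * ?l (mu1 N) (restrs N w u) + ((1 + c) * r1) * ?l (mu2 N) (restrs N w u)" for u
        unfolding app R[OF ij(2,1) ij(3)[symmetric]] flip1[OF ij(2,1) ij(3)[symmetric]] by (simp add: algebra_simps)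
      show "?l (mu2 N) (restrs N (w @ [j]) u) = ((1 - c) * r2) * ?l (mu1 N) (restrs N w u) + (c * r2) * ?l (mu2 N) (restrs N w u)" for u
        unfolding app R[OF ij(2,1) ij(3)[symmetric]] flip2[OF ij(2,1) ij(3)[symmetric]] by (simp add: algebra_simps)
      have "- c * r1 * (c * r2) - (1 - c) * r2 * ((1 + c) * r1) = - (r1 * r2)" by (simp add: algebra_simps)
      thus "- c * r1 * (c * r2) - (1 - c) * r2 * ((1 + c) * r1) \<noteq> 0" using r by simp
    qed
  next
    case 3
    show ?thesis
    proof (rule case_v[OF _ _ _ _ 3])
      show "set [i] \<subseteq> {i, j}" by simp
      show "?l (mu1 N) (restrs N (w @ [i]) u) = (- c * r1) * ?l (mu1 N) (restrs N w u) + ((1 + c) * r2) * ?l (mu2 N) (restrs N w u)" for u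
        unfolding app flip1[OF ij] R[OF ij] by (simp add: algebra_simps)
      show "?l (mu2 N) (restrs N (w @ [i]) u) = ((1 - c) * r1) * ?l (mu1 N) (restrs N w u) + (c * r2) * ?l (mu2 N) (restrs N w u)" for u
        unfolding app flip2[OF ij] R[OF ij] by (simp add: algebra_simps)
      have "- c * r1 * (c * r2) - (1 - c) * r1 * ((1 + c) * r2) = - (r1 * r2)" by (simp add: algebra_simps)
      thus "- c * r1 * (c * r2) - (1 - c) * r1 * ((1 + c) * r2) \<noteq> 0" using r by simp
    qed
  qed
qed

lemma edge_limsup_pos_nonconstant:
  assumes h: "h \<in> harmonic N p" and w: "set w \<subseteq> S" and nc: "\<not> h constant_on K"
  shows "\<exists>i\<in>S. \<exists>j\<in>S. i \<noteq> j \<and> (\<exists>x\<in>edge p w i j. edge_limsup N p h w i j x > 0)"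
proof -
  let ?v = "restrs N w (\<lambda>k. h (p k))"
  have "\<exists>i\<in>S. \<exists>j\<in>S. ?v i \<noteq> ?v j"
  proof (rule ccontr)
    assume "\<not> ?thesis"
    hence c: "?v k = ?v (Suc 0)" if "k \<in> S" for k using that one_in_letters by blast
    have "h (p k) = ?v (Suc 0)" if "k \<in> S" for k
      by (rule restrs_const_imp_const[OF w _ that]) (rule c)
    hence "h x = ?v (Suc 0)" if "x \<in> K" for x using harmonic_const_boundary[OF h _ that] by blast
    thus False using nc by (auto simp: constant_on_def)
  qed
  then obtain i j where "i \<in> S" "j \<in> S" "?v i \<noteq> ?v j" by blast
  moreover from this have "i \<noteq> j" by auto
  ultimately show ?thesis using edge_limsup_pos_of_ends_distinct[OF h w] by blast
qed

lemma ex_harmonic_edge_limsup_pos: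
  assumes w: "set w \<subseteq> S" and ij: "i \<in> S" "j \<in> S" "i \<noteq> j"
  shows "\<exists>h\<in>harmonic N p. \<exists>x\<in>edge p w i j. edge_limsup N p h w i j x > 0"
proof -
  obtain u where u: "\<forall>k. restrs N w u k = unit_boundary j k" using restrs_surj[OF w] by blast
  have "restrs N w (\<lambda>k. harmonic_extension u (p k)) l = unit_boundary j l" if "l \<in> S" for l
    using restrs_cong[OF w _ that, of "\<lambda>k. harmonic_extension u (p k)" u] u by (simp add: harmonic_extension_vertex)
  hence "restrs N w (\<lambda>k. harmonic_extension u (p k)) i \<noteq> restrs N w (\<lambda>k. harmonic_extension u (p k)) j"
    using ij by (simp add: unit_boundary_def)
  thus ?thesis
    using edge_limsup_pos_of_ends_distinct[OF harmonic_extension_harmonic w ij] harmonic_extension_harmonic by blast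
qed

end

theorem theorem2p4:
  fixes N :: nat and p :: "nat \<Rightarrow> real ^ 'n" and w :: "nat list"
  assumes "N \<ge> 2" and "CARD('n) = N"
    and "inj_on p (letters N)" and "\<not> affine_dependent (p ` letters N)"
    and "w \<in> words N"
  shows "(\<forall>h\<in>harmonic N p. \<not> h constant_on gasket N p \<longrightarrow>
            (\<exists>i\<in>letters N. \<exists>j\<in>letters N. i \<noteq> j \<and> (\<exists>x\<in>edge p w i j. edge_limsup N p h w i j x > 0)))
       \<and> (\<forall>i\<in>letters N. \<forall>j\<in>letters N. i \<noteq> j \<longrightarrow>
            (\<exists>h\<in>harmonic N p. \<exists>x\<in>edge p w i j. edge_limsup N p h w i j x > 0))"
proof -
  interpret sierpinski N p by unfold_locales (use assms in auto)
  have w: "set w \<subseteq> letters N" using assms(5) by (simp add: words_def lists_eq_set)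
  show ?thesis
    using edge_limsup_pos_nonconstant[OF _ w] ex_harmonic_edge_limsup_pos[OF w] by blast
qed

end
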